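(* Let $\alpha\geq 0$ and let $a,b,\gamma>0$. Let $f\in L^2_\alpha(\mathbb{R}^+)$ be such that $\mathrm{supp}\,\mathcal{F}_\alpha(f)\subset[0,b]$. If $\Omega$ is a $(\gamma,a)$-relatively dense subset of $\mathbb{R}^+$, then $$\|f\|^2_{L^2_\alpha(\Omega)}\ \geq\ \frac{2}{3}\left(\frac{\gamma}{300\times 9^\alpha}\right)^{\frac{160\sqrt{3}\,\pi}{\ln 2}\,ab+\alpha\frac{\ln 3}{\ln 2}+1}\|f\|^2_{L^2_\alpha}.$$
   Context: Here $\mathbb{R}^+=[0,\infty)$. For $\alpha>-1/2$, let $d\mu_\alpha(x)=\frac{2\pi^{\alpha+1}}{\Gamma(\alpha+1)}x^{2\alpha+1}\,dx$ on $\mathbb{R}^+$. For $1\le p<\infty$, $L^p_\alpha(\mathbb{R}^+)$ is the space of (complex-valued) measurable functions on $\mathbb{R}^+$ with $\|f\|_{L^p_\alpha}=\left(\int_0^\infty|f|^p\,d\mu_\alpha\right)^{1/p}<\infty$; for measurable $\Omega\subset\mathbb{R}^+$, $\|f\|^2_{L^2_\alpha(\Omega)}=\int_\Omega|f|^2\,d\mu_\alpha$. The Fourier-Bessel (Hankel) transform of $f\in L^1_\alpha(\mathbb{R}^+)$ is $\mathcal{F}_\alpha(f)(y)=\int_0^\infty f(x)\,j_\alpha(2\pi xy)\,d\mu_\alpha(x)$, where $j_\alpha(x)=\Gamma(\alpha+1)\sum_{n=0}^\infty\frac{(-1)^n}{n!\,\Gamma(n+\alpha+1)}\left(\frac{x}{2}\right)^{2n}$.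 It extends from $L^1_\alpha\cap L^2_\alpha$ to an isometry of $L^2_\alpha(\mathbb{R}^+)$, still denoted $\mathcal{F}_\alpha$. The condition $\mathrm{supp}\,\mathcal{F}_\alpha(f)\subset[0,b]$ means $\mathcal{F}_\alpha(f)=0$ almost everywhere outside $[0,b]$. Given $\gamma,a>0$, a measurable subset $\Omega\subset\mathbb{R}^+$ is $(\gamma,a)$-relatively dense if $\mu_\alpha(\Omega\cap[x-a,x+a])\geq\gamma\,\mu_\alpha([x-a,x+a])$ for all $x\geq a$. *)

theory Defs
  imports "HOL-Analysis.Analysis"
begin

definition mu :: "real \<Rightarrow> real measure" where
  "mu \<alpha> = density (lebesgue_on {0..})
     (\<lambda>x. ennreal (2 * pi powr (\<alpha> + 1) / Gamma (\<alpha> + 1) * x powr (2 * \<alpha> + 1)))"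

text \<open>Elements of \<open>Lp \<alpha> p\<close> are functions, not classes modulo equality almost everywhere;
  their values at negative arguments play no role.\<close>

definition Lp :: "real \<Rightarrow> real \<Rightarrow> (real \<Rightarrow> complex) set" where
  "Lp \<alpha> p = {f \<in> borel_measurable (mu \<alpha>). integrable (mu \<alpha>) (\<lambda>x. norm (f x) powr p)}"

definition Lp_norm_on :: "real \<Rightarrow> real \<Rightarrow> real set \<Rightarrow> (real \<Rightarrow> complex) \<Rightarrow> real" where
  "Lp_norm_on \<alpha> p \<Omega> f = (LINT x:\<Omega>|mu \<alpha>. norm (f x) powr p) powr (1 / p)"

abbreviation Lp_norm :: "real \<Rightarrow> real \<Rightarrow> (real \<Rightarrow> complex) \<Rightarrow> real" where
  "Lp_norm \<alpha> p f \<equiv> Lp_norm_on \<alpha> p {0..} f"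

text \<open>Membership in \<open>Lp\<close> is part of convergence, since the Bochner integral of a
  non-integrable function is \<open>0\<close> and the norm alone would not detect divergence.\<close>

definition tendsto_Lp ::
  "real \<Rightarrow> real \<Rightarrow> (nat \<Rightarrow> real \<Rightarrow> complex) \<Rightarrow> (real \<Rightarrow> complex) \<Rightarrow> bool" where
  "tendsto_Lp \<alpha> p F f \<longleftrightarrow>
     (\<forall>n. F n \<in> Lp \<alpha> p) \<and> f \<in> Lp \<alpha> p \<and>
     (\<lambda>n. Lp_norm \<alpha> p (\<lambda>x. F n x - f x)) \<longlonglongrightarrow> 0"

definition bessel_j :: "real \<Rightarrow> real \<Rightarrow> real" where
  "bessel_j \<alpha> x = Gamma (\<alpha> + 1) *
     (\<Sum>n. (-1) ^ n / (fact n * Gamma (real n + \<alpha> + 1)) * (x / 2) ^ (2 * n))"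

definition fourier_bessel :: "real \<Rightarrow> (real \<Rightarrow> complex) \<Rightarrow> real \<Rightarrow> complex" where
  "fourier_bessel \<alpha> f y =
     (LINT x|mu \<alpha>. f x * complex_of_real (bessel_j \<alpha> (2 * pi * x * y)))"

text \<open>The graph of the continuous extension of \<^const>\<open>fourier_bessel\<close> from
  \<open>L\<^sup>1 \<inter> L\<^sup>2\<close> to \<open>L\<^sup>2\<close>: \<open>g\<close> is a representative of the transform of \<open>f\<close>, which is
  determined only up to equality almost everywhere.\<close>

definition is_fourier_bessel_L2 ::
  "real \<Rightarrow> (real \<Rightarrow> complex) \<Rightarrow> (real \<Rightarrow> complex) \<Rightarrow> bool" where
  "is_fourier_bessel_L2 \<alpha> f g \<longleftrightarrow>
     (\<exists>F. (\<forall>n. F n \<in> Lp \<alpha> 1 \<inter> Lp \<alpha> 2) \<and> tendsto_Lp \<alpha> 2 F f \<and>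
          tendsto_Lp \<alpha> 2 (\<lambda>n. fourier_bessel \<alpha> (F n)) g)"

definition relatively_dense :: "real \<Rightarrow> real \<Rightarrow> real \<Rightarrow> real set \<Rightarrow> bool" where
  "relatively_dense \<alpha> \<gamma> a \<Omega> \<longleftrightarrow>
     \<Omega> \<in> sets (mu \<alpha>) \<and>
     (\<forall>x\<ge>a. measure (mu \<alpha>) (\<Omega> \<inter> {x - a..x + a}) \<ge> \<gamma> * measure (mu \<alpha>) {x - a..x + a})"

end

theory Submission
  imports Defs
begin

text \<open>
  Write \<open>t = x\<^sup>2\<close>. A function \<open>f\<close> whose transform \<open>g\<close> lives on \<open>[0, b]\<close> equals
  almost everywhere the transform of \<open>g\<close>, so that \<open>f x = F (x\<^sup>2)\<close> with \<open>F\<close> entire. Let \<open>F_k\<close> be the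
  \<open>k\<close>-th derivative of \<open>F\<close>. In the variable \<open>t\<close> each differentiation of the kernel raises its order by
  one: \<open>F_k (x\<^sup>2)\<close> is \<open>(- pi)\<^sup>k\<close> times the transform of order \<open>\<alpha> + k\<close> of the same \<open>g\<close>. The \<open>L\<^sup>2\<close>
  bound for the transform of order \<open>\<alpha> + k\<close> therefore is a Bernstein inequality: the norm of
  \<open>x\<^sup>k F_k (x\<^sup>2)\<close> is at most \<open>(pi b)\<^sup>k\<close> times the norm of \<open>f\<close> (\<open>hankel_bernstein\<close>).

  The line is cut into intervals \<open>I\<close> of length \<open>2 a\<close>. Let \<open>deriv_energy\<close> be the sum over \<open>k \<ge> 1\<close> of
  \<open>(x\<^sup>k F_k (x\<^sup>2))\<^sup>2 / (3 pi b)\<^sup>2\<^sup>k\<close>; by Bernstein its total integral is at most one eighth of the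
  squared norm of \<open>f\<close>. Either an interval carries at least \<open>3/8\<close> of its share of the squared norm as
  derivative energy, and such intervals together account for at most a third of the norm, which is
  the origin of the factor \<open>2/3\<close>. Or some point \<open>x0\<close> of \<open>I\<close>, away from \<open>0\<close>, has derivative energy at
  most the mean of \<open>f\<^sup>2\<close> over \<open>I\<close>. Then all derivatives of \<open>F\<close> at \<open>x0\<^sup>2\<close> grow at most geometrically, and
  Taylor expansion at that point controls the derivative of order \<open>n\<close> on all of \<open>I\<close>; as soon as \<open>n\<close>
  exceeds a multiple of \<open>a b\<close>, polynomial interpolation at \<open>n\<close> nodes determines \<open>F\<close> on \<open>I\<close> up to half
  the root mean square of \<open>f\<close>. Choosing the nodes in the part of \<open>\<Omega> \<inter> I\<close> where \<open>f\<^sup>2\<close> is at most twice its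
  mean, separated in measure, bounds the interpolation operator by a power of \<open>1/\<gamma>\<close> of order \<open>n - 1\<close>
  (\<open>interpolation_bound\<close>), and the local inequality \<open>local_estimate\<close> follows. Adding up both cases over
  all intervals gives \<open>global_estimate\<close>.

  What is needed of the transform, namely that it is bounded by \<open>1\<close> on \<open>L\<^sup>2\<close> and that it is inverse to
  itself on the pairs \<open>(f, g)\<close> at hand, comes from Gaussians: the transform of a Gaussian is an
  explicit Gaussian, the transform is isometric on their span, and a function is determined, with its
  norm, by its integrals against that span (\<open>norm_le_if_tested_on_gauss_sums\<close>). All of this is done for
  real-valued functions and applied to the real and the imaginary part of \<open>f\<close>.
\<close>

section \<open>Exponential power series\<close>

text \<open>The factorials make differentiation a shift of the coefficient sequence.\<close>

definition exp_series :: "(nat \<Rightarrow> real) \<Rightarrow> real \<Rightarrow> real" where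
  "exp_series A t = (\<Sum>n. A n / fact n * t ^ n)"

lemma exp_series_term_le:
  fixes A :: "nat \<Rightarrow> real" and K R t :: real
  assumes A: "\<And>n. \<bar>A n\<bar> \<le> K * R ^ n"
  shows "\<bar>A n / fact n * t ^ n\<bar> \<le> K * ((R * \<bar>t\<bar>) ^ n /\<^sub>R fact n)"
proof -
  have "\<bar>A n / fact n * t ^ n\<bar> = \<bar>A n\<bar> * (\<bar>t\<bar> ^ n / fact n)"
    by (simp add: abs_mult power_abs)
  also have "\<dots> \<le> (K * R ^ n) * (\<bar>t\<bar> ^ n / fact n)"
    by (intro mult_right_mono A) auto
  finally show ?thesis by (simp add: power_mult_distrib divide_inverse mult_ac)
qed

lemma summable_exp_series:
  fixes A :: "nat \<Rightarrow> real" and K R t :: real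
  assumes A: "\<And>n. \<bar>A n\<bar> \<le> K * R ^ n"
  shows "summable (\<lambda>n. A n / fact n * t ^ n)"
    and "summable (\<lambda>n. \<bar>A n / fact n * t ^ n\<bar>)"
proof -
  have s: "summable (\<lambda>n. K * ((R * \<bar>t\<bar>) ^ n /\<^sub>R fact n))"
    by (intro summable_mult sums_summable[OF exp_converges])
  show "summable (\<lambda>n. \<bar>A n / fact n * t ^ n\<bar>)"
    by (rule summable_comparison_test'[OF s, where N = 0]) (simp only: real_norm_def abs_abs exp_series_term_le[OF A])
  then show "summable (\<lambda>n. A n / fact n * t ^ n)" by (rule summable_rabs_cancel)
qed

lemma exp_series_bound:
  assumes A: "\<And>n. \<bar>A n\<bar> \<le> K * R ^ n"
  shows "\<bar>exp_series A t\<bar> \<le> K * exp (R * \<bar>t\<bar>)"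
proof -
  have s: "(\<lambda>n. K * ((R * \<bar>t\<bar>) ^ n /\<^sub>R fact n)) sums (K * exp (R * \<bar>t\<bar>))"
    by (intro sums_mult exp_converges)
  have "\<bar>exp_series A t\<bar> \<le> (\<Sum>n. \<bar>A n / fact n * t ^ n\<bar>)"
    unfolding exp_series_def by (rule summable_rabs, rule summable_exp_series(2)[OF A])
  also have "\<dots> \<le> (\<Sum>n. K * ((R * \<bar>t\<bar>) ^ n /\<^sub>R fact n))"
    by (intro suminf_le exp_series_term_le[OF A] summable_exp_series(2)[OF A] sums_summable[OF s])
  also have "\<dots> = K * exp (R * \<bar>t\<bar>)" by (rule sums_unique[OF s, symmetric])
  finally show ?thesis .
qed

lemma exp_series_deriv:
  assumes A: "\<And>n. \<bar>A n\<bar> \<le> K * R ^ n"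
  shows "(exp_series A has_real_derivative exp_series (\<lambda>n. A (Suc n)) t) (at t)"
proof -
  have "((\<lambda>t. \<Sum>n. A n / fact n * t ^ n) has_field_derivative
      (\<Sum>n. diffs (\<lambda>n. A n / fact n) n * t ^ n)) (at t)"
    by (rule termdiffs_strong_converges_everywhere, rule summable_exp_series(1)[OF A])
  moreover have "diffs (\<lambda>n. A n / fact n) n = A (Suc n) / fact n" for n
    by (simp add: diffs_def field_simps del: of_nat_Suc)
  ultimately show ?thesis by (simp add: exp_series_def[abs_def])
qed

lemma shifted_bound:
  fixes A :: "nat \<Rightarrow> real"
  assumes A: "\<And>n. \<bar>A n\<bar> \<le> K * R ^ n"
  shows "\<bar>A (n + k)\<bar> \<le> (K * R ^ k) * R ^ n"
  using A[of "n + k"] by (simp add: power_add mult_ac)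

lemma exp_series_shift_deriv:
  assumes A: "\<And>n. \<bar>A n\<bar> \<le> K * R ^ n"
  shows "(exp_series (\<lambda>n. A (n + k)) has_real_derivative exp_series (\<lambda>n. A (n + Suc k)) t) (at t)"
  using exp_series_deriv[of "\<lambda>n. A (n + k)", OF shifted_bound[OF A]] by simp

text \<open>At every point the derivatives grow at most geometrically in their order, by
  \<open>exp_series_bound\<close>, so the Lagrange remainder of the Taylor series at \<open>t0\<close>
  tends to \<open>0\<close>.\<close>

lemma exp_series_recentre:
  assumes A: "\<And>n. \<bar>A n\<bar> \<le> K * R ^ n" and R: "R \<ge> 0"
  shows "exp_series A t = exp_series (\<lambda>k. exp_series (\<lambda>n. A (n + k)) t0) (t - t0)"
proof -
  define D where "D k x = exp_series (\<lambda>n. A (n + k)) x" for k x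
  define x where "x = t - t0"
  have K: "K \<ge> 0" using A[of 0] by simp
  have der: "((\<lambda>x. D k (t0 + x)) has_real_derivative D (Suc k) (t0 + x)) (at x)" for k x
  proof -
    have "((\<lambda>x. t0 + x) has_real_derivative 1) (at x)"
      by (auto intro!: derivative_eq_intros)
    from DERIV_chain2[where f = "exp_series (\<lambda>n. A (n + k))" and g = "\<lambda>x. t0 + x",
        OF exp_series_shift_deriv[OF A, of k "t0 + x"] this]
    show ?thesis by (simp add: D_def)
  qed
  define C where "C = K * exp (R * (\<bar>t0\<bar> + \<bar>x\<bar>))"
  have rem: "\<bar>D 0 (t0 + x) - (\<Sum>m<n. D m t0 / fact m * x ^ m)\<bar> \<le> C * ((R * \<bar>x\<bar>) ^ n /\<^sub>R fact n)"
    for n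
  proof -
    obtain s where s: "\<bar>s\<bar> \<le> \<bar>x\<bar>"
      "D 0 (t0 + x) = (\<Sum>m<n. D m (t0 + 0) / fact m * x ^ m) + D n (t0 + s) / fact n * x ^ n"
      using Maclaurin_all_le[of "\<lambda>k x. D k (t0 + x)" "\<lambda>x. D 0 (t0 + x)" x n] der by auto
    have "\<bar>D n (t0 + s)\<bar> \<le> (K * R ^ n) * exp (R * \<bar>t0 + s\<bar>)"
      unfolding D_def by (rule exp_series_bound, rule shifted_bound[OF A])
    also have "\<dots> \<le> (K * R ^ n) * exp (R * (\<bar>t0\<bar> + \<bar>x\<bar>))"
      using s K R by (intro mult_left_mono) (auto intro!: mult_left_mono)
    finally have "\<bar>D n (t0 + s)\<bar> * (\<bar>x\<bar> ^ n / fact n)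
        \<le> (K * R ^ n) * exp (R * (\<bar>t0\<bar> + \<bar>x\<bar>)) * (\<bar>x\<bar> ^ n / fact n)"
      by (intro mult_right_mono) auto
    moreover have "D 0 (t0 + x) - (\<Sum>m<n. D m t0 / fact m * x ^ m) = D n (t0 + s) / fact n * x ^ n"
      using s(2) by simp
    then have "\<bar>D 0 (t0 + x) - (\<Sum>m<n. D m t0 / fact m * x ^ m)\<bar> = \<bar>D n (t0 + s)\<bar> * (\<bar>x\<bar> ^ n / fact n)"
      by (simp add: abs_mult power_abs)
    ultimately show ?thesis
      by (simp add: C_def power_mult_distrib divide_inverse mult_ac)
  qed
  have lim: "(\<lambda>n. C * ((R * \<bar>x\<bar>) ^ n /\<^sub>R fact n)) \<longlonglongrightarrow> 0"
    by (intro tendsto_mult_right_zero summable_LIMSEQ_zero sums_summable[OF exp_converges])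
  have "(\<lambda>n. D 0 (t0 + x) - (\<Sum>m<n. D m t0 / fact m * x ^ m)) \<longlonglongrightarrow> 0"
    by (rule Lim_null_comparison[OF _ lim], rule always_eventually) (simp only: real_norm_def rem, simp)
  then have "(\<lambda>n. D 0 (t0 + x) - (D 0 (t0 + x) - (\<Sum>m<n. D m t0 / fact m * x ^ m)))
      \<longlonglongrightarrow> D 0 (t0 + x) - 0"
    by (intro tendsto_diff tendsto_const)
  then have "(\<lambda>m. D m t0 / fact m * x ^ m) sums D 0 (t0 + x)"
    by (simp add: sums_def)
  then show ?thesis
    by (simp add: exp_series_def[of "\<lambda>k. exp_series (\<lambda>n. A (n + k)) t0"] sums_unique D_def x_def)
qed

text \<open>Geometric growth of the derivatives at a single point \<open>t0\<close> with small constants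
  \<open>M\<close>, \<open>q\<close> gives a bound near \<open>t0\<close> that no longer involves the
  crude constants \<open>K\<close>, \<open>R\<close>.\<close>

lemma exp_series_bound_from_point:
  assumes A: "\<And>n. \<bar>A n\<bar> \<le> K * R ^ n" and R: "R \<ge> 0"
    and t0: "\<And>k. \<bar>exp_series (\<lambda>n. A (n + k)) t0\<bar> \<le> M * q ^ k"
  shows "\<bar>exp_series A t\<bar> \<le> M * exp (q * \<bar>t - t0\<bar>)"
  unfolding exp_series_recentre[OF A R, of t t0] by (rule exp_series_bound[OF t0])

section \<open>The Bessel--Clifford function\<close>

definition bessel_coeff :: "real \<Rightarrow> nat \<Rightarrow> real" where
  "bessel_coeff nu n = (-1) ^ n / Gamma (real n + nu + 1)"

lemma Gamma_mono_nat:
  assumes "nu \<ge> 0"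
  shows "Gamma (real n + nu + 1) \<ge> Gamma (nu + 1)"
proof (induction n)
  case (Suc n)
  have "Gamma (real (Suc n) + nu + 1) = (real n + nu + 1) * Gamma (real n + nu + 1)"
    using Gamma_plus1[of "real n + nu + 1"] assms
    by (auto simp: nonpos_Ints_def add_ac)
  also have "\<dots> \<ge> 1 * Gamma (real n + nu + 1)"
    using assms by (intro mult_right_mono Gamma_real_nonneg) auto
  finally show ?case using Suc by simp
qed simp

lemma bessel_coeff_bound:
  assumes "nu \<ge> 0"
  shows "\<bar>bessel_coeff nu n\<bar> \<le> (1 / Gamma (nu + 1)) * 1 ^ n"
proof -
  have "Gamma (nu + 1) > 0" using assms by simp
  then show ?thesis using Gamma_mono_nat[OF assms, of n]
    by (auto simp: bessel_coeff_def abs_mult power_abs intro!: divide_left_mono)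
qed

text \<open>The Bessel--Clifford function at \<open>- s\<close>. In contrast to
  \<open>bessel_j\<close>, which is a multiple of it at \<open>s = x\<^sup>2 / 4\<close>, it is
  differentiated by raising the index.\<close>

definition bessel_clifford :: "real \<Rightarrow> real \<Rightarrow> real" where
  "bessel_clifford nu s = exp_series (bessel_coeff nu) s"

lemma bessel_clifford_deriv:
  assumes "nu \<ge> 0"
  shows "(bessel_clifford nu has_real_derivative - bessel_clifford (nu + 1) s) (at s)"
proof -
  have "exp_series (\<lambda>n. bessel_coeff nu (Suc n)) s = (\<Sum>n. - (bessel_coeff (nu + 1) n / fact n * s ^ n))"
    by (simp add: exp_series_def bessel_coeff_def add_ac)
  also have "\<dots> = - bessel_clifford (nu + 1) s"
    unfolding bessel_clifford_def exp_series_def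
    using summable_exp_series(1)[OF bessel_coeff_bound] assms by (intro suminf_minus) auto
  finally show ?thesis
    using exp_series_deriv[OF bessel_coeff_bound[OF assms], of s] by (simp add: bessel_clifford_def[abs_def])
qed

text \<open>Bessel's differential equation: the functions of index \<open>nu + 1\<close> and
  \<open>nu + 2\<close> are, up to sign, the first two derivatives.\<close>

lemma bessel_clifford_recurrence:
  assumes b: "nu \<ge> 0"
  shows "bessel_clifford nu s = (nu + 1) * bessel_clifford (nu + 1) s - s * bessel_clifford (nu + 2) s"
proof -
  let ?a = "\<lambda>nu n. bessel_coeff nu n / fact n * s ^ n"
  have s: "?a nu sums bessel_clifford nu s" if "nu \<ge> 0" for nu
    unfolding bessel_clifford_def exp_series_def
    using that by (intro summable_sums summable_exp_series(1)[OF bessel_coeff_bound])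
  have "(\<lambda>n. (nu + 1) * ?a (nu + 1) n - ?a nu n) sums ((nu + 1) * bessel_clifford (nu + 1) s - bessel_clifford nu s)"
    using b by (intro sums_diff sums_mult s) auto
  then have "(\<lambda>n. (nu + 1) * ?a (nu + 1) (Suc n) - ?a nu (Suc n)) sums
      ((nu + 1) * bessel_clifford (nu + 1) s - bessel_clifford nu s - ((nu + 1) * ?a (nu + 1) 0 - ?a nu 0))"
    by (subst sums_Suc_iff) simp
  moreover have "(nu + 1) * ?a (nu + 1) 0 - ?a nu 0 = 0"
  proof -
    have "Gamma (nu + 1 + 1) = (nu + 1) * Gamma (nu + 1)"
      using b by (intro Gamma_plus1) (auto simp: nonpos_Ints_def)
    then show ?thesis using b by (simp add: bessel_coeff_def)
  qed
  moreover have "(nu + 1) * ?a (nu + 1) (Suc n) - ?a nu (Suc n) = s * ?a (nu + 2) n" for n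
  proof -
    define G where "G = Gamma (real n + nu + 2)"
    have G: "G > 0" using b by (simp add: G_def)
    have "Gamma ((real n + nu + 2) + 1) = (real n + nu + 2) * G"
      using b unfolding G_def by (intro Gamma_plus1) (auto simp: nonpos_Ints_def)
    then have g: "Gamma (real n + nu + 3) = (real n + nu + 2) * G" by (simp add: add_ac)
    have 1: "bessel_coeff (nu + 1) (Suc n) = - ((-1) ^ n) / ((real n + nu + 2) * G)"
      "bessel_coeff nu (Suc n) = - ((-1) ^ n) / G"
      "bessel_coeff (nu + 2) n = (-1) ^ n / ((real n + nu + 2) * G)"
      using g by (simp_all add: bessel_coeff_def G_def add_ac)
    have nz: "real n + nu + 2 \<noteq> 0" using b by simp
    have "(nu + 1) * bessel_coeff (nu + 1) (Suc n) - bessel_coeff nu (Suc n)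
        = (real n + 1) * bessel_coeff (nu + 2) n"
      unfolding 1 using G nz by (simp add: divide_simps; simp add: algebra_simps)
    then have "((nu + 1) * bessel_coeff (nu + 1) (Suc n) - bessel_coeff nu (Suc n)) * (s ^ Suc n / fact (Suc n))
        = (real n + 1) * bessel_coeff (nu + 2) n * (s ^ Suc n / fact (Suc n))" by simp
    also have "\<dots> = s * ?a (nu + 2) n" by (simp add: divide_simps)
    finally show ?thesis by (simp only: left_diff_distrib) (simp add: mult_ac)
  qed
  ultimately have "(\<lambda>n. s * ?a (nu + 2) n) sums ((nu + 1) * bessel_clifford (nu + 1) s - bessel_clifford nu s)"
    by simp
  moreover have "(\<lambda>n. s * ?a (nu + 2) n) sums (s * bessel_clifford (nu + 2) s)"
    using b by (intro sums_mult s) auto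
  ultimately show ?thesis using sums_unique2 by fastforce
qed

lemma bessel_clifford_0: "bessel_clifford nu 0 = 1 / Gamma (nu + 1)"
  using powser_zero[of "\<lambda>n. bessel_coeff nu n / fact n"]
  by (simp add: bessel_clifford_def exp_series_def bessel_coeff_def)

text \<open>With \<open>u\<close> and \<open>v\<close> the functions of index \<open>nu\<close> and
  \<open>nu + 1\<close>, the energy \<open>u\<^sup>2 + s v\<^sup>2\<close> is non-increasing, because
  Bessel's equation makes its derivative \<open>- (2 nu + 1) v\<^sup>2\<close>; for
  \<open>s \<ge> 0\<close> it dominates \<open>u\<^sup>2\<close>.\<close>

lemma bessel_clifford_le:
  assumes b: "nu \<ge> 0" and s: "s \<ge> 0"
  shows "\<bar>Gamma (nu + 1) * bessel_clifford nu s\<bar> \<le> 1"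
proof -
  define E where "E s = (bessel_clifford nu s)^2 + s * (bessel_clifford (nu + 1) s)^2" for s
  have "\<exists>D. (E has_real_derivative D) (at x) \<and> D \<le> 0" for x
  proof -
    let ?u = "bessel_clifford nu x" and ?v = "bessel_clifford (nu + 1) x" and ?w = "bessel_clifford (nu + 2) x"
    have "(E has_real_derivative (2 * ?u * (- ?v) + (?v\<^sup>2 + x * (2 * ?v * (- ?w))))) (at x)"
      unfolding E_def using b bessel_clifford_deriv[of nu x] bessel_clifford_deriv[of "nu + 1" x]
      by (auto intro!: derivative_eq_intros simp: add.assoc)
    moreover have "2 * ?u * (- ?v) + (?v\<^sup>2 + x * (2 * ?v * (- ?w))) = - ((2 * nu + 1) * ?v\<^sup>2)"
      unfolding bessel_clifford_recurrence[OF b, of x] by (simp add: algebra_simps power2_eq_square)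
    moreover have "- ((2 * nu + 1) * ?v\<^sup>2) \<le> 0" using b by simp
    ultimately show ?thesis by metis
  qed
  then have "E s \<le> E 0"
    using DERIV_nonpos_imp_nonincreasing[OF s, of E] by blast
  moreover have "s * (bessel_clifford (nu + 1) s)^2 \<ge> 0" using s by simp
  ultimately have "(bessel_clifford nu s)^2 \<le> (1 / Gamma (nu + 1))^2"
    unfolding E_def bessel_clifford_0 by linarith
  moreover have G: "Gamma (nu + 1) > 0" using b by simp
  ultimately have "\<bar>bessel_clifford nu s\<bar> \<le> 1 / Gamma (nu + 1)"
    by (simp add: abs_le_square_iff[symmetric])
  then show ?thesis using G by (simp add: abs_mult field_simps)
qed

lemma bessel_j_eq: "bessel_j nu x = Gamma (nu + 1) * bessel_clifford nu ((x / 2)^2)"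
  unfolding bessel_j_def bessel_clifford_def exp_series_def bessel_coeff_def power_mult
  by (simp add: mult.commute)

lemma bessel_j_le_1: "nu \<ge> 0 \<Longrightarrow> \<bar>bessel_j nu x\<bar> \<le> 1"
  unfolding bessel_j_eq by (rule bessel_clifford_le) auto

lemma continuous_bessel_j: "nu \<ge> 0 \<Longrightarrow> continuous_on UNIV (bessel_j nu)"
proof -
  assume b: "nu \<ge> 0"
  have "continuous_on UNIV (bessel_clifford nu)"
    by (intro continuous_at_imp_continuous_on ballI DERIV_isCont[OF bessel_clifford_deriv[OF b]])
  then have "continuous_on UNIV (\<lambda>x. bessel_clifford nu ((x / 2)^2))"
    by (rule continuous_on_compose2) (auto intro!: continuous_intros)
  then have "continuous_on UNIV (\<lambda>x. Gamma (nu + 1) * bessel_clifford nu ((x / 2)^2))"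
    by (intro continuous_intros)
  then show ?thesis by (simp add: bessel_j_eq[abs_def])
qed

section \<open>The weighted measure\<close>

definition weight :: "real \<Rightarrow> real \<Rightarrow> real" where
  "weight nu x = 2 * pi powr (nu + 1) / Gamma (nu + 1) * x powr (2 * nu + 1)"

lemma weight_nonneg: "nu \<ge> 0 \<Longrightarrow> weight nu x \<ge> 0"
  by (simp add: weight_def)

lemma weight_measurable [measurable]: "weight nu \<in> borel_measurable borel"
  unfolding weight_def by measurable

lemma mu_eq_density_weight: "mu nu = density (lebesgue_on {0..}) (\<lambda>x. ennreal (weight nu x))"
  by (simp add: mu_def weight_def)

lemma space_mu [simp]: "space (mu nu) = {0..}"
  by (simp add: mu_def)

lemma sets_mu: "sets (mu nu) = sets (lebesgue_on {0..})"
  by (simp add: mu_def)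

lemma measurable_mu: "borel_measurable (mu nu) = borel_measurable (lebesgue_on {0..})"
  by (rule measurable_cong_sets) (simp_all add: sets_mu)

lemma measurable_borel_lebesgue_on: "f \<in> borel_measurable borel \<Longrightarrow> f \<in> borel_measurable (lebesgue_on S)"
  by (intro measurable_restrict_space1 measurable_completion) simp

lemma measurable_borel_mu: "f \<in> borel_measurable borel \<Longrightarrow> f \<in> borel_measurable (mu nu)"
  by (simp add: measurable_mu measurable_borel_lebesgue_on)

lemma measurable_id_mu [measurable]: "(\<lambda>x. x) \<in> borel_measurable (mu nu)"
  by (rule measurable_borel_mu) simp

lemma sets_borel_mu: "S \<in> sets borel \<Longrightarrow> S \<subseteq> {0..} \<Longrightarrow> S \<in> sets (mu nu)"
  unfolding sets_mu by (subst sets_restrict_space_iff) (auto simp: sets_completionI_sets)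

lemma sigma_finite_mu: "nu \<ge> 0 \<Longrightarrow> sigma_finite_measure (mu nu)"
proof -
  obtain A :: "real set set" where A: "countable A" "A \<subseteq> sets lborel" "\<Union>A = space lborel"
      "\<And>a. a \<in> A \<Longrightarrow> emeasure lborel a \<noteq> \<infinity>"
    using lborel.sigma_finite_countable by metis
  have "sigma_finite_measure (lebesgue :: real measure)"
  proof
    show "\<exists>A::real set set. countable A \<and> A \<subseteq> sets lebesgue \<and> \<Union>A = space lebesgue \<and>
        (\<forall>a\<in>A. emeasure lebesgue a \<noteq> \<infinity>)"
      using A by (intro exI[of _ A]) (auto simp: subset_iff)
  qed
  then interpret L: sigma_finite_measure "lebesgue_on {0::real..}"
    by (intro sigma_finite_measure_restrict_space) auto
  have "(\<lambda>x. ennreal (weight nu x)) \<in> borel_measurable (lebesgue_on {0..})"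
    by (intro measurable_borel_lebesgue_on) measurable
  then show ?thesis unfolding mu_eq_density_weight
    by (subst L.sigma_finite_iff_density_finite) auto
qed

lemma pair_sigma_finite_mu: "nu \<ge> 0 \<Longrightarrow> pair_sigma_finite (mu nu) (mu nu)"
  by (intro pair_sigma_finite.intro sigma_finite_mu)

lemma AE_mu_of_negligible:
  assumes "negligible N"
  shows "AE x in mu nu. x \<notin> N"
proof -
  have "N \<in> null_sets lebesgue" using assms by (simp add: negligible_iff_null_sets)
  then have "AE x in lebesgue. x \<notin> N" by (rule AE_not_in)
  then have "AE x in lebesgue_on {0..}. x \<notin> N"
    by (subst AE_restrict_space_iff) auto
  then show ?thesis unfolding mu_eq_density_weight
    by (subst AE_density) (auto intro!: measurable_borel_lebesgue_on)
qed

text \<open>Raising the order of the measure multiplies the density by an even power of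
  \<open>x\<close>. This absorbs the powers that appear when the kernel is differentiated.\<close>

lemma mu_shift:
  assumes "nu \<ge> 0"
  shows "mu (nu + real k) = density (mu nu)
    (\<lambda>x. ennreal (pi ^ k * Gamma (nu + 1) / Gamma (nu + real k + 1) * x ^ (2 * k)))"
proof -
  let ?c = "\<lambda>x::real. pi ^ k * Gamma (nu + 1) / Gamma (nu + real k + 1) * x ^ (2 * k)"
  have G: "Gamma (nu + 1) > 0" "Gamma (nu + real k + 1) > 0" using assms by simp_all
  have eq: "weight (nu + real k) x = weight nu x * ?c x" if "x \<ge> 0" for x
  proof (cases "x = 0")
    case False
    then have x: "x > 0" using that by simp
    have "x powr (2 * (nu + real k) + 1) = x powr ((2 * nu + 1) + real (2 * k))"
      by (simp add: algebra_simps)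
    also have "\<dots> = x powr (2 * nu + 1) * x ^ (2 * k)"
      using x by (simp only: powr_add powr_realpow)
    finally have 1: "x powr (2 * (nu + real k) + 1) = x powr (2 * nu + 1) * x ^ (2 * k)" .
    have "pi powr (nu + real k + 1) = pi powr ((nu + 1) + real k)" by (simp add: algebra_simps)
    also have "\<dots> = pi powr (nu + 1) * pi ^ k" by (simp only: powr_add powr_realpow pi_gt_zero)
    finally have 2: "pi powr (nu + real k + 1) = pi powr (nu + 1) * pi ^ k" .
    show ?thesis unfolding weight_def 1 2 using G by simp
  qed (use assms in \<open>simp add: weight_def\<close>)
  have "density (mu nu) (\<lambda>x. ennreal (?c x)) =
      density (lebesgue_on {0..}) (\<lambda>x. ennreal (weight nu x) * ennreal (?c x))"
    unfolding mu_eq_density_weight by (intro density_density_eq measurable_borel_lebesgue_on) measurable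
  also have "\<dots> = density (lebesgue_on {0..}) (\<lambda>x. ennreal (weight (nu + real k) x))"
  proof (intro density_cong measurable_borel_lebesgue_on)
    show "AE x in lebesgue_on {0..}. ennreal (weight nu x) * ennreal (?c x) = ennreal (weight (nu + real k) x)"
      using assms by (intro AE_I2) (simp only: ennreal_mult'[symmetric] weight_nonneg eq, simp add: eq)
  qed measurable
  finally show ?thesis by (simp add: mu_eq_density_weight)
qed

definition shift_const :: "real \<Rightarrow> nat \<Rightarrow> real" where
  "shift_const nu k = pi ^ k * Gamma (nu + 1) / Gamma (nu + real k + 1)"

lemma shift_const_pos: "nu \<ge> 0 \<Longrightarrow> shift_const nu k > 0"
  by (simp add: shift_const_def)

lemma integral_mu_shift:
  fixes f :: "real \<Rightarrow> real"
  assumes a: "nu \<ge> 0" and f: "f \<in> borel_measurable (mu nu)"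
  shows "integrable (mu (nu + real k)) f \<longleftrightarrow> integrable (mu nu) (\<lambda>x. shift_const nu k * x ^ (2 * k) * f x)"
    and "(LINT x|mu (nu + real k). f x) = (LINT x|mu nu. shift_const nu k * x ^ (2 * k) * f x)"
    and "(\<integral>\<^sup>+x. ennreal (f x) \<partial>mu (nu + real k)) = (\<integral>\<^sup>+x. ennreal (shift_const nu k * x ^ (2 * k) * f x) \<partial>mu nu)"
proof -
  have m: "(\<lambda>x. shift_const nu k * x ^ (2 * k)) \<in> borel_measurable (mu nu)"
    by (intro measurable_borel_mu) measurable
  have nn: "shift_const nu k * x ^ (2 * k) \<ge> 0" for x
    using shift_const_pos[OF a, of k] by (simp add: power_mult)
  have eq: "mu (nu + real k) = density (mu nu) (\<lambda>x. ennreal (shift_const nu k * x ^ (2 * k)))"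
    using mu_shift[OF a, of k] by (simp add: shift_const_def)
  show "integrable (mu (nu + real k)) f \<longleftrightarrow> integrable (mu nu) (\<lambda>x. shift_const nu k * x ^ (2 * k) * f x)"
    unfolding eq using integrable_density[OF f m] nn by simp
  show "(LINT x|mu (nu + real k). f x) = (LINT x|mu nu. shift_const nu k * x ^ (2 * k) * f x)"
    unfolding eq using integral_density[OF f m] nn by simp
  show "(\<integral>\<^sup>+x. ennreal (f x) \<partial>mu (nu + real k)) = (\<integral>\<^sup>+x. ennreal (shift_const nu k * x ^ (2 * k) * f x) \<partial>mu nu)"
    unfolding eq using f m nn by (subst nn_integral_density) (auto simp: ennreal_mult')
qed

section \<open>Gaussians and their Hankel transforms\<close>

definition gauss :: "real \<Rightarrow> real \<Rightarrow> real" where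
  "gauss t x = exp (- (pi * t * x\<^sup>2))"

lemma gauss_measurable [measurable]: "gauss t \<in> borel_measurable borel"
  unfolding gauss_def by measurable

lemma gauss_pos: "gauss t x > 0" by (simp add: gauss_def)

lemma gauss_mult: "gauss s x * gauss t x = gauss (s + t) x"
  by (simp add: gauss_def exp_add[symmetric] algebra_simps)

text \<open>The substitution \<open>s = pi t x\<^sup>2\<close> turns the integral into that of the
  Gamma function; the normalisation of \<open>mu\<close> is the one for which \<open>gauss 1\<close> has
  integral \<open>1\<close>.\<close>

lemma gauss_integral:
  assumes b: "nu \<ge> 0" and t: "t > 0"
  shows "integrable (mu nu) (gauss t)" and "(LINT x|mu nu. gauss t x) = t powr - (nu + 1)"
proof -
  define f where "f s = s powr nu / exp s" for s :: real
  define g where "g x = pi * t * x\<^sup>2" for x :: real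
  have img: "g ` {0<..} = {0<..}"
  proof -
    have "y \<in> g ` {0<..}" if "y > 0" for y
      using that t by (intro image_eqI[where x = "sqrt (y / (pi * t))"]) (auto simp: g_def)
    moreover have "g x > 0" if "x > 0" for x using that t by (simp add: g_def)
    ultimately show ?thesis by auto
  qed
  have "(f has_integral Gamma (nu + 1)) {0..}"
    using Gamma_integral_real[of "nu + 1"] b by (simp add: f_def[abs_def])
  moreover have "(f has_integral Gamma (nu + 1)) {0..} \<longleftrightarrow> (f has_integral Gamma (nu + 1)) {0<..}"
  proof (rule has_integral_spike_set_eq)
    have "{0..} - {0<..} = {0::real}" "{0<..} - {0..} = ({}::real set)" by auto
    then show "negligible {x \<in> {0..} - {0<..}. f x \<noteq> 0}" "negligible {x \<in> {0<..} - {0..}. f x \<noteq> 0}"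
      by (auto intro: negligible_subset[of "{0}"])
  qed
  ultimately have f: "(f has_integral Gamma (nu + 1)) {0<..}" by simp
  then have "f absolutely_integrable_on {0<..}"
    by (intro nonnegative_absolutely_integrable_1) (auto simp: f_def)
  then have *: "(\<lambda>x. \<bar>2 * pi * t * x\<bar> * f (g x)) absolutely_integrable_on {0<..} \<and>
      integral {0<..} (\<lambda>x. \<bar>2 * pi * t * x\<bar> * f (g x)) = Gamma (nu + 1)"
  proof (subst has_absolute_integral_change_of_variables_1'[where f = f and g = g])
    show "(g has_real_derivative 2 * pi * t * x) (at x within {0<..})" for x
      unfolding g_def by (auto intro!: derivative_eq_intros)
    show "inj_on g {0<..}" using t by (auto simp: inj_on_def g_def)
  qed (use f img in \<open>auto intro: integral_unique\<close>)
  have eq: "\<bar>2 * pi * t * x\<bar> * f (g x) = t powr (nu + 1) * Gamma (nu + 1) * (weight nu x * gauss t x)"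
    if "x > 0" for x
  proof -
    have "(pi * t * x\<^sup>2) powr nu = pi powr nu * t powr nu * x powr (2 * nu)"
      using that t by (simp add: powr_mult powr_powr[symmetric] powr_numeral)
    moreover have "pi powr (nu + 1) = pi * pi powr nu" "t powr (nu + 1) = t * t powr nu"
       "x powr (2 * nu + 1) = x * x powr (2 * nu)"
      using that t by (simp_all add: powr_add)
    moreover have "Gamma (nu + 1) > 0" using b by simp
    ultimately show ?thesis
      using that t by (simp add: f_def g_def weight_def gauss_def exp_minus divide_inverse mult_ac)
  qed
  let ?h = "\<lambda>x. indicator {0..} x *\<^sub>R (weight nu x * gauss t x)"
  have c: "t powr (nu + 1) * Gamma (nu + 1) > 0" using b t by simp
  have ind: "indicator {0<..} x *\<^sub>R (\<bar>2 * pi * t * x\<bar> * f (g x)) = t powr (nu + 1) * Gamma (nu + 1) * ?h x" for x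
    using eq[of x] b by (auto simp: indicator_def weight_def)
  have "integrable lebesgue (\<lambda>x. t powr (nu + 1) * Gamma (nu + 1) * ?h x)"
    using conjunct1[OF *] unfolding set_integrable_def ind .
  then have int: "integrable lebesgue ?h"
    using c by auto
  have "(LINT x|lebesgue. t powr (nu + 1) * Gamma (nu + 1) * ?h x) = Gamma (nu + 1)"
    using conjunct2[OF *] set_lebesgue_integral_eq_integral(2)[OF conjunct1[OF *]]
    unfolding set_lebesgue_integral_def ind by simp
  then have val: "(LINT x|lebesgue. ?h x) = t powr - (nu + 1)"
    using c unfolding integral_mult_right_zero powr_minus by (auto intro!: inverse_unique[symmetric])
  have S: "{0..} \<inter> space lebesgue \<in> sets (lebesgue :: real measure)" by simp
  have m: "gauss t \<in> borel_measurable (lebesgue_on {0..})" "weight nu \<in> borel_measurable (lebesgue_on {0..})"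
    by (intro measurable_borel_lebesgue_on; measurable)+
  show "integrable (mu nu) (gauss t)"
    unfolding mu_eq_density_weight using b int
    by (subst integrable_density[OF m]) (auto simp: weight_nonneg integrable_restrict_space[OF S])
  show "(LINT x|mu nu. gauss t x) = t powr - (nu + 1)"
    unfolding mu_eq_density_weight using b val
    by (subst integral_density[OF m]) (auto simp: weight_nonneg integral_restrict_space[OF S])
qed

text \<open>By \<open>mu_shift\<close> a moment of order \<open>2 n\<close> is a plain integral for the
  measure of order \<open>nu + n\<close>.\<close>

lemma gauss_moment:
  assumes b: "nu \<ge> 0" and t: "t > 0"
  shows "integrable (mu nu) (\<lambda>x. x ^ (2 * n) * gauss t x)"
    and "(LINT x|mu nu. x ^ (2 * n) * gauss t x)
      = Gamma (nu + real n + 1) / (pi ^ n * Gamma (nu + 1)) * t powr - (nu + real n + 1)"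
proof -
  note I = integral_mu_shift[OF b, where f = "gauss t" and k = n]
  have m: "gauss t \<in> borel_measurable (mu nu)" by (intro measurable_borel_mu) measurable
  have c: "shift_const nu n > 0" by (rule shift_const_pos[OF b])
  have G: "Gamma (nu + 1) > 0" "Gamma (nu + real n + 1) > 0" using b by simp_all
  have "integrable (mu nu) (\<lambda>x. shift_const nu n * (x ^ (2 * n) * gauss t x))"
    using I(1)[OF m] gauss_integral(1)[of "nu + real n" t] b t by (simp add: mult_ac)
  then show "integrable (mu nu) (\<lambda>x. x ^ (2 * n) * gauss t x)" using c by simp
  have "shift_const nu n * (LINT x|mu nu. x ^ (2 * n) * gauss t x) = t powr - (nu + real n + 1)"
    using I(2)[OF m] gauss_integral(2)[of "nu + real n" t] b t by (simp add: mult.assoc)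
  then show "(LINT x|mu nu. x ^ (2 * n) * gauss t x)
      = Gamma (nu + real n + 1) / (pi ^ n * Gamma (nu + 1)) * t powr - (nu + real n + 1)"
    using G by (simp add: shift_const_def field_simps)
qed

definition hankel :: "real \<Rightarrow> (real \<Rightarrow> real) \<Rightarrow> real \<Rightarrow> real" where
  "hankel nu g y = (LINT x|mu nu. g x * bessel_j nu (2 * pi * x * y))"

lemma bessel_j_kernel_sums:
  assumes "nu \<ge> 0"
  shows "(\<lambda>n. Gamma (nu + 1) * bessel_coeff nu n / fact n * (pi * y) ^ (2 * n) * x ^ (2 * n))
    sums bessel_j nu (2 * pi * x * y)"
proof -
  have "(\<lambda>n. Gamma (nu + 1) * (bessel_coeff nu n / fact n * ((pi * x * y)^2) ^ n)) sums
      (Gamma (nu + 1) * bessel_clifford nu ((pi * x * y)^2))"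
    unfolding bessel_clifford_def exp_series_def
    by (intro sums_mult summable_sums summable_exp_series(1)[OF bessel_coeff_bound] assms)
  moreover have "bessel_j nu (2 * pi * x * y) = Gamma (nu + 1) * bessel_clifford nu ((pi * x * y)^2)"
    by (simp add: bessel_j_eq mult.assoc)
  ultimately show ?thesis
    by (simp add: power_mult[symmetric] power_mult_distrib mult_ac)
qed

text \<open>Integrating the kernel term by term, the Gamma factors of the moments cancel those of the
  Bessel coefficients and an exponential series remains.\<close>

lemma hankel_gauss:
  assumes b: "nu \<ge> 0" and t: "t > 0"
  shows "hankel nu (gauss t) y = t powr - (nu + 1) * gauss (1 / t) y"
proof -
  define c where "c n = Gamma (nu + 1) * bessel_coeff nu n / fact n * (pi * y) ^ (2 * n)" for n
  define f where "f n x = c n * (x ^ (2 * n) * gauss t x)" for n and x :: real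
  have G: "Gamma (nu + 1) > 0" "Gamma (nu + real n + 1) > 0" for n using b by simp_all
  have fint: "integrable (mu nu) (f n)" for n
    unfolding f_def by (intro integrable_mult_right gauss_moment(1) b t)
  have cs: "(\<lambda>n. c n * x ^ (2 * n)) sums bessel_j nu (2 * pi * x * y)" for x
    using bessel_j_kernel_sums[OF b, of y x] by (simp add: c_def)
  have moment: "\<bar>c n\<bar> * (LINT x|mu nu. x ^ (2 * n) * gauss t x) = t powr - (nu + 1) * ((pi * y\<^sup>2 / t) ^ n /\<^sub>R fact n)"
    and moment': "c n * (LINT x|mu nu. x ^ (2 * n) * gauss t x) = t powr - (nu + 1) * ((- (pi * y\<^sup>2 / t)) ^ n /\<^sub>R fact n)"
    for n
  proof -
    have "t powr - (nu + real n + 1) = t powr (- (nu + 1) + - real n)" by (simp add: algebra_simps)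
    also have "\<dots> = t powr - (nu + 1) / t ^ n"
      using t by (simp only: powr_add powr_minus powr_realpow divide_inverse)
    finally have tp: "t powr - (nu + real n + 1) = t powr - (nu + 1) / t ^ n" .
    show "\<bar>c n\<bar> * (LINT x|mu nu. x ^ (2 * n) * gauss t x) = t powr - (nu + 1) * ((pi * y\<^sup>2 / t) ^ n /\<^sub>R fact n)"
      unfolding gauss_moment(2)[OF b t] tp using G(1) G(2)[of n]
      by (simp add: c_def bessel_coeff_def abs_mult power_abs power_mult power_mult_distrib power_divide
          divide_simps add_ac) (simp add: power2_eq_square power_mult_distrib)
    show "c n * (LINT x|mu nu. x ^ (2 * n) * gauss t x) = t powr - (nu + 1) * ((- (pi * y\<^sup>2 / t)) ^ n /\<^sub>R fact n)"
      unfolding gauss_moment(2)[OF b t] tp power_minus[of "pi * y\<^sup>2 / t"] using G(1) G(2)[of n]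
      by (simp add: c_def bessel_coeff_def abs_mult power_abs power_mult power_mult_distrib power_divide
          divide_simps add_ac) (simp add: power2_eq_square power_mult_distrib)
  qed
  have norm_f: "norm (f n x) = \<bar>c n\<bar> * (x ^ (2 * n) * gauss t x)" for n x
    using gauss_pos[of t x] by (simp add: f_def abs_mult power_mult)
  have "(LINT x|mu nu. (\<Sum>n. f n x)) = (\<Sum>n. integral\<^sup>L (mu nu) (f n))"
  proof (rule integral_suminf[OF fint])
    show "AE x in mu nu. summable (\<lambda>n. norm (f n x))"
    proof (intro AE_I2)
      fix x
      have "summable (\<lambda>n. Gamma (nu + 1) * \<bar>bessel_coeff nu n / fact n * (pi * x * y)\<^sup>2 ^ n\<bar> * gauss t x)"
        by (intro summable_mult summable_mult2 summable_exp_series(2)[OF bessel_coeff_bound] b)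
      moreover have "Gamma (nu + 1) * \<bar>bessel_coeff nu n / fact n * (pi * x * y)\<^sup>2 ^ n\<bar> * gauss t x = norm (f n x)" for n
        unfolding norm_f c_def abs_mult using G(1)
        by (simp add: power_mult power_mult_distrib abs_mult power_abs[symmetric] power2_eq_square mult_ac)
      ultimately show "summable (\<lambda>n. norm (f n x))" by simp
    qed
    show "summable (\<lambda>n. LINT x|mu nu. norm (f n x))"
      unfolding norm_f integral_mult_right_zero moment
      by (intro summable_mult sums_summable[OF exp_converges])
  qed
  moreover have "(\<Sum>n. f n x) = gauss t x * bessel_j nu (2 * pi * x * y)" for x
  proof -
    have "(\<lambda>n. c n * x ^ (2 * n) * gauss t x) sums (bessel_j nu (2 * pi * x * y) * gauss t x)"
      by (intro sums_mult2 cs)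
    from sums_unique[OF this] show ?thesis by (simp add: f_def mult_ac)
  qed
  moreover have "(\<Sum>n. integral\<^sup>L (mu nu) (f n)) = t powr - (nu + 1) * gauss (1 / t) y"
  proof -
    have "integral\<^sup>L (mu nu) (f n) = t powr - (nu + 1) * ((- (pi * y\<^sup>2 / t)) ^ n /\<^sub>R fact n)" for n
      by (simp only: f_def[abs_def] integral_mult_right_zero moment')
    moreover have "(\<lambda>n. t powr - (nu + 1) * ((- (pi * y\<^sup>2 / t)) ^ n /\<^sub>R fact n)) sums
        (t powr - (nu + 1) * exp (- (pi * y\<^sup>2 / t)))"
      by (intro sums_mult exp_converges)
    ultimately show ?thesis by (simp add: sums_unique[symmetric] gauss_def)
  qed
  ultimately show ?thesis by (simp add: hankel_def)
qed

lemma measurable_bessel_j [measurable]: "nu \<ge> 0 \<Longrightarrow> bessel_j nu \<in> borel_measurable borel"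
  by (intro borel_measurable_continuous_onI continuous_bessel_j)

lemma integrable_bessel_kernel:
  assumes b: "nu \<ge> 0" and g: "integrable (mu nu) g"
  shows "integrable (mu nu) (\<lambda>x. g x * bessel_j nu (2 * pi * x * y))"
proof (rule Bochner_Integration.integrable_bound[OF g])
  have [measurable]: "(\<lambda>x. bessel_j nu (2 * pi * x * y)) \<in> borel_measurable (mu nu)"
    by (intro measurable_borel_mu measurable_compose[OF _ measurable_bessel_j[OF b]]) measurable
  show "(\<lambda>x. g x * bessel_j nu (2 * pi * x * y)) \<in> borel_measurable (mu nu)"
    using g by measurable
  show "AE x in mu nu. norm (g x * bessel_j nu (2 * pi * x * y)) \<le> norm (g x)"
    using bessel_j_le_1[OF b] by (intro AE_I2) (auto simp: abs_mult intro!: mult_left_le)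
qed

lemma hankel_bound:
  assumes b: "nu \<ge> 0" and g: "integrable (mu nu) g"
  shows "\<bar>hankel nu g y\<bar> \<le> (LINT x|mu nu. \<bar>g x\<bar>)"
  unfolding hankel_def
proof (rule order_trans[OF integral_abs_bound])
  show "(LINT x|mu nu. \<bar>g x * bessel_j nu (2 * pi * x * y)\<bar>) \<le> (LINT x|mu nu. \<bar>g x\<bar>)"
    using bessel_j_le_1[OF b] g integrable_bessel_kernel[OF b g]
    by (intro integral_mono integrable_abs) (auto simp: abs_mult intro!: mult_left_le)
qed

lemma measurable_hankel_kernel:
  assumes b: "nu \<ge> 0" and g: "g \<in> borel_measurable (mu nu)"
  shows "(\<lambda>(y, x). g x * bessel_j nu (2 * pi * x * y)) \<in> borel_measurable (mu nu \<Otimes>\<^sub>M mu nu)"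
proof -
  have [measurable]: "g \<in> borel_measurable (mu nu)" by fact
  have [measurable]: "bessel_j nu \<in> borel_measurable borel" by (rule measurable_bessel_j[OF b])
  have [measurable]: "(\<lambda>p. fst p) \<in> borel_measurable (mu nu \<Otimes>\<^sub>M mu nu)"
    by (rule measurable_compose[OF measurable_fst measurable_id_mu])
  have [measurable]: "(\<lambda>p. snd p) \<in> borel_measurable (mu nu \<Otimes>\<^sub>M mu nu)"
    by (rule measurable_compose[OF measurable_snd measurable_id_mu])
  have "(\<lambda>p. bessel_j nu (2 * pi * snd p * fst p)) \<in> borel_measurable (mu nu \<Otimes>\<^sub>M mu nu)"
    by (rule measurable_compose[OF _ measurable_bessel_j[OF b]]) measurable
  moreover have "(\<lambda>p. g (snd p)) \<in> borel_measurable (mu nu \<Otimes>\<^sub>M mu nu)"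
    by (rule measurable_compose[OF measurable_snd g])
  ultimately show ?thesis by (simp add: case_prod_beta')
qed

lemma measurable_hankel:
  assumes b: "nu \<ge> 0" and g: "g \<in> borel_measurable (mu nu)"
  shows "hankel nu g \<in> borel_measurable (mu nu)"
proof -
  interpret sigma_finite_measure "mu nu" by (rule sigma_finite_mu[OF b])
  show ?thesis unfolding hankel_def[abs_def]
    using borel_measurable_lebesgue_integral[of "\<lambda>y x. g x * bessel_j nu (2 * pi * x * y)" "mu nu"]
      measurable_hankel_kernel[OF assms] by simp
qed

text \<open>The kernel is symmetric and bounded, so Fubini applies.\<close>

lemma hankel_symmetric:
  assumes b: "nu \<ge> 0" and g: "integrable (mu nu) g" and h: "integrable (mu nu) h"
  shows "(LINT y|mu nu. hankel nu g y * h y) = (LINT x|mu nu. g x * hankel nu h x)"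
proof -
  interpret pair_sigma_finite "mu nu" "mu nu" by (rule pair_sigma_finite_mu[OF b])
  let ?F = "\<lambda>(y, x). g x * bessel_j nu (2 * pi * x * y) * h y"
  have [measurable]: "h \<in> borel_measurable (mu nu)" using h by simp
  have [measurable]: "g \<in> borel_measurable (mu nu)" using g by simp
  have [measurable]: "(\<lambda>(y, x). g x * bessel_j nu (2 * pi * x * y)) \<in> borel_measurable (mu nu \<Otimes>\<^sub>M mu nu)"
    by (rule measurable_hankel_kernel[OF b]) simp
  have m: "?F \<in> borel_measurable (mu nu \<Otimes>\<^sub>M mu nu)"
  proof -
    have "(\<lambda>p. (\<lambda>(y, x). g x * bessel_j nu (2 * pi * x * y)) p * h (fst p)) \<in> borel_measurable (mu nu \<Otimes>\<^sub>M mu nu)"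
      by measurable
    then show ?thesis by (simp add: case_prod_beta')
  qed
  have int: "integrable (mu nu \<Otimes>\<^sub>M mu nu) ?F"
  proof (rule Fubini_integrable[OF m])
    show "integrable (mu nu) (\<lambda>y. LINT x|mu nu. norm (?F (y, x)))"
    proof (rule Bochner_Integration.integrable_bound)
      show "integrable (mu nu) (\<lambda>y. (LINT x|mu nu. \<bar>g x\<bar>) * \<bar>h y\<bar>)"
        using h by (intro integrable_mult_right integrable_abs)
      show "(\<lambda>y. LINT x|mu nu. norm (?F (y, x))) \<in> borel_measurable (mu nu)"
        using m by measurable
      have "(LINT x|mu nu. norm (?F (y, x))) \<le> (LINT x|mu nu. \<bar>g x\<bar>) * \<bar>h y\<bar>" for y
      proof -
        have "(LINT x|mu nu. norm (?F (y, x))) = (LINT x|mu nu. \<bar>g x * bessel_j nu (2 * pi * x * y)\<bar> * \<bar>h y\<bar>)"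
          by (simp add: abs_mult)
        also have "\<dots> = (LINT x|mu nu. \<bar>g x * bessel_j nu (2 * pi * x * y)\<bar>) * \<bar>h y\<bar>"
          by simp
        also have "\<dots> \<le> (LINT x|mu nu. \<bar>g x\<bar>) * \<bar>h y\<bar>"
          using bessel_j_le_1[OF b] g integrable_bessel_kernel[OF b g]
          by (intro mult_right_mono integral_mono integrable_abs) (auto simp: abs_mult intro!: mult_left_le)
        finally show ?thesis .
      qed
      moreover have "(LINT x|mu nu. norm (?F (y, x))) \<ge> 0" for y
        by (intro integral_nonneg_AE) auto
      ultimately show "AE y in mu nu. norm (LINT x|mu nu. norm (?F (y, x)))
          \<le> norm ((LINT x|mu nu. \<bar>g x\<bar>) * \<bar>h y\<bar>)"
        by (intro AE_I2) (simp only: real_norm_def[of "LINT x|mu nu. norm (?F (y, x))" for y]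
            abs_of_nonneg, simp only: real_norm_def, blast intro: order_trans abs_ge_self)
    qed
    show "AE y in mu nu. integrable (mu nu) (\<lambda>x. ?F (y, x))"
      using integrable_bessel_kernel[OF b g] by simp
  qed
  have "(LINT y|mu nu. hankel nu g y * h y) = (LINT y|mu nu. LINT x|mu nu. ?F (y, x))"
    by (simp add: hankel_def)
  also have "\<dots> = (LINT x|mu nu. LINT y|mu nu. ?F (y, x))"
    using Fubini_integral[OF int] by simp
  also have "\<dots> = (LINT x|mu nu. LINT y|mu nu. g x * (h y * bessel_j nu (2 * pi * y * x)))"
    by (simp add: mult_ac)
  also have "\<dots> = (LINT x|mu nu. g x * hankel nu h x)"
    by (simp add: hankel_def)
  finally show ?thesis .
qed

section \<open>The Hankel transform on square-integrable functions\<close>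

lemma integrable_mult_square:
  fixes f g :: "'a \<Rightarrow> real"
  assumes [measurable]: "f \<in> borel_measurable M" "g \<in> borel_measurable M"
    and f: "integrable M (\<lambda>x. (f x)^2)" and g: "integrable M (\<lambda>x. (g x)^2)"
  shows "integrable M (\<lambda>x. f x * g x)"
proof (rule Bochner_Integration.integrable_bound)
  show "integrable M (\<lambda>x. (f x)^2 + (g x)^2)" using f g by (rule Bochner_Integration.integrable_add)
  have "\<bar>a * b\<bar> \<le> a\<^sup>2 + b\<^sup>2" for a b :: real
    using sum_squares_bound[of "\<bar>a\<bar>" "\<bar>b\<bar>"] zero_le_power2[of a] zero_le_power2[of b]
    unfolding abs_mult power2_abs by linarith
  then show "AE x in M. norm (f x * g x) \<le> norm ((f x)^2 + (g x)^2)" by simp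
qed measurable

lemma Cauchy_Schwarz_integral:
  fixes f g :: "'a \<Rightarrow> real"
  assumes m: "f \<in> borel_measurable M" "g \<in> borel_measurable M"
    and f: "integrable M (\<lambda>x. (f x)^2)" and g: "integrable M (\<lambda>x. (g x)^2)"
  shows "\<bar>LINT x|M. f x * g x\<bar> \<le> sqrt (LINT x|M. (f x)^2) * sqrt (LINT x|M. (g x)^2)"
proof -
  note fg = integrable_mult_square[OF m f g]
  define A where "A = (LINT x|M. (f x)^2)"
  define B where "B = (LINT x|M. (g x)^2)"
  define P where "P = (LINT x|M. f x * g x)"
  have A0: "A \<ge> 0" by (simp add: A_def)
  have "P\<^sup>2 \<le> A * B"
  proof (cases "A = 0")
    case True
    then have "AE x in M. (f x)^2 = 0"
      unfolding A_def by (subst (asm) integral_nonneg_eq_0_iff_AE[OF f]) auto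
    then have "P = (LINT x|M. 0)"
      unfolding P_def using fg by (intro integral_cong_AE) auto
    then show ?thesis using True by simp
  next
    case False
    \<comment> \<open>the minimiser of \<open>t\<^sup>2 A - 2 t P + B\<close>\<close>
    define t where "t = P / A"
    have "0 \<le> (LINT x|M. (t * f x - g x)^2)" by simp
    also have "(LINT x|M. (t * f x - g x)^2) = (LINT x|M. t\<^sup>2 * (f x)^2 - 2 * t * (f x * g x) + (g x)^2)"
      by (intro Bochner_Integration.integral_cong refl) (simp add: power2_diff power_mult_distrib mult_ac)
    also have "\<dots> = t\<^sup>2 * A - 2 * t * P + B"
      using f g fg by (simp add: A_def B_def P_def)
    also have "\<dots> = B - P\<^sup>2 / A" using False by (simp add: t_def power2_eq_square field_simps)
    finally show ?thesis using A0 False by (simp add: field_simps)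
  qed
  then have "\<bar>P\<bar> \<le> sqrt (A * B)" by (simp add: real_le_rsqrt)
  then show ?thesis by (simp add: real_sqrt_mult A_def B_def P_def)
qed

definition gauss_sum :: "(nat \<Rightarrow> real) \<Rightarrow> nat \<Rightarrow> real \<Rightarrow> real" where
  "gauss_sum a n x = (\<Sum>i\<le>n. a i * gauss (real (Suc i)) x)"

text \<open>A product of two Gaussians is a Gaussian, so the squared norm is an explicit quadratic form
  in the coefficients.\<close>

lemma gauss_combination_norm:
  assumes b: "nu \<ge> 0" and t: "\<And>i. i \<le> n \<Longrightarrow> t i > 0"
  shows "integrable (mu nu) (\<lambda>x. (\<Sum>i\<le>n. c i * gauss (t i) x)^2)"
    and "(LINT x|mu nu. (\<Sum>i\<le>n. c i * gauss (t i) x)^2)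
      = (\<Sum>i\<le>n. \<Sum>j\<le>n. c i * c j * (t i + t j) powr - (nu + 1))"
proof -
  have eq: "(\<Sum>i\<le>n. c i * gauss (t i) x)^2 = (\<Sum>i\<le>n. \<Sum>j\<le>n. c i * c j * gauss (t i + t j) x)" for x
    unfolding power2_eq_square sum_product
    by (intro sum.cong refl) (simp add: gauss_mult[symmetric] mult_ac)
  have i: "integrable (mu nu) (\<lambda>x. c i * c j * gauss (t i + t j) x)" if "i \<in> {..n}" "j \<in> {..n}" for i j
    using that t by (intro integrable_mult_right gauss_integral(1) b) (auto intro: add_pos_pos)
  show "integrable (mu nu) (\<lambda>x. (\<Sum>i\<le>n. c i * gauss (t i) x)^2)"
    unfolding eq by (intro Bochner_Integration.integrable_sum i)
  have "(LINT x|mu nu. (\<Sum>i\<le>n. c i * gauss (t i) x)^2)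
      = (\<Sum>i\<le>n. \<Sum>j\<le>n. LINT x|mu nu. c i * c j * gauss (t i + t j) x)"
    unfolding eq by (subst Bochner_Integration.integral_sum, intro Bochner_Integration.integrable_sum i, assumption+)
      (intro sum.cong refl Bochner_Integration.integral_sum i, assumption+)
  also have "\<dots> = (\<Sum>i\<le>n. \<Sum>j\<le>n. c i * c j * (t i + t j) powr - (nu + 1))"
    using t by (intro sum.cong refl) (simp add: gauss_integral(2)[OF b] add_pos_pos)
  finally show "(LINT x|mu nu. (\<Sum>i\<le>n. c i * gauss (t i) x)^2)
      = (\<Sum>i\<le>n. \<Sum>j\<le>n. c i * c j * (t i + t j) powr - (nu + 1))" .
qed

lemma gauss_sum_measurable [measurable]: "gauss_sum a n \<in> borel_measurable borel"
  unfolding gauss_sum_def[abs_def] by measurable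

lemma integrable_gauss_sum: "nu \<ge> 0 \<Longrightarrow> integrable (mu nu) (gauss_sum a n)"
  unfolding gauss_sum_def[abs_def]
  by (intro Bochner_Integration.integrable_sum integrable_mult_right gauss_integral(1)) auto

lemma hankel_gauss_sum:
  assumes b: "nu \<ge> 0"
  shows "hankel nu (gauss_sum a n) y =
    (\<Sum>i\<le>n. (a i * real (Suc i) powr - (nu + 1)) * gauss (1 / real (Suc i)) y)"
proof -
  have i: "integrable (mu nu) (\<lambda>x. a i * (gauss (real (Suc i)) x * bessel_j nu (2 * pi * x * y)))" for i
    by (intro integrable_mult_right integrable_bessel_kernel gauss_integral(1) b) simp
  have "hankel nu (gauss_sum a n) y
      = (LINT x|mu nu. (\<Sum>i\<le>n. a i * (gauss (real (Suc i)) x * bessel_j nu (2 * pi * x * y))))"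
    by (simp add: hankel_def gauss_sum_def sum_distrib_right mult.assoc)
  also have "\<dots> = (\<Sum>i\<le>n. a i * hankel nu (gauss (real (Suc i))) y)"
    unfolding hankel_def by (subst Bochner_Integration.integral_sum[OF i]) simp
  finally show ?thesis
    using hankel_gauss[OF b, of "real (Suc i)" y for i] by (simp add: mult.assoc)
qed

text \<open>With \<open>p = i + 1\<close> and \<open>q = j + 1\<close> both quadratic forms
  agree because \<open>p q (1 / p + 1 / q) = p + q\<close>.\<close>

lemma hankel_gauss_sum_isometry:
  assumes b: "nu \<ge> 0"
  shows "integrable (mu nu) (\<lambda>x. (gauss_sum a n x)^2)"
    and "integrable (mu nu) (\<lambda>x. (hankel nu (gauss_sum a n) x)^2)"
    and "(LINT x|mu nu. (hankel nu (gauss_sum a n) x)^2) = (LINT x|mu nu. (gauss_sum a n x)^2)"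
proof -
  note N1 = gauss_combination_norm[OF b, where t = "\<lambda>i. real (Suc i)" and c = a and n = n]
  note N2 = gauss_combination_norm[OF b, where t = "\<lambda>i. 1 / real (Suc i)" and n = n and
      c = "\<lambda>i. a i * real (Suc i) powr - (nu + 1)"]
  show "integrable (mu nu) (\<lambda>x. (gauss_sum a n x)^2)"
    unfolding gauss_sum_def by (rule N1(1)) simp
  show "integrable (mu nu) (\<lambda>x. (hankel nu (gauss_sum a n) x)^2)"
    unfolding hankel_gauss_sum[OF b] by (rule N2(1)) simp
  have "(real (Suc i) powr - (nu + 1) * real (Suc j) powr - (nu + 1)) * (1 / real (Suc i) + 1 / real (Suc j)) powr - (nu + 1)
      = (real (Suc i) + real (Suc j)) powr - (nu + 1)" for i j
  proof -
    have "real (Suc i) * real (Suc j) * (1 / real (Suc i) + 1 / real (Suc j)) = real (Suc i) + real (Suc j)"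
      by (simp add: field_simps del: of_nat_Suc)
    then show ?thesis by (simp only: powr_mult[symmetric] of_nat_0_le_iff mult_nonneg_nonneg)
  qed
  then have "a i * real (Suc i) powr - (nu + 1) * (a j * real (Suc j) powr - (nu + 1)) *
      (1 / real (Suc i) + 1 / real (Suc j)) powr - (nu + 1)
      = a i * a j * (real (Suc i) + real (Suc j)) powr - (nu + 1)" for i j
    by (metis (no_types, lifting) mult.assoc mult.left_commute)
  then show "(LINT x|mu nu. (hankel nu (gauss_sum a n) x)^2) = (LINT x|mu nu. (gauss_sum a n x)^2)"
    unfolding hankel_gauss_sum[OF b] gauss_sum_def
    by (subst N1(2), simp, subst N2(2), simp) (intro sum.cong refl)
qed

lemma gauss_power: "gauss 1 x * (gauss 1 x) ^ i = gauss (real (Suc i)) x"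
proof -
  have "gauss 1 x ^ Suc i = gauss (real (Suc i)) x"
    unfolding gauss_def by (subst exp_of_nat_mult[symmetric]) (simp add: algebra_simps)
  then show ?thesis by simp
qed

lemma gauss_sum_poly: "gauss_sum a n x = gauss 1 x * (\<Sum>i\<le>n. a i * gauss 1 x ^ i)"
  unfolding gauss_sum_def sum_distrib_left
  by (intro sum.cong refl) (simp only: gauss_power[symmetric] mult_ac)

text \<open>In the variable \<open>s = gauss 1 x\<close>, which ranges over \<open>(0, 1]\<close>,
  Gaussian sums are \<open>s\<close> times a polynomial in \<open>s\<close>; so the Weierstrass theorem is
  applied to \<open>V / gauss 1\<close> as a function of \<open>s\<close>.\<close>

lemma gauss_sum_approx_continuous:
  fixes V :: "real \<Rightarrow> real"
  assumes V: "continuous_on UNIV V" and e: "e > 0" and N: "N \<ge> 0"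
    and V0: "\<And>x. x \<ge> N \<Longrightarrow> V x = 0"
  shows "\<exists>a n. \<forall>x\<ge>0. \<bar>gauss_sum a n x - V x\<bar> \<le> e * gauss 1 x"
proof -
  define \<delta> where "\<delta> = gauss 1 N"
  have d: "\<delta> > 0" by (simp add: \<delta>_def gauss_pos)
  \<comment> \<open>the argument of \<open>V\<close> is the \<open>x \<le> N\<close> with \<open>gauss 1 x = s\<close>; for \<open>s \<le> \<delta>\<close> it is \<open>N\<close>, where \<open>V\<close> vanishes\<close>
  define W where "W s = V (sqrt (- ln (max s \<delta>) / pi)) / max s \<delta>" for s
  have "continuous_on {0..1} (\<lambda>s. V (sqrt (- ln (max s \<delta>) / pi)))"
    using d by (intro continuous_on_compose2[OF V] continuous_intros) auto
  then have "continuous_on {0..1} W"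
    unfolding W_def using d by (intro continuous_intros) auto
  then obtain g where g: "real_polynomial_function g" "\<And>s. s \<in> {0..1} \<Longrightarrow> \<bar>W s - g s\<bar> < e"
    using Stone_Weierstrass_real_polynomial_function[of "{0..1}" W e] e by auto
  then obtain a n where ga: "g = (\<lambda>s. \<Sum>i\<le>n. a i * s ^ i)"
    by (auto simp: real_polynomial_function_iff_sum)
  have "\<bar>gauss_sum a n x - V x\<bar> \<le> e * gauss 1 x" if x: "x \<ge> 0" for x
  proof -
    have W: "gauss 1 x * W (gauss 1 x) = V x"
    proof (cases "x \<le> N")
      case True
      then have "x\<^sup>2 \<le> N\<^sup>2" using x by (simp add: power_mono)
      then have "\<delta> \<le> gauss 1 x" by (simp add: \<delta>_def gauss_def)
      moreover have "sqrt (- ln (gauss 1 x) / pi) = x" using x by (simp add: gauss_def)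
      ultimately show ?thesis using gauss_pos[of 1 x] by (simp add: W_def max_def)
    next
      case False
      then have "x\<^sup>2 \<ge> N\<^sup>2" using N by (simp add: power_mono)
      then have "gauss 1 x \<le> \<delta>" by (simp add: \<delta>_def gauss_def)
      moreover have "sqrt (- ln \<delta> / pi) = N" using N by (simp add: \<delta>_def gauss_def)
      ultimately show ?thesis using False V0[of N] V0[of x] by (simp add: W_def max_def)
    qed
    have "gauss 1 x \<in> {0..1}" by (simp add: gauss_def)
    then have "\<bar>g (gauss 1 x) - W (gauss 1 x)\<bar> \<le> e" using g(2)[of "gauss 1 x"] by linarith
    then have "gauss 1 x * \<bar>g (gauss 1 x) - W (gauss 1 x)\<bar> \<le> gauss 1 x * e"
      by (intro mult_left_mono less_imp_le[OF gauss_pos])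
    moreover have "gauss_sum a n x - V x = gauss 1 x * (g (gauss 1 x) - W (gauss 1 x))"
      using W by (simp add: gauss_sum_poly ga right_diff_distrib)
    ultimately show ?thesis using gauss_pos[of 1 x] by (simp add: abs_mult mult.commute)
  qed
  then show ?thesis by blast
qed

text \<open>A measurable function is almost everywhere a limit of continuous ones. These are cut off in
  height and support and then replaced by Gaussian sums; the common Gaussian majorant is what dominated
  convergence needs later.\<close>

lemma gauss_sum_approx:
  fixes v :: "real \<Rightarrow> real"
  assumes v: "v \<in> borel_measurable (mu nu)" and K: "\<And>x. \<bar>v x\<bar> \<le> K" and N: "N \<ge> 0"
    and v0: "\<And>x. x > N \<Longrightarrow> v x = 0"
  obtains C a n where "\<And>m x. x \<ge> 0 \<Longrightarrow> \<bar>gauss_sum (a m) (n m) x\<bar> \<le> C * gauss 1 x"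
    and "AE x in mu nu. (\<lambda>m. gauss_sum (a m) (n m) x) \<longlonglongrightarrow> v x"
proof -
  have K0: "K \<ge> 0" using K[of 0] by simp
  have "(\<lambda>x. if x \<in> {0..} then v x else 0) \<in> borel_measurable lebesgue"
    using v by (intro borel_measurable_if_I) (auto simp: measurable_mu)
  then have "(\<lambda>x. if x \<in> {0..} then v x else 0) measurable_on UNIV"
    by (rule lebesgue_measurable_imp_measurable_on) simp
  then obtain Z g where Z: "negligible Z" and g: "\<And>m. continuous_on UNIV (g m)"
    and lim: "\<And>x. x \<notin> Z \<Longrightarrow> (\<lambda>m. g m x) \<longlonglongrightarrow> (if x \<in> {0..} then v x else 0)"
    by (auto simp: measurable_on_def)
  define V where "V m x = max (- K) (min K (g m x)) * max 0 (min 1 (N + 1 - x))" for m :: nat and x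
  have "\<exists>a n. \<forall>x\<ge>0. \<bar>gauss_sum a n x - V m x\<bar> \<le> (1 / real (Suc m)) * gauss 1 x" for m
    using N by (intro gauss_sum_approx_continuous[where N = "N + 1"])
      (auto simp: V_def intro!: continuous_intros g)
  then obtain a n where an: "\<And>m x. x \<ge> 0 \<Longrightarrow> \<bar>gauss_sum (a m) (n m) x - V m x\<bar> \<le> (1 / real (Suc m)) * gauss 1 x"
    by metis
  define \<delta> where "\<delta> = gauss 1 (N + 1)"
  have d: "\<delta> > 0" by (simp add: \<delta>_def gauss_pos)
  have V_le: "\<bar>V m x\<bar> \<le> (K / \<delta>) * gauss 1 x" if x: "x \<ge> 0" for m x
  proof (cases "x \<le> N + 1")
    case True
    then have "x\<^sup>2 \<le> (N + 1)^2" using x by (simp add: power_mono)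
    then have "\<delta> \<le> gauss 1 x" by (simp add: \<delta>_def gauss_def)
    then have "K * 1 \<le> K * (gauss 1 x / \<delta>)" using d K0 by (intro mult_left_mono) auto
    moreover have "\<bar>V m x\<bar> \<le> K * 1"
      unfolding V_def abs_mult using K0 by (intro mult_mono) auto
    ultimately show ?thesis by simp
  next
    case False
    then have "V m x = 0" by (simp add: V_def)
    then show ?thesis using K0 d gauss_pos[of 1 x] by simp
  qed
  show ?thesis
  proof
    fix m and x :: real assume x: "x \<ge> 0"
    have "(1 / real (Suc m)) * gauss 1 x \<le> 1 * gauss 1 x"
      by (intro mult_right_mono less_imp_le[OF gauss_pos]) simp
    then show "\<bar>gauss_sum (a m) (n m) x\<bar> \<le> (K / \<delta> + 1) * gauss 1 x"
      using an[OF x, of m] V_le[OF x, of m] unfolding distrib_right by linarith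
  next
    show "AE x in mu nu. (\<lambda>m. gauss_sum (a m) (n m) x) \<longlonglongrightarrow> v x"
      using AE_mu_of_negligible[OF Z] AE_space
    proof eventually_elim
      case (elim x)
      then have x: "x \<ge> 0" by simp
      have "(\<lambda>m. V m x) \<longlonglongrightarrow> max (- K) (min K (v x)) * max 0 (min 1 (N + 1 - x))"
        unfolding V_def using lim[of x] elim x by (intro tendsto_intros) auto
      also have "max (- K) (min K (v x)) * max 0 (min 1 (N + 1 - x)) = v x"
        using K[of x] v0[of x] by (cases "x \<le> N") (auto simp: max_def min_def)
      finally have V: "(\<lambda>m. V m x) \<longlonglongrightarrow> v x" .
      have "(\<lambda>m. (1 / real (Suc m)) * gauss 1 x) \<longlonglongrightarrow> 0"
        by (intro tendsto_mult_left_zero LIMSEQ_inverse_real_of_nat[unfolded inverse_eq_divide])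
      then have "(\<lambda>m. gauss_sum (a m) (n m) x - V m x) \<longlonglongrightarrow> 0"
        by (rule Lim_null_comparison[rotated]) (auto intro!: always_eventually an[OF x, simplified])
      from tendsto_add[OF this V] show ?case by simp
    qed
  qed
qed

text \<open>Let \<open>v\<close> be \<open>w\<close> truncated in height and support. Testing
  \<open>w\<close> on Gaussian sums that approximate \<open>v\<close> gives
  \<open>\<integral>v\<^sup>2 \<le> C sqrt (\<integral>v\<^sup>2)\<close>, that is
  \<open>\<integral>v\<^sup>2 \<le> C\<^sup>2\<close>, and Fatou removes the truncation. For
  \<open>C = 0\<close> this is a uniqueness theorem.\<close>

lemma norm_le_if_tested_on_gauss_sums:
  fixes w :: "real \<Rightarrow> real"
  assumes b: "nu \<ge> 0" and w[measurable]: "w \<in> borel_measurable (mu nu)"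
    and wg: "integrable (mu nu) (\<lambda>x. w x * gauss 1 x)" and C: "C \<ge> 0"
    and test: "\<And>a n. \<bar>LINT x|mu nu. w x * gauss_sum a n x\<bar> \<le> C * sqrt (LINT x|mu nu. (gauss_sum a n x)^2)"
  shows "integrable (mu nu) (\<lambda>x. (w x)^2)" and "(LINT x|mu nu. (w x)^2) \<le> C\<^sup>2"
proof -
  define v where "v N x = (if x \<le> real N \<and> \<bar>w x\<bar> \<le> real N then w x else 0)" for N x
  have vm[measurable]: "v N \<in> borel_measurable (mu nu)" for N
    unfolding v_def[abs_def] by measurable
  have v: "integrable (mu nu) (\<lambda>x. (v N x)^2) \<and> (LINT x|mu nu. (v N x)^2) \<le> C\<^sup>2" for N
  proof -
    have vN: "\<bar>v N x\<bar> \<le> real N" "x > real N \<Longrightarrow> v N x = 0" for x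
      by (auto simp: v_def)
    obtain D a n where D: "\<And>m x. x \<ge> 0 \<Longrightarrow> \<bar>gauss_sum (a m) (n m) x\<bar> \<le> D * gauss 1 x"
      and lim: "AE x in mu nu. (\<lambda>m. gauss_sum (a m) (n m) x) \<longlonglongrightarrow> v N x"
      by (rule gauss_sum_approx[OF vm[of N] vN(1) of_nat_0_le_iff[of N]]) (assumption | rule vN(2) that)+
    let ?G = "\<lambda>m. gauss_sum (a m) (n m)"
    have G[measurable]: "?G m \<in> borel_measurable (mu nu)" for m
      by (rule measurable_borel_mu) measurable
    have "(\<lambda>m. LINT x|mu nu. w x * ?G m x) \<longlonglongrightarrow> (LINT x|mu nu. w x * v N x)"
    proof (rule integral_dominated_convergence)
      show "integrable (mu nu) (\<lambda>x. D * \<bar>w x * gauss 1 x\<bar>)"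
        using wg by (intro integrable_mult_right integrable_abs)
      show "AE x in mu nu. (\<lambda>m. w x * ?G m x) \<longlonglongrightarrow> w x * v N x"
        using lim by eventually_elim (intro tendsto_mult tendsto_const)
      fix m
      show "AE x in mu nu. norm (w x * ?G m x) \<le> D * \<bar>w x * gauss 1 x\<bar>"
      proof (intro AE_I2)
        fix x assume "x \<in> space (mu nu)"
        then have "\<bar>w x\<bar> * \<bar>?G m x\<bar> \<le> \<bar>w x\<bar> * (D * gauss 1 x)"
          by (intro mult_left_mono D) auto
        then show "norm (w x * ?G m x) \<le> D * \<bar>w x * gauss 1 x\<bar>"
          using gauss_pos[of 1 x] by (simp add: abs_mult mult_ac)
      qed
    qed measurable
    moreover have "w x * v N x = (v N x)^2" for x by (simp add: v_def power2_eq_square)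
    ultimately have l1: "(\<lambda>m. \<bar>LINT x|mu nu. w x * ?G m x\<bar>) \<longlonglongrightarrow> \<bar>LINT x|mu nu. (v N x)^2\<bar>"
      by (intro tendsto_rabs) simp
    have dom: "AE x in mu nu. norm ((?G m x)^2) \<le> D\<^sup>2 * gauss 2 x" for m
    proof (intro AE_I2)
      fix x assume "x \<in> space (mu nu)"
      then have "\<bar>?G m x\<bar>\<^sup>2 \<le> (D * gauss 1 x)^2" by (intro power_mono D) auto
      then show "norm ((?G m x)^2) \<le> D\<^sup>2 * gauss 2 x"
        using gauss_mult[of 1 x 1] by (simp add: power_mult_distrib power2_eq_square[of "gauss 1 x"])
    qed
    have lim2: "AE x in mu nu. (\<lambda>m. (?G m x)^2) \<longlonglongrightarrow> (v N x)^2"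
      using lim by eventually_elim (intro tendsto_power)
    have g2: "integrable (mu nu) (\<lambda>x. D\<^sup>2 * gauss 2 x)"
      by (intro integrable_mult_right gauss_integral(1) b) simp
    have int: "integrable (mu nu) (\<lambda>x. (v N x)^2)"
      by (rule integrable_dominated_convergence[OF _ _ g2 lim2 dom]) measurable
    have "(\<lambda>m. LINT x|mu nu. (?G m x)^2) \<longlonglongrightarrow> (LINT x|mu nu. (v N x)^2)"
      by (rule integral_dominated_convergence[OF _ _ g2 lim2 dom]) measurable
    then have l2: "(\<lambda>m. C * sqrt (LINT x|mu nu. (?G m x)^2)) \<longlonglongrightarrow> C * sqrt (LINT x|mu nu. (v N x)^2)"
      by (intro tendsto_intros)
    define S where "S = (LINT x|mu nu. (v N x)^2)"
    have "\<bar>S\<bar> \<le> C * sqrt S"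
      unfolding S_def by (rule LIMSEQ_le[OF l1 l2]) (use test in auto)
    moreover have S0: "S \<ge> 0" by (simp add: S_def)
    ultimately have "sqrt S * sqrt S \<le> C * sqrt S" by simp
    then have "sqrt S \<le> C"
      using C S0 by (cases "S = 0") (simp, rule mult_right_le_imp_le[of _ "sqrt S"], simp_all)
    then have "(sqrt S)^2 \<le> C\<^sup>2" using S0 by (intro power_mono) auto
    then show ?thesis using int S0 by (simp add: S_def)
  qed
  have "(\<integral>\<^sup>+x. ennreal ((w x)^2) \<partial>mu nu) = (\<integral>\<^sup>+x. liminf (\<lambda>N. ennreal ((v N x)^2)) \<partial>mu nu)"
  proof (intro nn_integral_cong)
    fix x assume "x \<in> space (mu nu)"
    obtain M :: nat where M: "max x \<bar>w x\<bar> \<le> real M" using real_arch_simple by blast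
    have "eventually (\<lambda>N. ennreal ((v N x)^2) = ennreal ((w x)^2)) sequentially"
      using eventually_ge_at_top[of M]
    proof eventually_elim
      case (elim N)
      then have "max x \<bar>w x\<bar> \<le> real N" using M by linarith
      then show ?case by (simp add: v_def)
    qed
    then have "(\<lambda>N. ennreal ((v N x)^2)) \<longlonglongrightarrow> ennreal ((w x)^2)" by (rule tendsto_eventually)
    then show "ennreal ((w x)^2) = liminf (\<lambda>N. ennreal ((v N x)^2))"
      by (intro lim_imp_Liminf[symmetric]) auto
  qed
  also have "\<dots> \<le> liminf (\<lambda>N. \<integral>\<^sup>+x. ennreal ((v N x)^2) \<partial>mu nu)"
    by (rule nn_integral_liminf) measurable
  also have "\<dots> \<le> limsup (\<lambda>N. \<integral>\<^sup>+x. ennreal ((v N x)^2) \<partial>mu nu)"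
    by (rule Liminf_le_Limsup) simp
  also have "\<dots> \<le> ennreal (C\<^sup>2)"
  proof (intro Limsup_bounded always_eventually allI)
    fix N
    have "(\<integral>\<^sup>+x. ennreal ((v N x)^2) \<partial>mu nu) = ennreal (LINT x|mu nu. (v N x)^2)"
      using v[of N] by (intro nn_integral_eq_integral) auto
    then show "(\<integral>\<^sup>+x. ennreal ((v N x)^2) \<partial>mu nu) \<le> ennreal (C\<^sup>2)"
      using v[of N] by (simp add: ennreal_leI)
  qed
  finally have le: "(\<integral>\<^sup>+x. ennreal ((w x)^2) \<partial>mu nu) \<le> ennreal (C\<^sup>2)" .
  show int: "integrable (mu nu) (\<lambda>x. (w x)^2)"
    by (rule integrableI_bounded) (use le in \<open>auto simp: le_less_trans\<close>)
  have "ennreal (LINT x|mu nu. (w x)^2) \<le> ennreal (C\<^sup>2)"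
    using le nn_integral_eq_integral[OF int] by simp
  then show "(LINT x|mu nu. (w x)^2) \<le> C\<^sup>2"
    using C by (simp add: ennreal_le_iff)
qed

lemma integrable_bounded_mult:
  fixes w :: "real \<Rightarrow> real"
  assumes h: "integrable M h" and w: "w \<in> borel_measurable M" and B: "\<And>x. \<bar>w x\<bar> \<le> B"
  shows "integrable M (\<lambda>x. w x * h x)"
proof (rule Bochner_Integration.integrable_bound)
  show "integrable M (\<lambda>x. B * h x)" using h by (rule integrable_mult_right)
  show "(\<lambda>x. w x * h x) \<in> borel_measurable M" using h w by measurable
  show "AE x in M. norm (w x * h x) \<le> norm (B * h x)"
    using B by (intro AE_I2) (auto simp: abs_mult intro!: mult_right_mono order_trans[OF B])
qed

text \<open>By symmetry of the transform, testing \<open>hankel nu g\<close> on a Gaussian sum is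
  testing \<open>g\<close> on the transform of that sum, which has the same norm.\<close>

lemma hankel_L2_le:
  assumes b: "nu \<ge> 0" and g: "integrable (mu nu) g" and g2: "integrable (mu nu) (\<lambda>x. (g x)^2)"
  shows "integrable (mu nu) (\<lambda>x. (hankel nu g x)^2)"
    and "(LINT x|mu nu. (hankel nu g x)^2) \<le> (LINT x|mu nu. (g x)^2)"
proof -
  have gm: "g \<in> borel_measurable (mu nu)" using g by simp
  have m: "hankel nu g \<in> borel_measurable (mu nu)" by (rule measurable_hankel[OF b gm])
  have i: "integrable (mu nu) (\<lambda>x. hankel nu g x * gauss 1 x)"
    by (rule integrable_bounded_mult[OF gauss_integral(1)[OF b] m hankel_bound[OF b g]]) simp
  have test: "\<bar>LINT x|mu nu. hankel nu g x * gauss_sum a n x\<bar>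
      \<le> sqrt (LINT x|mu nu. (g x)^2) * sqrt (LINT x|mu nu. (gauss_sum a n x)^2)" for a n
    unfolding hankel_symmetric[OF b g integrable_gauss_sum[OF b]]
      hankel_gauss_sum_isometry(3)[OF b, symmetric]
    by (intro Cauchy_Schwarz_integral gm g2 hankel_gauss_sum_isometry(2) b
        measurable_hankel borel_measurable_integrable[OF integrable_gauss_sum[OF b]])
  note N = norm_le_if_tested_on_gauss_sums[OF b m i _ test]
  show "integrable (mu nu) (\<lambda>x. (hankel nu g x)^2)" by (rule N(1)) simp
  show "(LINT x|mu nu. (hankel nu g x)^2) \<le> (LINT x|mu nu. (g x)^2)" using N(2) by simp
qed

text \<open>The real-valued counterpart of \<open>is_fourier_bessel_L2\<close>, with squared norms
  written as integrals.\<close>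

definition hankel_L2_limit :: "real \<Rightarrow> (real \<Rightarrow> real) \<Rightarrow> (real \<Rightarrow> real) \<Rightarrow> bool" where
  "hankel_L2_limit nu f g \<longleftrightarrow>
     f \<in> borel_measurable (mu nu) \<and> integrable (mu nu) (\<lambda>x. (f x)^2) \<and>
     g \<in> borel_measurable (mu nu) \<and> integrable (mu nu) (\<lambda>x. (g x)^2) \<and>
     (\<exists>F. (\<forall>n. integrable (mu nu) (F n) \<and> integrable (mu nu) (\<lambda>x. (F n x)^2)) \<and>
       (\<lambda>n. LINT x|mu nu. (F n x - f x)^2) \<longlonglongrightarrow> 0 \<and>
       (\<lambda>n. LINT x|mu nu. (hankel nu (F n) x - g x)^2) \<longlonglongrightarrow> 0)"

lemma integrable_diff_square:
  fixes f g :: "'a \<Rightarrow> real"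
  assumes m: "f \<in> borel_measurable M" "g \<in> borel_measurable M"
    and f: "integrable M (\<lambda>x. (f x)^2)" and g: "integrable M (\<lambda>x. (g x)^2)"
  shows "integrable M (\<lambda>x. (f x - g x)^2)"
proof -
  have "integrable M (\<lambda>x. (f x)^2 + (g x)^2 - 2 * (f x * g x))"
    by (intro Bochner_Integration.integrable_diff Bochner_Integration.integrable_add f g
        integrable_mult_right integrable_mult_square[OF m f g])
  then show ?thesis by (simp add: power2_diff mult.assoc)
qed

lemma L2_limit_tested:
  fixes f h :: "real \<Rightarrow> real"
  assumes f: "f \<in> borel_measurable M" "integrable M (\<lambda>x. (f x)^2)"
    and F: "\<And>n. F n \<in> borel_measurable M" "\<And>n. integrable M (\<lambda>x. (F n x)^2)"
    and h: "h \<in> borel_measurable M" "integrable M (\<lambda>x. (h x)^2)"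
    and lim: "(\<lambda>n. LINT x|M. (F n x - f x)^2) \<longlonglongrightarrow> 0"
  shows "(\<lambda>n. LINT x|M. F n x * h x) \<longlonglongrightarrow> (LINT x|M. f x * h x)"
proof -
  have "(\<lambda>n. sqrt (LINT x|M. (F n x - f x)^2) * sqrt (LINT x|M. (h x)^2)) \<longlonglongrightarrow>
      sqrt 0 * sqrt (LINT x|M. (h x)^2)"
    by (intro tendsto_intros lim)
  then have s: "(\<lambda>n. sqrt (LINT x|M. (F n x - f x)^2) * sqrt (LINT x|M. (h x)^2)) \<longlonglongrightarrow> 0"
    by simp
  have le: "\<bar>(LINT x|M. F n x * h x) - (LINT x|M. f x * h x)\<bar>
      \<le> sqrt (LINT x|M. (F n x - f x)^2) * sqrt (LINT x|M. (h x)^2)" for n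
  proof -
    have "(LINT x|M. F n x * h x) - (LINT x|M. f x * h x) = (LINT x|M. (F n x - f x) * h x)"
      unfolding left_diff_distrib
      by (intro Bochner_Integration.integral_diff[symmetric] integrable_mult_square f F h)
    also have "\<bar>\<dots>\<bar> \<le> sqrt (LINT x|M. (F n x - f x)^2) * sqrt (LINT x|M. (h x)^2)"
      by (intro Cauchy_Schwarz_integral integrable_diff_square borel_measurable_diff f F h)
    finally show ?thesis .
  qed
  have "(\<lambda>n. (LINT x|M. F n x * h x) - (LINT x|M. f x * h x)) \<longlonglongrightarrow> 0"
    by (rule Lim_null_comparison[OF _ s]) (use le in auto)
  then show ?thesis by (simp add: LIM_zero_iff)
qed

text \<open>The symmetry of the transform passes to the limit, since both sides are continuous in
  \<open>L\<^sup>2\<close>.\<close>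

lemma hankel_L2_limit_tested:
  assumes b: "nu \<ge> 0" and fg: "hankel_L2_limit nu f g"
    and h: "integrable (mu nu) h" "integrable (mu nu) (\<lambda>x. (h x)^2)"
  shows "(LINT x|mu nu. g x * h x) = (LINT x|mu nu. f x * hankel nu h x)"
proof -
  obtain F where f: "f \<in> borel_measurable (mu nu)" "integrable (mu nu) (\<lambda>x. (f x)^2)"
    and g: "g \<in> borel_measurable (mu nu)" "integrable (mu nu) (\<lambda>x. (g x)^2)"
    and F: "\<And>n. integrable (mu nu) (F n)" "\<And>n. integrable (mu nu) (\<lambda>x. (F n x)^2)"
    and lim: "(\<lambda>n. LINT x|mu nu. (F n x - f x)^2) \<longlonglongrightarrow> 0"
      "(\<lambda>n. LINT x|mu nu. (hankel nu (F n) x - g x)^2) \<longlonglongrightarrow> 0"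
    using fg by (auto simp: hankel_L2_limit_def)
  have hm: "h \<in> borel_measurable (mu nu)" using h by simp
  have Fm: "F n \<in> borel_measurable (mu nu)" for n using F by simp
  have "(\<lambda>n. LINT x|mu nu. hankel nu (F n) x * h x) \<longlonglongrightarrow> (LINT x|mu nu. g x * h x)"
    by (intro L2_limit_tested g hm h lim measurable_hankel b Fm hankel_L2_le(1) F)
  moreover have "(\<lambda>n. LINT x|mu nu. F n x * hankel nu h x) \<longlonglongrightarrow> (LINT x|mu nu. f x * hankel nu h x)"
    by (intro L2_limit_tested f hm h lim measurable_hankel b Fm hankel_L2_le(1) F)
  ultimately show ?thesis
    unfolding hankel_symmetric[OF b F(1) h(1)] by (rule LIMSEQ_unique)
qed

text \<open>Against a Gaussian sum, \<open>g\<close> integrates like \<open>f\<close> against the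
  transform of that sum, which has the same norm.\<close>

lemma hankel_L2_limit_norm_le:
  assumes b: "nu \<ge> 0" and fg: "hankel_L2_limit nu f g"
  shows "(LINT x|mu nu. (g x)^2) \<le> (LINT x|mu nu. (f x)^2)"
proof -
  have f: "f \<in> borel_measurable (mu nu)" "integrable (mu nu) (\<lambda>x. (f x)^2)"
    and g: "g \<in> borel_measurable (mu nu)" "integrable (mu nu) (\<lambda>x. (g x)^2)"
    using fg by (auto simp: hankel_L2_limit_def)
  have 1: "integrable (mu nu) (\<lambda>x. g x * gauss 1 x)"
    using gauss_integral(1)[OF b, of 2] gauss_mult[of 1 _ 1]
    by (intro integrable_mult_square g measurable_borel_mu gauss_measurable) (simp add: power2_eq_square)
  have "\<bar>LINT x|mu nu. g x * gauss_sum a n x\<bar>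
      \<le> sqrt (LINT x|mu nu. (f x)^2) * sqrt (LINT x|mu nu. (gauss_sum a n x)^2)" for a n
    unfolding hankel_L2_limit_tested[OF b fg integrable_gauss_sum[OF b] hankel_gauss_sum_isometry(1)[OF b]]
      hankel_gauss_sum_isometry(3)[OF b, symmetric]
    by (intro Cauchy_Schwarz_integral f hankel_gauss_sum_isometry(2) b
        measurable_hankel borel_measurable_integrable[OF integrable_gauss_sum[OF b]])
  from norm_le_if_tested_on_gauss_sums(2)[OF b g(1) 1 _ this] show ?thesis by simp
qed

text \<open>Moving the transform from \<open>g\<close> onto \<open>gauss t\<close> leaves
  \<open>g\<close> against a multiple of \<open>gauss (1 / t)\<close>; by
  \<open>hankel_L2_limit_tested\<close> this is \<open>f\<close> against the transform of that Gaussian,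
  which is \<open>gauss t\<close> again. So \<open>f\<close> and \<open>hankel nu g\<close> have the
  same integrals against all Gaussian sums.\<close>

lemma hankel_L2_limit_inversion:
  assumes b: "nu \<ge> 0" and fg: "hankel_L2_limit nu f g" and g1: "integrable (mu nu) g"
  shows "AE x in mu nu. f x = hankel nu g x"
proof -
  have f: "f \<in> borel_measurable (mu nu)" "integrable (mu nu) (\<lambda>x. (f x)^2)"
    and g: "g \<in> borel_measurable (mu nu)" "integrable (mu nu) (\<lambda>x. (g x)^2)"
    using fg by (auto simp: hankel_L2_limit_def)
  have gauss2: "integrable (mu nu) (\<lambda>x. (gauss t x)^2)" if "t > 0" for t
    using gauss_integral(1)[OF b, of "t + t"] gauss_mult[of t _ t] that by (simp add: power2_eq_square)
  have fgauss: "integrable (mu nu) (\<lambda>x. f x * gauss t x)" if "t > 0" for t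
    by (intro integrable_mult_square f measurable_borel_mu gauss_measurable gauss2 that)
  have hm: "hankel nu g \<in> borel_measurable (mu nu)" by (rule measurable_hankel[OF b g(1)])
  have hgauss: "integrable (mu nu) (\<lambda>x. hankel nu g x * gauss t x)" if "t > 0" for t
    by (rule integrable_bounded_mult[OF gauss_integral(1)[OF b that] hm hankel_bound[OF b g1]])
  have eq: "(LINT x|mu nu. hankel nu g x * gauss t x) = (LINT x|mu nu. f x * gauss t x)" if t: "t > 0" for t
  proof -
    have t': "1 / t > 0" using t by simp
    have "(LINT x|mu nu. hankel nu g x * gauss t x) = (LINT x|mu nu. g x * hankel nu (gauss t) x)"
      by (intro hankel_symmetric b g1 gauss_integral(1) t)
    also have "\<dots> = t powr - (nu + 1) * (LINT x|mu nu. g x * gauss (1 / t) x)"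
      by (simp only: hankel_gauss[OF b t] mult.left_commute[of "g x" for x] integral_mult_right_zero)
    also have "(LINT x|mu nu. g x * gauss (1 / t) x) = (LINT x|mu nu. f x * hankel nu (gauss (1 / t)) x)"
      by (intro hankel_L2_limit_tested b fg gauss_integral(1) gauss2 t')
    also have "\<dots> = (1 / t) powr - (nu + 1) * (LINT x|mu nu. f x * gauss t x)"
      by (simp only: hankel_gauss[OF b t'] mult.left_commute[of "f x" for x] integral_mult_right_zero
          div_by_1 divide_divide_eq_right mult_1_left)
    also have "t powr - (nu + 1) * ((1 / t) powr - (nu + 1) * (LINT x|mu nu. f x * gauss t x))
        = (t * (1 / t)) powr - (nu + 1) * (LINT x|mu nu. f x * gauss t x)"
      using t by (simp only: powr_mult less_imp_le t' mult.assoc)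
    finally show ?thesis using t by simp
  qed
  let ?w = "\<lambda>x. f x - hankel nu g x"
  have wm: "?w \<in> borel_measurable (mu nu)" using f hm by measurable
  have w1: "integrable (mu nu) (\<lambda>x. ?w x * gauss 1 x)"
    unfolding left_diff_distrib by (intro Bochner_Integration.integrable_diff fgauss hgauss) simp_all
  have "(LINT x|mu nu. ?w x * gauss_sum a n x) = 0" for a n
  proof -
    have "(LINT x|mu nu. ?w x * gauss_sum a n x)
        = (LINT x|mu nu. (\<Sum>i\<le>n. a i * (f x * gauss (real (Suc i)) x - hankel nu g x * gauss (real (Suc i)) x)))"
      by (simp add: gauss_sum_def sum_distrib_left algebra_simps sum_subtractf)
    also have "\<dots> = (\<Sum>i\<le>n. LINT x|mu nu. a i * (f x * gauss (real (Suc i)) x - hankel nu g x * gauss (real (Suc i)) x))"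
      by (intro Bochner_Integration.integral_sum integrable_mult_right Bochner_Integration.integrable_diff
          fgauss hgauss) simp_all
    also have "\<dots> = (\<Sum>i\<le>n. a i * ((LINT x|mu nu. f x * gauss (real (Suc i)) x) - (LINT x|mu nu. hankel nu g x * gauss (real (Suc i)) x)))"
      by (intro sum.cong refl, subst integral_mult_right_zero, subst Bochner_Integration.integral_diff)
        (auto intro: fgauss hgauss simp del: of_nat_Suc)
    also have "\<dots> = 0" using eq[of "real (Suc i)" for i] by simp
    finally show ?thesis .
  qed
  then have t: "\<bar>LINT x|mu nu. ?w x * gauss_sum a n x\<bar> \<le> 0 * sqrt (LINT x|mu nu. (gauss_sum a n x)^2)" for a n
    by simp
  note N = norm_le_if_tested_on_gauss_sums[OF b wm w1 order.refl t]
  have "(LINT x|mu nu. (?w x)^2) = 0"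
    using N(2) by (intro antisym) auto
  then have "AE x in mu nu. (?w x)^2 = 0"
    by (subst (asm) integral_nonneg_eq_0_iff_AE[OF N(1)]) auto
  then show ?thesis by eventually_elim simp
qed

section \<open>Band-limited functions and Bernstein's inequality\<close>

text \<open>The \<open>m\<close>-th derivative at \<open>t = 0\<close> of the function
  \<open>F\<close> with \<open>F (x\<^sup>2) = hankel \<alpha> g x\<close>.\<close>

definition hankel_coeff :: "real \<Rightarrow> (real \<Rightarrow> real) \<Rightarrow> nat \<Rightarrow> real" where
  "hankel_coeff \<alpha> g m =
     (- (pi\<^sup>2)) ^ m * Gamma (\<alpha> + 1) / Gamma (real m + \<alpha> + 1) * (LINT y|mu \<alpha>. y ^ (2 * m) * g y)"

text \<open>The \<open>k\<close>-th derivative of the function \<open>F\<close> with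
  \<open>F (x\<^sup>2) = hankel \<alpha> g x\<close>, given by its Taylor series at
  \<open>0\<close>.\<close>

definition hankel_deriv :: "real \<Rightarrow> (real \<Rightarrow> real) \<Rightarrow> nat \<Rightarrow> real \<Rightarrow> real" where
  "hankel_deriv \<alpha> g k = exp_series (\<lambda>n. hankel_coeff \<alpha> g (n + k))"

locale band_limited =
  fixes \<alpha> b :: real and g :: "real \<Rightarrow> real"
  assumes alpha: "\<alpha> \<ge> 0" and b: "b > 0"
    and g1: "integrable (mu \<alpha>) g" and g2: "integrable (mu \<alpha>) (\<lambda>x. (g x)^2)"
    and supp: "\<And>x. x > b \<Longrightarrow> g x = 0"
begin

lemma gm [measurable]: "g \<in> borel_measurable (mu \<alpha>)"
  using g1 by simp

lemma power_le_supp: "x \<ge> 0 \<Longrightarrow> \<bar>x ^ m * g x\<bar> \<le> b ^ m * \<bar>g x\<bar>"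
proof (cases "x \<le> b")
  case True
  assume "x \<ge> 0"
  with True have "x ^ m \<le> b ^ m" by (intro power_mono)
  then show ?thesis using \<open>x \<ge> 0\<close> by (simp add: abs_mult mult_right_mono)
qed (use supp in simp)

lemma integrable_power_supp: "integrable (mu \<alpha>) (\<lambda>y. y ^ m * g y)"
proof (rule Bochner_Integration.integrable_bound)
  show "integrable (mu \<alpha>) (\<lambda>y. b ^ m * \<bar>g y\<bar>)" using g1 by (intro integrable_mult_right integrable_abs)
  show "AE y in mu \<alpha>. norm (y ^ m * g y) \<le> norm (b ^ m * \<bar>g y\<bar>)"
    using power_le_supp b by (intro AE_I2) auto
qed measurable

lemma power_integral_le: "(LINT y|mu \<alpha>. \<bar>y ^ m * g y\<bar>) \<le> b ^ m * (LINT y|mu \<alpha>. \<bar>g y\<bar>)"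
proof -
  have "(LINT y|mu \<alpha>. \<bar>y ^ m * g y\<bar>) \<le> (LINT y|mu \<alpha>. b ^ m * \<bar>g y\<bar>)"
    using g1 power_le_supp by (intro integral_mono integrable_abs integrable_mult_right integrable_power_supp) auto
  then show ?thesis by simp
qed

lemma hankel_coeff_bound: "\<bar>hankel_coeff \<alpha> g m\<bar> \<le> (LINT y|mu \<alpha>. \<bar>g y\<bar>) * ((pi * b)^2) ^ m"
proof -
  have G: "Gamma (\<alpha> + 1) > 0" using alpha by simp
  have "\<bar>Gamma (\<alpha> + 1) / Gamma (real m + \<alpha> + 1)\<bar> \<le> 1"
    using G Gamma_mono_nat[OF alpha, of m] by simp
  moreover have "\<bar>hankel_coeff \<alpha> g m\<bar> = (pi\<^sup>2) ^ m *
      \<bar>Gamma (\<alpha> + 1) / Gamma (real m + \<alpha> + 1)\<bar> * \<bar>LINT y|mu \<alpha>. y ^ (2 * m) * g y\<bar>"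
    by (simp add: hankel_coeff_def abs_mult power_abs)
  ultimately have "\<bar>hankel_coeff \<alpha> g m\<bar> \<le> (pi\<^sup>2) ^ m * 1 * (LINT y|mu \<alpha>. \<bar>y ^ (2 * m) * g y\<bar>)"
    by (simp only:) (intro mult_mono integral_abs_bound, auto)
  also have "\<dots> \<le> (pi\<^sup>2) ^ m * 1 * (b ^ (2 * m) * (LINT y|mu \<alpha>. \<bar>g y\<bar>))"
    by (intro mult_left_mono power_integral_le) auto
  finally show ?thesis unfolding power_mult[of b 2 m] by (simp add: power_mult_distrib mult_ac)
qed

lemma hankel_deriv_has_derivative:
  "(hankel_deriv \<alpha> g k has_real_derivative hankel_deriv \<alpha> g (Suc k) t) (at t)"
  unfolding hankel_deriv_def by (rule exp_series_shift_deriv[OF hankel_coeff_bound])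

lemma hankel_deriv_bound_from_point:
  assumes "\<And>k. \<bar>hankel_deriv \<alpha> g (n + k) t0\<bar> \<le> M * q ^ k"
  shows "\<bar>hankel_deriv \<alpha> g n t\<bar> \<le> M * exp (q * \<bar>t - t0\<bar>)"
  unfolding hankel_deriv_def
proof (rule exp_series_bound_from_point[OF shifted_bound[OF hankel_coeff_bound]])
  show "\<bar>exp_series (\<lambda>m. hankel_coeff \<alpha> g (m + k + n)) t0\<bar> \<le> M * q ^ k" for k
    using assms[of k] by (simp add: hankel_deriv_def add_ac)
qed simp

text \<open>Differentiating the kernel in \<open>t = x\<^sup>2\<close> raises its order, and the
  resulting factor \<open>y\<^sup>2\<^sup>k\<close> raises the order of the measure. The identity is
  obtained by comparing power series; the support condition on \<open>g\<close> justifies integrating term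
  by term.\<close>

lemma hankel_deriv_eq: "hankel_deriv \<alpha> g k (x^2) = (- pi) ^ k * hankel (\<alpha> + real k) g x"
proof -
  define nu where "nu = \<alpha> + real k"
  have beta: "nu \<ge> 0" using alpha by (simp add: nu_def)
  have G: "Gamma (\<alpha> + 1) > 0" "Gamma (nu + 1) > 0" "Gamma (real n + nu + 1) > 0" for n
    using alpha beta by simp_all
  define c where "c n = shift_const \<alpha> k * (Gamma (nu + 1) * bessel_coeff nu n / fact n * (pi * x) ^ (2 * n))" for n
  define f where "f n y = c n * (y ^ (2 * (n + k)) * g y)" for n and y :: real
  have fint: "integrable (mu \<alpha>) (f n)" for n
    unfolding f_def by (intro integrable_mult_right integrable_power_supp)
  have f_le: "\<bar>f n y\<bar> \<le> \<bar>c n\<bar> * (b ^ (2 * (n + k)) * \<bar>g y\<bar>)" if "y \<ge> 0" for n y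
    unfolding f_def abs_mult[of "c n"] by (intro mult_left_mono power_le_supp that) auto
  have c_sum: "summable (\<lambda>n. \<bar>c n\<bar> * b ^ (2 * (n + k)))"
  proof -
    have "summable (\<lambda>n. \<bar>bessel_coeff nu n / fact n * ((pi * x * b)^2) ^ n\<bar> * (shift_const \<alpha> k * Gamma (nu + 1) * b ^ (2 * k)))"
      by (intro summable_mult2 summable_exp_series(2)[OF bessel_coeff_bound] beta)
    moreover have "\<bar>bessel_coeff nu n / fact n * ((pi * x * b)^2) ^ n\<bar> * (shift_const \<alpha> k * Gamma (nu + 1) * b ^ (2 * k))
        = \<bar>c n\<bar> * b ^ (2 * (n + k))" for n
      using G shift_const_pos[OF alpha, of k] b unfolding c_def abs_mult
      by (simp add: power_mult_distrib power_mult[symmetric] power_add abs_mult power_abs)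
    ultimately show ?thesis by simp
  qed
  have sums: "(\<lambda>n. f n y) sums (shift_const \<alpha> k * y ^ (2 * k) * (g y * bessel_j nu (2 * pi * y * x)))" for y
  proof -
    have "(\<lambda>n. shift_const \<alpha> k * y ^ (2 * k) * g y *
        (Gamma (nu + 1) * bessel_coeff nu n / fact n * (pi * x) ^ (2 * n) * y ^ (2 * n))) sums
        (shift_const \<alpha> k * y ^ (2 * k) * g y * bessel_j nu (2 * pi * y * x))"
      by (intro sums_mult bessel_j_kernel_sums beta)
    then show ?thesis by (simp add: f_def c_def distrib_left power_add mult_ac)
  qed
  have ae: "AE y in mu \<alpha>. summable (\<lambda>n. norm (f n y))"
  proof (intro AE_I2)
    fix y assume "y \<in> space (mu \<alpha>)"
    then have y: "y \<ge> 0" by simp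
    have "summable (\<lambda>n. \<bar>c n\<bar> * b ^ (2 * (n + k)) * \<bar>g y\<bar>)" by (intro summable_mult2 c_sum)
    then show "summable (\<lambda>n. norm (f n y))"
      by (rule summable_comparison_test'[where N = 0]) (use f_le[OF y] in \<open>simp add: mult.assoc\<close>)
  qed
  have "summable (\<lambda>n. \<bar>c n\<bar> * b ^ (2 * (n + k)) * (LINT y|mu \<alpha>. \<bar>g y\<bar>))" by (intro summable_mult2 c_sum)
  then have norms: "summable (\<lambda>n. LINT y|mu \<alpha>. norm (f n y))"
  proof (rule summable_comparison_test'[where N = 0])
    fix n
    have "(LINT y|mu \<alpha>. norm (f n y)) \<le> (LINT y|mu \<alpha>. \<bar>c n\<bar> * (b ^ (2 * (n + k)) * \<bar>g y\<bar>))"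
      using g1 f_le by (intro integral_mono integrable_norm fint integrable_mult_right integrable_abs) auto
    then show "norm (LINT y|mu \<alpha>. norm (f n y)) \<le> \<bar>c n\<bar> * b ^ (2 * (n + k)) * (LINT y|mu \<alpha>. \<bar>g y\<bar>)"
      by (simp add: mult.assoc)
  qed
  have "(\<lambda>y. bessel_j nu (2 * pi * y * x)) \<in> borel_measurable (mu \<alpha>)"
    by (intro measurable_borel_mu measurable_compose[OF _ measurable_bessel_j[OF beta]]) measurable
  then have "(\<lambda>y. g y * bessel_j nu (2 * pi * y * x)) \<in> borel_measurable (mu \<alpha>)" by simp
  from integral_mu_shift(2)[OF alpha this, of k]
  have "hankel nu g x = (LINT y|mu \<alpha>. (\<Sum>n. f n y))"
    by (simp add: hankel_def sums_unique[OF sums, symmetric] flip: nu_def)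
  then have H: "hankel nu g x = (\<Sum>n. integral\<^sup>L (mu \<alpha>) (f n))"
    by (simp only: integral_suminf[OF fint ae norms])
  have summ: "summable (\<lambda>n. integral\<^sup>L (mu \<alpha>) (f n))" by (rule summable_integral[OF fint ae norms])
  have "(- pi) ^ k * integral\<^sup>L (mu \<alpha>) (f n) = hankel_coeff \<alpha> g (n + k) / fact n * (x^2) ^ n" for n
  proof -
    have GG: "Gamma (real (n + k) + \<alpha> + 1) = Gamma (real n + nu + 1)" by (simp add: nu_def add_ac)
    have Gk: "Gamma (\<alpha> + real k + 1) = Gamma (nu + 1)" by (simp add: nu_def)
    have "(- pi) ^ k * c n = (- (pi\<^sup>2)) ^ (n + k) * Gamma (\<alpha> + 1) / Gamma (real n + nu + 1) * ((x^2) ^ n / fact n)"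
    proof -
      have s: "(- pi) ^ k = (-1) ^ k * pi ^ k" "(- (pi\<^sup>2)) ^ (n + k) = (-1) ^ (n + k) * (pi\<^sup>2) ^ (n + k)"
        by (rule power_minus)+
      show ?thesis
        unfolding c_def shift_const_def Gk bessel_coeff_def s using G(1,2) G(3)[of n]
        by (simp add: divide_simps power_add power_mult_distrib power_mult[symmetric] mult_2 mult_2_right)
    qed
    then have "(- pi) ^ k * c n * (LINT y|mu \<alpha>. y ^ (2 * (n + k)) * g y)
        = (- (pi\<^sup>2)) ^ (n + k) * Gamma (\<alpha> + 1) / Gamma (real n + nu + 1) * ((x^2) ^ n / fact n) *
          (LINT y|mu \<alpha>. y ^ (2 * (n + k)) * g y)" by simp
    then show ?thesis
      unfolding hankel_coeff_def GG f_def integral_mult_right_zero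
      by (simp add: mult_ac)
  qed
  then have "hankel_deriv \<alpha> g k (x^2) = (\<Sum>n. (- pi) ^ k * integral\<^sup>L (mu \<alpha>) (f n))"
    by (simp add: hankel_deriv_def exp_series_def)
  also have "\<dots> = (- pi) ^ k * (\<Sum>n. integral\<^sup>L (mu \<alpha>) (f n))"
    by (rule suminf_mult[OF summ])
  finally show ?thesis using H by (simp add: nu_def)
qed

text \<open>The transform of order \<open>\<alpha> + k\<close> is bounded by \<open>1\<close> in
  \<open>L\<^sup>2\<close>. Rewritten in terms of \<open>mu \<alpha>\<close>, the same constant appears
  on both sides and cancels, leaving the weight \<open>x\<^sup>2\<^sup>k\<close> on the left and at most
  \<open>b\<^sup>2\<^sup>k\<close> on the right.\<close>

lemma hankel_bernstein:
  "integrable (mu \<alpha>) (\<lambda>x. x ^ (2 * k) * (hankel_deriv \<alpha> g k (x^2))^2)"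
  "(LINT x|mu \<alpha>. x ^ (2 * k) * (hankel_deriv \<alpha> g k (x^2))^2) \<le> (pi * b) ^ (2 * k) * (LINT x|mu \<alpha>. (g x)^2)"
proof -
  define nu where "nu = \<alpha> + real k"
  have beta: "nu \<ge> 0" using alpha by (simp add: nu_def)
  define s where "s = shift_const \<alpha> k"
  have s: "s > 0" unfolding s_def by (rule shift_const_pos[OF alpha])
  have sets: "borel_measurable (mu nu) = (borel_measurable (mu \<alpha>) :: (real \<Rightarrow> real) set)"
    by (simp only: measurable_mu)
  have g1': "integrable (mu nu) g"
    unfolding nu_def integral_mu_shift(1)[OF alpha gm] s_def[symmetric]
    using integrable_mult_right[OF integrable_power_supp[of "2 * k"], of s] by (simp add: mult.assoc)
  have le: "x ^ (2 * k) * (g x)^2 \<le> b ^ (2 * k) * (g x)^2" if "x \<ge> 0" for x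
    using power_le_supp[OF that, of "2 * k"] b that
    by (cases "g x = 0") (auto simp: abs_mult intro!: mult_right_mono)
  have pg2: "integrable (mu \<alpha>) (\<lambda>x. x ^ (2 * k) * (g x)^2)"
  proof (rule Bochner_Integration.integrable_bound)
    show "integrable (mu \<alpha>) (\<lambda>x. b ^ (2 * k) * (g x)^2)" using g2 by (rule integrable_mult_right)
    show "AE x in mu \<alpha>. norm (x ^ (2 * k) * (g x)^2) \<le> norm (b ^ (2 * k) * (g x)^2)"
      using le b by (intro AE_I2) auto
  qed measurable
  have gm2: "(\<lambda>x. (g x)^2) \<in> borel_measurable (mu \<alpha>)" by measurable
  have g2': "integrable (mu nu) (\<lambda>x. (g x)^2)"
    unfolding nu_def integral_mu_shift(1)[OF alpha gm2] s_def[symmetric]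
    using integrable_mult_right[OF pg2, of s] by (simp add: mult.assoc)
  note H = hankel_L2_le[OF beta g1' g2']
  have "hankel nu g \<in> borel_measurable (mu nu)" using g1' by (intro measurable_hankel beta) simp
  then have hm: "(\<lambda>x. (hankel nu g x)^2) \<in> borel_measurable (mu \<alpha>)" unfolding sets by measurable
  have eq: "x ^ (2 * k) * (hankel_deriv \<alpha> g k (x^2))^2 = (pi ^ (2 * k) / s) * (s * x ^ (2 * k) * (hankel nu g x)^2)" for x
    unfolding hankel_deriv_eq using s
    by (simp add: nu_def power_mult_distrib power_even_eq[symmetric] power_mult[symmetric] mult.commute)
  have int: "integrable (mu \<alpha>) (\<lambda>x. s * x ^ (2 * k) * (hankel nu g x)^2)"
    using H(1) unfolding nu_def s_def by (simp add: integral_mu_shift(1)[OF alpha hm[unfolded nu_def]])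
  show "integrable (mu \<alpha>) (\<lambda>x. x ^ (2 * k) * (hankel_deriv \<alpha> g k (x^2))^2)"
    unfolding eq by (intro integrable_mult_right int)
  have "(LINT x|mu \<alpha>. x ^ (2 * k) * (hankel_deriv \<alpha> g k (x^2))^2)
      = (pi ^ (2 * k) / s) * (LINT x|mu nu. (hankel nu g x)^2)"
    unfolding eq integral_mult_right_zero
    using integral_mu_shift(2)[OF alpha hm, of k] by (simp add: nu_def s_def)
  also have "\<dots> \<le> (pi ^ (2 * k) / s) * (LINT x|mu nu. (g x)^2)"
    using s by (intro mult_left_mono H(2)) auto
  also have "(LINT x|mu nu. (g x)^2) = s * (LINT x|mu \<alpha>. x ^ (2 * k) * (g x)^2)"
    unfolding nu_def integral_mu_shift(2)[OF alpha gm2] s_def[symmetric] mult.assoc by simp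
  also have "(pi ^ (2 * k) / s) * (s * (LINT x|mu \<alpha>. x ^ (2 * k) * (g x)^2)) = pi ^ (2 * k) * (LINT x|mu \<alpha>. x ^ (2 * k) * (g x)^2)"
    using s by simp
  also have "(LINT x|mu \<alpha>. x ^ (2 * k) * (g x)^2) \<le> (LINT x|mu \<alpha>. b ^ (2 * k) * (g x)^2)"
    using g2 le by (intro integral_mono pg2) auto
  finally show "(LINT x|mu \<alpha>. x ^ (2 * k) * (hankel_deriv \<alpha> g k (x^2))^2)
      \<le> (pi * b) ^ (2 * k) * (LINT x|mu \<alpha>. (g x)^2)"
    by (simp add: power_mult_distrib mult.assoc)
qed

end

section \<open>Divided differences and interpolation\<close>

text \<open>Between consecutive zeros of \<open>f 0\<close> lies a zero of \<open>f 1\<close>, and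
  these are again ordered.\<close>

lemma Rolle_iterated:
  fixes f :: "nat \<Rightarrow> real \<Rightarrow> real"
  assumes der: "\<And>k x. (f k has_real_derivative f (Suc k) x) (at x)"
    and z: "\<And>i j. i < j \<Longrightarrow> j \<le> n \<Longrightarrow> z i < z j" and zero: "\<And>i. i \<le> n \<Longrightarrow> f 0 (z i) = 0"
  shows "\<exists>\<xi>. z 0 \<le> \<xi> \<and> \<xi> \<le> z n \<and> f n \<xi> = 0"
  using assms
proof (induction n arbitrary: f z)
  case 0
  then show ?case by auto
next
  case (Suc n)
  have "\<exists>w. z i < w \<and> w < z (Suc i) \<and> f (Suc 0) w = 0" if i: "i \<le> n" for i
  proof -
    have lt: "z i < z (Suc i)" using Suc.prems(2)[of i "Suc i"] i by simp
    have "\<exists>w. z i < w \<and> w < z (Suc i) \<and> (f 0 has_real_derivative 0) (at w)"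
    proof (rule Rolle[OF lt])
      show "f 0 (z i) = f 0 (z (Suc i))" using Suc.prems(3) i by simp
      show "continuous_on {z i..z (Suc i)} (f 0)"
        by (intro continuous_at_imp_continuous_on ballI DERIV_isCont[OF Suc.prems(1)])
      show "(f 0) differentiable (at x)" for x
        using Suc.prems(1) unfolding real_differentiable_def by blast
    qed
    then obtain w where w: "z i < w" "w < z (Suc i)" "(f 0 has_real_derivative 0) (at w)" by blast
    then show ?thesis using DERIV_unique[OF Suc.prems(1)[of 0 w] w(3)] by blast
  qed
  then obtain w where w: "\<And>i. i \<le> n \<Longrightarrow> z i < w i \<and> w i < z (Suc i) \<and> f (Suc 0) (w i) = 0"
    by metis
  have mono: "w i < w j" if "i < j" "j \<le> n" for i j
  proof -
    have "w i < z (Suc i)" using w that by simp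
    also have "z (Suc i) \<le> z j" using Suc.prems(2)[of "Suc i" j] that by (cases "Suc i = j") auto
    also have "z j < w j" using w that by simp
    finally show ?thesis .
  qed
  have "\<exists>\<xi>. w 0 \<le> \<xi> \<and> \<xi> \<le> w n \<and> f (Suc n) \<xi> = 0"
    by (rule Suc.IH[of "\<lambda>k. f (Suc k)" w]) (use Suc.prems(1) mono w in auto)
  moreover have "z 0 \<le> w 0" "w n \<le> z (Suc n)" using w by (auto intro: less_imp_le)
  ultimately show ?case by (meson order_trans)
qed

lemma Rolle_iterated_set:
  fixes f :: "nat \<Rightarrow> real \<Rightarrow> real"
  assumes der: "\<And>k x. (f k has_real_derivative f (Suc k) x) (at x)"
    and Z: "finite Z" "card Z = Suc n" "Z \<subseteq> {l..u}" and zero: "\<And>x. x \<in> Z \<Longrightarrow> f 0 x = 0"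
  obtains \<xi> where "\<xi> \<in> {l..u}" "f n \<xi> = 0"
proof -
  define z where "z i = sorted_list_of_set Z ! i" for i
  have len: "length (sorted_list_of_set Z) = Suc n" using Z by simp
  have zZ: "z i \<in> Z" if "i \<le> n" for i
    using nth_mem[of i "sorted_list_of_set Z"] that Z len by (simp add: z_def)
  have "z i < z j" if "i < j" "j \<le> n" for i j
    using sorted_wrt_nth_less[OF strict_sorted_list_of_set[of Z], of i j] that len
    by (simp add: z_def)
  then obtain \<xi> where "z 0 \<le> \<xi>" "\<xi> \<le> z n" "f n \<xi> = 0"
    using Rolle_iterated[of f n z] der zZ zero by blast
  moreover have "z 0 \<in> {l..u}" "z n \<in> {l..u}" using zZ Z by (blast, blast)
  ultimately show ?thesis using that[of \<xi>] by auto
qed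

text \<open>The leading coefficient of the polynomial that interpolates \<open>\<phi>\<close> on
  \<open>Z\<close>, in Lagrange form.\<close>

definition divided_difference :: "(real \<Rightarrow> real) \<Rightarrow> real set \<Rightarrow> real" where
  "divided_difference \<phi> Z = (\<Sum>s\<in>Z. \<phi> s / (\<Prod>r\<in>Z - {s}. s - r))"

lemma higher_pderiv_degree:
  fixes p :: "real poly"
  assumes "degree p \<le> n"
  shows "(pderiv ^^ n) p = [:fact n * coeff p n:]"
proof (rule poly_eqI)
  fix i
  have "coeff ((pderiv ^^ n) p) i = pochhammer (of_nat (Suc i)) n * coeff p (i + n)"
    by (simp add: coeff_higher_pderiv add.commute)
  also have "\<dots> = coeff [:fact n * coeff p n:] i"
  proof (cases i)
    case 0 then show ?thesis by (simp add: pochhammer_fact)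
  next
    case (Suc j)
    then have "coeff p (i + n) = 0" using assms by (intro coeff_eq_0) simp
    then show ?thesis using Suc by simp
  qed
  finally show "coeff ((pderiv ^^ n) p) i = coeff [:fact n * coeff p n:] i" .
qed

lemma degree_prod_linear:
  fixes A :: "real set"
  assumes "finite A"
  shows "degree (\<Prod>r\<in>A. [:- r, 1:]) = card A \<and> lead_coeff (\<Prod>r\<in>A. [:- r, 1:]) = 1"
  using assms
proof (induction A)
  case (insert a A)
  have "(\<Prod>r\<in>A. [:- r, 1:]) \<noteq> 0" using insert by auto
  then have "degree ([:- a, 1:] * (\<Prod>r\<in>A. [:- r, 1:])) = 1 + card A"
    using insert by (subst degree_mult_eq) auto
  moreover have "lead_coeff ([:- a, 1:] * (\<Prod>r\<in>A. [:- r, 1:])) = 1"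
    using insert by (subst lead_coeff_mult) auto
  ultimately show ?case using insert by simp
qed simp

text \<open>The difference of \<open>f 0\<close> and its interpolation polynomial on \<open>Z\<close>
  has \<open>n + 1\<close> zeros, so its \<open>n\<close>-th derivative vanishes somewhere; the leading
  coefficient of the polynomial is the divided difference.\<close>

lemma divided_difference_mean_value:
  fixes f :: "nat \<Rightarrow> real \<Rightarrow> real"
  assumes der: "\<And>k x. (f k has_real_derivative f (Suc k) x) (at x)"
    and Z: "finite Z" "card Z = Suc n" "Z \<subseteq> {l..u}"
  obtains \<xi> where "\<xi> \<in> {l..u}" "divided_difference (f 0) Z = f n \<xi> / fact n"
proof -
  define L where "L s = (\<Prod>r\<in>Z - {s}. [:- r, 1:])" for s
  define c where "c s = f 0 s / (\<Prod>r\<in>Z - {s}. s - r)" for s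
  define p where "p = (\<Sum>s\<in>Z. smult (c s) (L s))"
  have L: "degree (L s) = n" "coeff (L s) n = 1" if "s \<in> Z" for s
    using degree_prod_linear[of "Z - {s}"] Z that by (auto simp: L_def)
  have deg: "degree p \<le> n"
    unfolding p_def using L by (intro degree_sum_le Z(1)) (auto intro: order_trans[OF degree_smult_le])
  have lead: "coeff p n = divided_difference (f 0) Z"
    unfolding p_def divided_difference_def c_def[symmetric] using L by (simp add: coeff_sum)
  have interp: "poly p s = f 0 s" if s: "s \<in> Z" for s
  proof -
    have "poly (L r) s = 0" if "r \<in> Z" "r \<noteq> s" for r
      using that s Z(1) by (auto simp: L_def poly_prod intro!: prod_zero bexI[of _ s])
    then have "poly p s = c s * poly (L s) s"
      unfolding p_def poly_sum using s Z(1) by (subst sum.remove[of _ s]) auto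
    moreover have "poly (L s) s = (\<Prod>r\<in>Z - {s}. s - r)" by (simp add: L_def poly_prod)
    moreover have "(\<Prod>r\<in>Z - {s}. s - r) \<noteq> 0" using Z(1) by auto
    ultimately show ?thesis by (simp add: c_def)
  qed
  define h where "h k x = f k x - poly ((pderiv ^^ k) p) x" for k x
  have "(h k has_real_derivative h (Suc k) x) (at x)" for k x
    unfolding h_def[abs_def] using der poly_DERIV[of "(pderiv ^^ k) p" x]
    by (auto intro!: DERIV_diff)
  moreover have "h 0 x = 0" if "x \<in> Z" for x using interp[OF that] by (simp add: h_def)
  ultimately obtain \<xi> where "\<xi> \<in> {l..u}" "h n \<xi> = 0"
    using Rolle_iterated_set[of h Z n l u] Z by blast
  then show ?thesis using that[of \<xi>] lead by (simp add: h_def higher_pderiv_degree[OF deg])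
qed

text \<open>One term of the series of \<open>exp n\<close>, with
  \<open>exp 1 \<le> 3\<close>.\<close>

lemma n_power_n_le: "real n ^ n \<le> 3 ^ n * fact n"
proof -
  have s: "(\<lambda>k. real n ^ k /\<^sub>R fact k) sums exp (real n)" by (rule exp_converges)
  have "real n ^ n /\<^sub>R fact n = (\<Sum>k\<in>{n}. real n ^ k /\<^sub>R fact k)" by simp
  also have "\<dots> \<le> (\<Sum>k. real n ^ k /\<^sub>R fact k)"
    by (intro sum_le_suminf sums_summable[OF s]) auto
  also have "\<dots> = exp (real n)" by (rule sums_unique[OF s, symmetric])
  also have "\<dots> = exp 1 ^ n" by (simp add: exp_of_nat_mult[symmetric])
  also have "\<dots> \<le> 3 ^ n" by (intro power_mono exp_le) simp
  finally show ?thesis by (simp add: field_simps)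
qed

text \<open>The mean value theorem for the divided difference over the nodes and \<open>x\<close>
  expresses \<open>f 0 x\<close> through the values at the nodes and one value of \<open>f n\<close>.
  The separation bounds the weight of the \<open>i\<close>-th node by
  \<open>(n / \<delta>)\<^sup>N / (i! (N - i)!)\<close> with \<open>N = n - 1\<close>; summed
  over \<open>i\<close> this is \<open>(2 n / \<delta>)\<^sup>N / N!\<close>, at most
  \<open>3 (6 / \<delta>)\<^sup>N\<close>.\<close>

lemma interpolation_bound:
  fixes f :: "nat \<Rightarrow> real \<Rightarrow> real" and t :: "nat \<Rightarrow> real"
  assumes der: "\<And>k x. (f k has_real_derivative f (Suc k) x) (at x)"
    and n: "n \<ge> 1" and \<delta>: "0 < \<delta>" "\<delta> \<le> 1" and lu: "l < u"
    and t: "\<And>i. i < n \<Longrightarrow> t i \<in> {l..u}"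
    and sep: "\<And>i j. i < j \<Longrightarrow> j < n \<Longrightarrow> t j - t i \<ge> real (j - i) * (\<delta> * (u - l) / real n)"
    and V: "\<And>i. i < n \<Longrightarrow> \<bar>f 0 (t i)\<bar> \<le> V"
    and E: "\<And>\<xi>. \<xi> \<in> {l..u} \<Longrightarrow> \<bar>f n \<xi>\<bar> * (u - l) ^ n / fact n \<le> E"
    and x: "x \<in> {l..u}"
  shows "\<bar>f 0 x\<bar> \<le> 3 * (6 / \<delta>) ^ (n - 1) * V + E"
proof -
  define H where "H = u - l"
  define N where "N = n - 1"
  have Nn: "n = Suc N" using n by (simp add: N_def)
  have H: "H > 0" using lu by (simp add: H_def)
  have V0: "V \<ge> 0" using V[of 0] n by linarith
  have E0: "E \<ge> 0" using E[of l] lu by (auto intro: order_trans[rotated])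
  define \<eta> where "\<eta> = \<delta> * H / real n"
  have \<eta>: "\<eta> > 0" using \<delta> H n by (simp add: \<eta>_def)
  have lt: "t i < t j" if "i < j" "j < n" for i j
  proof -
    have "0 < real (j - i) * \<eta>" using that \<eta> by simp
    also have "\<dots> \<le> t j - t i" using sep[OF that] by (simp add: \<eta>_def H_def)
    finally show ?thesis by simp
  qed
  have inj: "inj_on t {..<n}"
    by (rule linorder_inj_onI') (use lt in fastforce)
  show ?thesis
  proof (cases "x \<in> t ` {..<n}")
    case True
    then have "\<bar>f 0 x\<bar> \<le> V" using V by auto
    moreover have "(6 / \<delta>) ^ (n - 1) \<ge> 1" using \<delta> by (intro one_le_power) (simp add: field_simps)
    then have "3 * (6 / \<delta>) ^ (n - 1) * V \<ge> 1 * V" using V0 by (intro mult_right_mono) auto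
    ultimately show ?thesis using E0 by simp
  next
    case False
    define Y where "Y = t ` {..<n}"
    define W where "W = (\<Prod>r\<in>Y. x - r)"
    have Y: "finite Y" "x \<notin> Y" "card Y = n" "Y \<subseteq> {l..u}"
      using False inj t by (auto simp: Y_def card_image)
    have dist: "\<bar>x - r\<bar> \<le> H" if "r \<in> Y" for r
      using subsetD[OF Y(4) that] x by (auto simp: H_def)
    have W0: "W \<noteq> 0" using Y by (auto simp: W_def)
    have WH: "\<bar>W\<bar> \<le> H ^ n"
    proof -
      have "\<bar>W\<bar> = (\<Prod>r\<in>Y. \<bar>x - r\<bar>)" by (simp add: W_def abs_prod)
      also have "\<dots> \<le> (\<Prod>r\<in>Y. H)" using dist by (intro prod_mono) auto
      finally show ?thesis using Y by simp
    qed
    obtain \<xi> where xi: "\<xi> \<in> {l..u}" "divided_difference (f 0) (insert x Y) = f n \<xi> / fact n"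
      using divided_difference_mean_value[of f "insert x Y" n l u] der Y x by auto
    have eq1: "insert x Y - {x} = Y" using Y by auto
    have eq2: "(\<Prod>r\<in>insert x Y - {s}. s - r) = (s - x) * (\<Prod>r\<in>Y - {s}. s - r)" if "s \<in> Y" for s
    proof -
      have "insert x Y - {s} = insert x (Y - {s})" using that Y by auto
      then show ?thesis using Y by simp
    qed
    have "f n \<xi> / fact n = f 0 x / W + (\<Sum>s\<in>Y. f 0 s / ((s - x) * (\<Prod>r\<in>Y - {s}. s - r)))"
      unfolding xi(2)[symmetric] divided_difference_def using Y eq1 eq2
      by (simp add: W_def)
    then have "f 0 x = W * (f n \<xi> / fact n) - (\<Sum>s\<in>Y. W * (f 0 s / ((s - x) * (\<Prod>r\<in>Y - {s}. s - r))))"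
      using W0 by (simp add: field_simps sum_distrib_left)
    moreover have "\<bar>W * (f n \<xi> / fact n)\<bar> \<le> E"
    proof -
      have "\<bar>W * (f n \<xi> / fact n)\<bar> = \<bar>W\<bar> * (\<bar>f n \<xi>\<bar> / fact n)" by (simp add: abs_mult)
      also have "\<dots> \<le> H ^ n * (\<bar>f n \<xi>\<bar> / fact n)" by (intro mult_right_mono WH) auto
      also have "\<dots> \<le> E" using E[OF xi(1)] by (simp add: H_def mult.commute)
      finally show ?thesis .
    qed
    moreover have "\<bar>\<Sum>s\<in>Y. W * (f 0 s / ((s - x) * (\<Prod>r\<in>Y - {s}. s - r)))\<bar> \<le> 3 * (6 / \<delta>) ^ (n - 1) * V"
    proof -
      have node: "\<bar>W * (f 0 (t i) / ((t i - x) * (\<Prod>r\<in>Y - {t i}. t i - r)))\<bar>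
          \<le> V * (H / \<eta>) ^ N * (real (N choose i) / fact N)" if i: "i < n" for i
      proof -
        let ?s = "t i"
        have sY: "?s \<in> Y" using i by (auto simp: Y_def)
        have "W = (x - ?s) * (\<Prod>r\<in>Y - {?s}. x - r)"
          unfolding W_def using Y sY by (subst prod.remove[of _ ?s]) auto
        moreover have "x \<noteq> ?s" using sY Y by auto
        ultimately have "W * (f 0 ?s / ((?s - x) * (\<Prod>r\<in>Y - {?s}. ?s - r)))
            = - ((\<Prod>r\<in>Y - {?s}. x - r) * (f 0 ?s / (\<Prod>r\<in>Y - {?s}. ?s - r)))"
          by (simp add: divide_simps) (simp add: algebra_simps)
        then have "\<bar>W * (f 0 ?s / ((?s - x) * (\<Prod>r\<in>Y - {?s}. ?s - r)))\<bar>
            = \<bar>\<Prod>r\<in>Y - {?s}. x - r\<bar> * (\<bar>f 0 ?s\<bar> / \<bar>\<Prod>r\<in>Y - {?s}. ?s - r\<bar>)"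
          by (simp add: abs_mult)
        also have "\<dots> \<le> H ^ N * (V / (\<eta> ^ N * (fact i * fact (N - i))))"
        proof (intro mult_mono frac_le)
          have "\<bar>\<Prod>r\<in>Y - {?s}. x - r\<bar> = (\<Prod>r\<in>Y - {?s}. \<bar>x - r\<bar>)" by (simp add: abs_prod)
          also have "\<dots> \<le> (\<Prod>r\<in>Y - {?s}. H)" using dist by (intro prod_mono) auto
          also have "\<dots> = H ^ N" using Y sY Nn by simp
          finally show "\<bar>\<Prod>r\<in>Y - {?s}. x - r\<bar> \<le> H ^ N" .
          show "\<bar>f 0 ?s\<bar> \<le> V" using V i by simp
          show "0 < \<eta> ^ N * (fact i * fact (N - i))" using \<eta> by simp
          have img: "Y - {?s} = t ` ({..<n} - {i})"
            using inj i unfolding Y_def by (auto simp: inj_on_def)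
          have "\<bar>\<Prod>r\<in>Y - {?s}. ?s - r\<bar> = (\<Prod>j\<in>{..<n} - {i}. \<bar>t i - t j\<bar>)"
            unfolding img abs_prod
            by (subst prod.reindex) (auto intro: inj_on_subset[OF inj])
          also have "{..<n} - {i} = {..<i} \<union> {Suc i..<n}" using i by auto
          also have "(\<Prod>j\<in>{..<i} \<union> {Suc i..<n}. \<bar>t i - t j\<bar>)
              = (\<Prod>j<i. \<bar>t i - t j\<bar>) * (\<Prod>j=Suc i..<n. \<bar>t i - t j\<bar>)"
            by (subst prod.union_disjoint) auto
          also have "\<dots> \<ge> (\<Prod>j<i. real (i - j) * \<eta>) * (\<Prod>j=Suc i..<n. real (j - i) * \<eta>)"
          proof (intro mult_mono prod_mono conjI)
            fix j assume "j \<in> {..<i}"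
            then show "real (i - j) * \<eta> \<le> \<bar>t i - t j\<bar>" using sep[of j i] i by (simp add: \<eta>_def H_def)
          next
            fix j assume "j \<in> {Suc i..<n}"
            then show "real (j - i) * \<eta> \<le> \<bar>t i - t j\<bar>" using sep[of i j] i by (simp add: \<eta>_def H_def)
          qed (use \<eta> in \<open>auto intro!: prod_nonneg\<close>)
          also have "(\<Prod>j<i. real (i - j) * \<eta>) * (\<Prod>j=Suc i..<n. real (j - i) * \<eta>)
              = \<eta> ^ N * (fact i * fact (N - i))"
          proof -
            have "(\<Prod>j<i. real (i - j)) = fact i"
            proof -
              have "(\<Prod>j<i. real (i - j)) = (\<Prod>j<i. real (Suc j))"
                by (rule prod.reindex_bij_witness[of _ "\<lambda>j. i - Suc j" "\<lambda>j. i - Suc j"]) auto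
              then show ?thesis by (simp add: fact_prod_Suc lessThan_atLeast0)
            qed
            moreover have "(\<Prod>j=Suc i..<n. real (j - i)) = fact (N - i)"
            proof -
              have "(\<Prod>j=Suc i..<n. real (j - i)) = (\<Prod>j<N - i. real (Suc j))"
                using i Nn by (intro prod.reindex_bij_witness[of _ "\<lambda>j. j + Suc i" "\<lambda>j. j - Suc i"]) auto
              then show ?thesis by (simp add: fact_prod_Suc lessThan_atLeast0)
            qed
            moreover have "\<eta> ^ i * \<eta> ^ (N - i) = \<eta> ^ N"
              using i Nn by (simp add: power_add[symmetric])
            moreover have "card {Suc i..<n} = N - i" using Nn by simp
            ultimately show ?thesis
              by (simp add: prod.distrib)
          qed
          finally show "\<eta> ^ N * (fact i * fact (N - i)) \<le> \<bar>\<Prod>r\<in>Y - {?s}. ?s - r\<bar>" .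
        qed (use H V0 in auto)
        also have "\<dots> = V * (H / \<eta>) ^ N * (1 / (fact i * fact (N - i)))"
          by (simp add: power_divide)
        also have "1 / (fact i * fact (N - i)) = real (N choose i) / fact N"
          using i Nn by (simp add: binomial_fact)
        finally show ?thesis .
      qed
      have "\<bar>\<Sum>s\<in>Y. W * (f 0 s / ((s - x) * (\<Prod>r\<in>Y - {s}. s - r)))\<bar>
          \<le> (\<Sum>s\<in>Y. \<bar>W * (f 0 s / ((s - x) * (\<Prod>r\<in>Y - {s}. s - r)))\<bar>)" by (rule sum_abs)
      also have "\<dots> = (\<Sum>i<n. \<bar>W * (f 0 (t i) / ((t i - x) * (\<Prod>r\<in>Y - {t i}. t i - r)))\<bar>)"
        unfolding Y_def by (subst sum.reindex[OF inj]) simp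
      also have "\<dots> \<le> (\<Sum>i<n. V * (H / \<eta>) ^ N * (real (N choose i) / fact N))"
        using node by (intro sum_mono) auto
      also have "\<dots> = V * (H / \<eta>) ^ N * ((\<Sum>i<n. real (N choose i)) / fact N)"
        by (simp add: sum_distrib_left sum_divide_distrib)
      also have "(\<Sum>i<n. real (N choose i)) = 2 ^ N"
      proof -
        have "(\<Sum>i<n. real (N choose i)) = real (\<Sum>i\<le>N. N choose i)"
          using Nn by (simp add: lessThan_Suc_atMost)
        then show ?thesis by (simp add: choose_row_sum)
      qed
      also have "V * (H / \<eta>) ^ N * (2 ^ N / fact N) = V * (2 / \<delta>) ^ N * (real n ^ N / fact N)"
        using H \<delta> by (simp add: \<eta>_def power_mult_distrib power_divide field_simps)
      also have "\<dots> \<le> V * (2 / \<delta>) ^ N * (3 * 3 ^ N)"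
      proof (intro mult_left_mono)
        have "real n * real n ^ N \<le> 3 * 3 ^ N * (real n * fact N)"
          using n_power_n_le[of n] Nn by simp
        then have "real n * real n ^ N \<le> real n * (3 * 3 ^ N * fact N)"
          by (simp only: mult_ac)
        then have "real n ^ N \<le> 3 * 3 ^ N * fact N"
          by (rule mult_left_le_imp_le) (use n in simp)
        then show "real n ^ N / fact N \<le> 3 * 3 ^ N" by (simp add: field_simps)
      qed (use V0 \<delta> in auto)
      also have "\<dots> = 3 * (6 / \<delta>) ^ N * V"
        using power_mult_distrib[of "2 / \<delta>" 3 N] by simp
      finally show ?thesis by (simp add: N_def)
    qed
    ultimately show ?thesis by linarith
  qed
qed

section \<open>The distribution function of the measure\<close>

definition mu_cdf :: "real \<Rightarrow> real \<Rightarrow> real" where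
  "mu_cdf nu x = pi powr (nu + 1) / Gamma (nu + 2) * x powr (2 * nu + 2)"

lemma mu_cdf_const_pos: "nu \<ge> 0 \<Longrightarrow> pi powr (nu + 1) / Gamma (nu + 2) > 0"
  by simp

lemma mu_cdf_strict_mono: "nu \<ge> 0 \<Longrightarrow> 0 \<le> p \<Longrightarrow> p < q \<Longrightarrow> mu_cdf nu p < mu_cdf nu q"
  unfolding mu_cdf_def by (intro mult_strict_left_mono mu_cdf_const_pos powr_less_mono2) auto

lemma mu_cdf_mono: "nu \<ge> 0 \<Longrightarrow> 0 \<le> p \<Longrightarrow> p \<le> q \<Longrightarrow> mu_cdf nu p \<le> mu_cdf nu q"
  using mu_cdf_strict_mono[of nu p q] by (cases "p = q") auto

lemma mu_cdf_nonneg: "nu \<ge> 0 \<Longrightarrow> mu_cdf nu x \<ge> 0"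
  unfolding mu_cdf_def by (intro mult_nonneg_nonneg less_imp_le[OF mu_cdf_const_pos]) auto

lemma mu_cdf_measurable [measurable]: "mu_cdf nu \<in> borel_measurable borel"
  unfolding mu_cdf_def[abs_def] by measurable

lemma mu_cdf_surj:
  assumes "nu \<ge> 0" "s \<ge> 0"
  obtains p where "p \<ge> 0" "mu_cdf nu p = s"
proof
  let ?c = "pi powr (nu + 1) / Gamma (nu + 2)"
  show "(s / ?c) powr (1 / (2 * nu + 2)) \<ge> 0" by simp
  have "((s / ?c) powr (1 / (2 * nu + 2))) powr (2 * nu + 2) = (s / ?c) powr 1"
    using assms unfolding powr_powr by (intro arg_cong2[where f="(powr)"]) auto
  also have "\<dots> = s / ?c" using assms mu_cdf_const_pos[OF assms(1)] by (intro powr_one) auto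
  finally have "((s / ?c) powr (1 / (2 * nu + 2))) powr (2 * nu + 2) = s / ?c" .
  moreover have c0: "?c \<noteq> 0" using mu_cdf_const_pos[OF assms(1)] by linarith
  ultimately show "mu_cdf nu ((s / ?c) powr (1 / (2 * nu + 2))) = s"
    unfolding mu_cdf_def by (metis nonzero_mult_div_cancel_left times_divide_eq_right)
qed

lemma emeasure_mu_interval:
  assumes a: "nu \<ge> 0" and p: "0 \<le> p" "p \<le> q"
  shows "emeasure (mu nu) {p..q} = ennreal (mu_cdf nu q - mu_cdf nu p)"
proof -
  have I: "(weight nu has_integral (mu_cdf nu q - mu_cdf nu p)) {p..q}"
  proof (rule fundamental_theorem_of_calculus_interior[OF p(2)])
    show "continuous_on {p..q} (mu_cdf nu)"
      unfolding mu_cdf_def[abs_def] using p a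
      by (intro continuous_on_mult continuous_on_const continuous_on_powr' continuous_on_id) auto
    show "(mu_cdf nu has_vector_derivative weight nu x) (at x)" if "x \<in> {p<..<q}" for x
    proof -
      have x: "x > 0" using that p by auto
      have "((\<lambda>x. x powr (2 * nu + 2)) has_real_derivative (2 * nu + 2) * x powr (2 * nu + 1)) (at x)"
        using has_real_derivative_powr[OF x, of "2 * nu + 2"] by (simp add: algebra_simps)
      then have "(mu_cdf nu has_real_derivative
          pi powr (nu + 1) / Gamma (nu + 2) * ((2 * nu + 2) * x powr (2 * nu + 1))) (at x)"
        unfolding mu_cdf_def[abs_def] by (rule DERIV_cmult)
      moreover have "Gamma (nu + 2) = (nu + 1) * Gamma (nu + 1)"
        using Gamma_plus1[of "nu + 1"] a by (auto simp: nonpos_Ints_def add_ac)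
      then have "pi powr (nu + 1) / Gamma (nu + 2) * ((2 * nu + 2) * x powr (2 * nu + 1)) = weight nu x"
        using a by (simp add: weight_def divide_simps)
      ultimately show ?thesis by (simp add: has_real_derivative_iff_has_vector_derivative)
    qed
  qed
  have S: "{p..q} \<in> sets (mu nu)" using p by (intro sets_borel_mu) auto
  have "emeasure (mu nu) {p..q} = (\<integral>\<^sup>+x. ennreal (weight nu x) * indicator {p..q} x \<partial>lebesgue_on {0..})"
    using S unfolding mu_eq_density_weight
    by (intro emeasure_density measurable_compose[OF measurable_borel_lebesgue_on measurable_ennreal])
      (auto simp: sets_mu)
  also have "\<dots> = (\<integral>\<^sup>+x. (ennreal (weight nu x) * indicator {p..q} x) * indicator {0..} x \<partial>lebesgue)"
    by (subst nn_integral_restrict_space) auto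
  also have "\<dots> = (\<integral>\<^sup>+x. ennreal (indicator {p..q} x * weight nu x) \<partial>lebesgue)"
    using p by (intro nn_integral_cong) (auto simp: indicator_def)
  also have "\<dots> = (\<integral>\<^sup>+x. ennreal (indicator {p..q} x * weight nu x) \<partial>lborel)"
    by (rule nn_integral_completion)
  also have "\<dots> = ennreal (mu_cdf nu q - mu_cdf nu p)"
    by (rule nn_integral_has_integral_lebesgue[OF _ I]) (rule weight_nonneg[OF a])
  finally show ?thesis .
qed

lemma AE_mu_neq: "nu \<ge> 0 \<Longrightarrow> AE x in mu nu. x \<noteq> c"
  using AE_mu_of_negligible[of "{c}"] by simp

lemma emeasure_mu_half_open:
  assumes a: "nu \<ge> 0" and p: "0 \<le> p" "p \<le> q"
  shows "emeasure (mu nu) {p..<q} = ennreal (mu_cdf nu q - mu_cdf nu p)"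
proof -
  have "emeasure (mu nu) {p..<q} = emeasure (mu nu) {p..q}"
    using p by (intro emeasure_eq_AE eventually_mono[OF AE_mu_neq[OF a, of q]] sets_borel_mu) auto
  then show ?thesis by (simp add: emeasure_mu_interval[OF assms])
qed

lemma measure_mu_half_open:
  assumes a: "nu \<ge> 0" and p: "0 \<le> p" "p \<le> q"
  shows "measure (mu nu) {p..<q} = mu_cdf nu q - mu_cdf nu p"
  using mu_cdf_mono[OF a p] by (simp add: measure_def emeasure_mu_half_open[OF a p])

lemma fmeasurable_mu_bounded:
  assumes a: "nu \<ge> 0" and E: "E \<in> sets (mu nu)" "E \<subseteq> {p..q}" and p: "0 \<le> p"
  shows "E \<in> fmeasurable (mu nu)"
proof (rule fmeasurableI2[OF _ _ E(1)])
  show "E \<subseteq> {p..max p q}" using E by auto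
  show "{p..max p q} \<in> fmeasurable (mu nu)"
    using p emeasure_mu_interval[OF a p, of "max p q"]
    by (intro fmeasurableI sets_borel_mu) auto
qed

lemma powr_diff_bounds:
  fixes s t :: real
  assumes a: "nu \<ge> 0" and st: "0 \<le> s" "s \<le> t"
  shows "t powr (nu + 1) - s powr (nu + 1) \<le> (nu + 1) * t powr nu * (t - s)"
    and "t powr nu * (t - s) \<le> t powr (nu + 1) - s powr (nu + 1)"
proof -
  have p1: "x powr (nu + 1) = x powr nu * x" if "x \<ge> 0" for x
    using that by (cases "x = 0") (auto simp: powr_add)
  show "t powr nu * (t - s) \<le> t powr (nu + 1) - s powr (nu + 1)"
  proof -
    have "s powr nu * s \<le> t powr nu * s" using a st by (intro mult_right_mono powr_mono2) auto
    then show ?thesis using st by (simp add: p1 right_diff_distrib)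
  qed
  show "t powr (nu + 1) - s powr (nu + 1) \<le> (nu + 1) * t powr nu * (t - s)"
  proof (cases "s < t")
    case True
    let ?f = "\<lambda>x::real. x powr (nu + 1)"
    have der: "(?f has_real_derivative (nu + 1) * x powr nu) (at x)" if "s < x" for x
      using has_real_derivative_powr[of x "nu + 1"] that st by simp
    have "\<exists>l z. s < z \<and> z < t \<and> (?f has_real_derivative l) (at z) \<and> ?f t - ?f s = (t - s) * l"
    proof (rule MVT[OF True])
      show "continuous_on {s..t} ?f"
        using st a by (intro continuous_on_powr' continuous_on_const continuous_on_id) auto
      show "?f differentiable (at x)" if "s < x" for x
        using der[OF that] unfolding real_differentiable_def by blast
    qed
    then obtain l z where z: "s < z" "z < t" "(?f has_real_derivative l) (at z)" "?f t - ?f s = (t - s) * l"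
      by blast
    have "l = (nu + 1) * z powr nu" using DERIV_unique[OF z(3) der[OF z(1)]] .
    moreover have "z powr nu \<le> t powr nu" using z st a by (intro powr_mono2) auto
    ultimately have "(t - s) * l \<le> (t - s) * ((nu + 1) * t powr nu)"
      using a st by (auto intro!: mult_left_mono)
    then show ?thesis using z(4) by (simp add: mult_ac)
  qed (use st in auto)
qed

text \<open>Compares \<open>mu\<close> with Lebesgue measure in the variable
  \<open>t = x\<^sup>2\<close>, in which its density is proportional to \<open>t\<^sup>nu\<close>: on an
  interval ending at \<open>q\<^sup>2\<close> the density is at most its final value, and on average at
  least that value divided by \<open>nu + 1\<close>.\<close>

lemma mu_cdf_diff_bounds:
  assumes a: "nu \<ge> 0" and pq: "0 \<le> p" "p \<le> q"
  defines "c \<equiv> pi powr (nu + 1) / Gamma (nu + 1)"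
  shows "mu_cdf nu q - mu_cdf nu p \<le> c * (q\<^sup>2) powr nu * (q\<^sup>2 - p\<^sup>2)"
    and "c / (nu + 1) * (q\<^sup>2) powr nu * (q\<^sup>2 - p\<^sup>2) \<le> mu_cdf nu q - mu_cdf nu p"
proof -
  have G: "Gamma (nu + 1) > 0" using a by simp
  have c0: "c / (nu + 1) > 0" using a G by (simp add: c_def)
  have G2: "Gamma (nu + 2) = (nu + 1) * Gamma (nu + 1)"
    using Gamma_plus1[of "nu + 1"] a by (auto simp: nonpos_Ints_def add_ac)
  have cdf: "mu_cdf nu x = c / (nu + 1) * (x^2) powr (nu + 1)" if "x \<ge> 0" for x
  proof -
    have "(x^2) powr (nu + 1) = x powr (2 * nu + 2)"
      using that by (cases "x = 0") (auto simp: powr_powr distrib_left simp flip: powr_numeral)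
    then show ?thesis by (simp add: mu_cdf_def c_def G2)
  qed
  have sq: "p\<^sup>2 \<le> q\<^sup>2" using pq by (simp add: power_mono)
  note P = powr_diff_bounds[OF a zero_le_power2 sq]
  have eq: "mu_cdf nu q - mu_cdf nu p = c / (nu + 1) * ((q\<^sup>2) powr (nu + 1) - (p\<^sup>2) powr (nu + 1))"
    using pq by (simp add: cdf right_diff_distrib)
  have "c / (nu + 1) * ((q\<^sup>2) powr (nu + 1) - (p\<^sup>2) powr (nu + 1)) \<le> c / (nu + 1) * ((nu + 1) * (q\<^sup>2) powr nu * (q\<^sup>2 - p\<^sup>2))"
    using c0 by (intro mult_left_mono P(1)) auto
  also have "\<dots> = c * (q\<^sup>2) powr nu * (q\<^sup>2 - p\<^sup>2)" using a by simp
  finally show "mu_cdf nu q - mu_cdf nu p \<le> c * (q\<^sup>2) powr nu * (q\<^sup>2 - p\<^sup>2)" unfolding eq .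
  show "c / (nu + 1) * (q\<^sup>2) powr nu * (q\<^sup>2 - p\<^sup>2) \<le> mu_cdf nu q - mu_cdf nu p"
    unfolding eq mult.assoc using c0 by (intro mult_left_mono P(2)) auto
qed

text \<open>Greedy choice: a point whose distribution value is within \<open>\<eta>\<close> of the
  infimum over \<open>E\<close> is taken, and the points at measure distance less than \<open>h\<close>
  are discarded, which costs measure at most \<open>\<eta> + h\<close>.\<close>

lemma separated_points:
  assumes a: "nu \<ge> 0" and h: "h \<ge> 0" and E: "E \<in> fmeasurable (mu nu)"
    and big: "measure (mu nu) E > real n * h"
  shows "\<exists>x. (\<forall>i\<le>n. x i \<in> E) \<and> (\<forall>i<n. mu_cdf nu (x (Suc i)) \<ge> mu_cdf nu (x i) + h)"
  using E big
proof (induction n arbitrary: E)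
  case 0
  then have "E \<noteq> {}" by auto
  then obtain y where "y \<in> E" by auto
  then show ?case by (intro exI[of _ "\<lambda>_. y"]) auto
next
  case (Suc n)
  let ?G = "mu_cdf nu" and ?m = "measure (mu nu)"
  have E0: "E \<subseteq> {0..}" using sets.sets_into_space[of E "mu nu"] Suc.prems(1) by (simp add: fmeasurable_def)
  have Es: "E \<in> sets (mu nu)" using Suc.prems(1) by (rule fmeasurableD)
  define \<eta> where "\<eta> = (?m E - real (Suc n) * h) / 2"
  have eta: "\<eta> > 0" using Suc.prems(2) by (simp add: \<eta>_def)
  have "?m E > 0" using Suc.prems(2) h by (smt (verit) mult_nonneg_nonneg of_nat_0_le_iff)
  then have ne: "?G ` E \<noteq> {}" by auto
  have bdd: "bdd_below (?G ` E)" using mu_cdf_nonneg[OF a] by (intro bdd_belowI[of _ 0]) auto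
  define s where "s = Inf (?G ` E)"
  have s0: "s \<ge> 0" unfolding s_def using mu_cdf_nonneg[OF a] by (intro cInf_greatest ne) auto
  have s_le: "s \<le> ?G x" if "x \<in> E" for x unfolding s_def using that bdd by (intro cInf_lower) auto
  obtain x0 where x0: "x0 \<in> E" "?G x0 < s + \<eta>"
    using cInf_lessD[OF ne, of "s + \<eta>"] eta by (auto simp: s_def)
  define E' where "E' = {x \<in> E. ?G x \<ge> ?G x0 + h}"
  have "?G \<in> borel_measurable (mu nu)" by (rule measurable_borel_mu) measurable
  then have "{x \<in> space (mu nu). ?G x \<ge> ?G x0 + h} \<in> sets (mu nu)" by measurable
  then have "E \<inter> {x \<in> space (mu nu). ?G x \<ge> ?G x0 + h} \<in> sets (mu nu)" using Es by blast
  also have "E \<inter> {x \<in> space (mu nu). ?G x \<ge> ?G x0 + h} = E'" using E0 by (auto simp: E'_def)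
  finally have E's: "E' \<in> sets (mu nu)" .
  have E': "E' \<in> fmeasurable (mu nu)"
    by (rule fmeasurableI2[OF Suc.prems(1) _ E's]) (auto simp: E'_def)
  obtain p where p: "p \<ge> 0" "?G p = s" using mu_cdf_surj[OF a s0] .
  have r0: "s + \<eta> + h \<ge> 0" using s0 eta h by simp
  obtain q where q: "q \<ge> 0" "?G q = s + \<eta> + h" using mu_cdf_surj[OF a r0] .
  have pq: "p \<le> q"
  proof (rule ccontr)
    assume "\<not> p \<le> q"
    then have "?G q < ?G p" using q by (intro mu_cdf_strict_mono[OF a]) auto
    then show False using p q eta h by simp
  qed
  have sub: "E - E' \<subseteq> {p..<q}"
  proof
    fix x assume x: "x \<in> E - E'"
    then have xE: "x \<in> E" "x \<ge> 0" and gx: "?G x < ?G x0 + h" using E0 by (auto simp: E'_def)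
    have "\<not> x < p" using mu_cdf_strict_mono[OF a xE(2), of p] s_le[OF xE(1)] p by auto
    moreover have "\<not> q \<le> x" using mu_cdf_mono[OF a q(1), of x] q gx x0 by auto
    ultimately show "x \<in> {p..<q}" by auto
  qed
  have "?m (E - E') \<le> ?m {p..<q}"
  proof (rule measure_mono_fmeasurable[OF sub])
    show "E - E' \<in> sets (mu nu)" using Es E's by blast
    show "{p..<q} \<in> fmeasurable (mu nu)"
      using p by (intro fmeasurable_mu_bounded[OF a, of _ p q] sets_borel_mu) auto
  qed
  also have "\<dots> = \<eta> + h" using measure_mu_half_open[OF a p(1) pq] p q by simp
  finally have "?m (E - E') \<le> \<eta> + h" .
  moreover have "?m E = ?m (E - E') + ?m E'"
    using measure_Diff[of "mu nu" E E'] Suc.prems(1) E's by (auto simp: E'_def fmeasurable_def)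
  ultimately have "?m E' > real n * h" using eta by (simp add: \<eta>_def field_simps)
  from Suc.IH[OF E' this] obtain y where y: "\<And>i. i \<le> n \<Longrightarrow> y i \<in> E'"
    "\<And>i. i < n \<Longrightarrow> ?G (y (Suc i)) \<ge> ?G (y i) + h" by blast
  define x where "x i = (case i of 0 \<Rightarrow> x0 | Suc j \<Rightarrow> y j)" for i
  have "x i \<in> E" if "i \<le> Suc n" for i
    using that x0 y by (auto simp: x_def E'_def split: nat.split)
  moreover have "?G (x (Suc i)) \<ge> ?G (x i) + h" if "i < Suc n" for i
    using that y(1)[of 0] y(2) by (cases i) (auto simp: x_def E'_def)
  ultimately show ?case by blast
qed

lemma well_separated_points:
  assumes a: "nu \<ge> 0" and n: "n \<ge> 1" and E: "E \<in> fmeasurable (mu nu)" and pos: "measure (mu nu) E > 0"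
  obtains x where "\<And>i. i < n \<Longrightarrow> x i \<in> E"
    and "\<And>i j. i < j \<Longrightarrow> j < n \<Longrightarrow> mu_cdf nu (x j) - mu_cdf nu (x i) \<ge> real (j - i) * (measure (mu nu) E / real n)"
proof -
  define h where "h = measure (mu nu) E / real n"
  have "real (n - 1) * h < measure (mu nu) E"
    using n pos by (simp add: h_def field_simps of_nat_diff)
  then obtain x where x: "\<And>i. i \<le> n - 1 \<Longrightarrow> x i \<in> E"
    "\<And>i. i < n - 1 \<Longrightarrow> mu_cdf nu (x (Suc i)) \<ge> mu_cdf nu (x i) + h"
    using separated_points[OF a _ E, of h "n - 1"] pos n by (auto simp: h_def)
  have sep: "mu_cdf nu (x (i + d)) - mu_cdf nu (x i) \<ge> real d * h" if "i + d < n" for i d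
    using that
  proof (induction d)
    case (Suc d)
    moreover from Suc.prems have "i + d < n - 1" by linarith
    ultimately show ?case using x(2)[of "i + d"] by (simp add: algebra_simps)
  qed simp
  show ?thesis
  proof (rule that)
    show "x i \<in> E" if "i < n" for i using x(1)[of i] that by simp
    show "mu_cdf nu (x j) - mu_cdf nu (x i) \<ge> real (j - i) * (measure (mu nu) E / real n)"
      if "i < j" "j < n" for i j
      using sep[of i "j - i"] that by (simp add: h_def)
  qed
qed

section \<open>The estimate on one interval\<close>

text \<open>Since \<open>n\<^sup>n \<le> 3\<^sup>n n!\<close>, the quotient
  \<open>X\<^sup>n / n!\<close> is at most \<open>(1/3)\<^sup>n\<close>, while
  \<open>exp X \<le> (3/2)\<^sup>n\<close>.\<close>

lemma taylor_remainder_small: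
  fixes X :: real
  assumes X: "X \<ge> 0" and n: "n \<ge> 1" "real n \<ge> 9 * X"
  shows "X ^ n * exp X / fact n \<le> 1 / 2"
proof -
  have "exp (- (1 / 9 :: real)) \<ge> 1 + - (1 / 9)" by (rule exp_ge_add_one_self)
  then have "inverse (exp (- (1 / 9 :: real))) \<le> inverse (8 / 9)" by (intro le_imp_inverse_le) auto
  then have e9: "exp (1 / 9 :: real) \<le> 3 / 2" by (simp add: exp_minus)
  have "exp X \<le> exp (real n * (1 / 9))" using n by simp
  also have "\<dots> = exp (1 / 9) ^ n" by (rule exp_of_nat_mult)
  also have "\<dots> \<le> (3 / 2) ^ n" by (intro power_mono e9) simp
  finally have eX: "exp X \<le> (3 / 2) ^ n" .
  have "X ^ n \<le> (real n / 9) ^ n" using X n by (intro power_mono) auto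
  also have "\<dots> = real n ^ n / 9 ^ n" by (rule power_divide)
  also have "\<dots> \<le> 3 ^ n * fact n / 9 ^ n" by (intro divide_right_mono n_power_n_le) simp
  also have "\<dots> = (1 / 3) ^ n * fact n"
    using power_mult_distrib[of "3::real" 3 n] by (simp add: power_divide)
  finally have "X ^ n * exp X \<le> ((1 / 3) ^ n * fact n) * (3 / 2) ^ n"
    using X eX by (intro mult_mono) auto
  also have "\<dots> = (1 / 2) ^ n * fact n"
    using power_mult_distrib[of "1 / 3 :: real" "3 / 2" n] by simp
  finally have "X ^ n * exp X / fact n \<le> (1 / 2) ^ n" by (simp add: divide_le_eq)
  also have "\<dots> \<le> (1 / 2 :: real) ^ 1" using n by (intro power_decreasing) auto
  finally show ?thesis by simp
qed

text \<open>Only for \<open>l = 0\<close> does the cut at \<open>a\<close> remove anything, and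
  \<open>{0..a}\<close> has measure at most a quarter of that of \<open>{0..2 a}\<close>.\<close>

lemma mu_upper_part:
  assumes al: "\<alpha> \<ge> 0" and a: "a > 0" and l: "l = 0 \<or> l \<ge> 2 * a"
  shows "measure (mu \<alpha>) {max l a..<l + 2 * a} \<ge> 3 / 4 * measure (mu \<alpha>) {l..<l + 2 * a}"
  using l
proof
  assume "l \<ge> 2 * a"
  then have "max l a = l" using a by simp
  then show ?thesis by simp
next
  assume l0: "l = 0"
  let ?G = "mu_cdf \<alpha>"
  have "(2::real) powr 2 \<le> 2 powr (2 * \<alpha> + 2)" using al by (intro powr_mono) auto
  then have "4 * a powr (2 * \<alpha> + 2) \<le> (2 * a) powr (2 * \<alpha> + 2)" using a by (simp add: powr_mult)
  then have "pi powr (\<alpha> + 1) / Gamma (\<alpha> + 2) * (4 * a powr (2 * \<alpha> + 2)) \<le> ?G (2 * a)"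
    unfolding mu_cdf_def by (intro mult_left_mono less_imp_le[OF mu_cdf_const_pos[OF al]])
  then have "4 * ?G a \<le> ?G (2 * a)" by (simp add: mu_cdf_def mult.left_commute)
  moreover have "?G 0 = 0" using al by (simp add: mu_cdf_def)
  ultimately show ?thesis
    using a l0 by (simp add: measure_mu_half_open[OF al])
qed

context band_limited
begin

text \<open>The factor \<open>9\<close> bounds the total integral by a geometric series with sum
  \<open>1/8\<close> of the squared norm.\<close>

definition deriv_energy :: "real \<Rightarrow> ennreal" where
  "deriv_energy x =
     (\<Sum>k. ennreal (x ^ (2 * Suc k) * (hankel_deriv \<alpha> g (Suc k) (x^2))^2 / (9 * (pi * b)^2) ^ Suc k))"

lemma hankel_deriv_measurable [measurable]: "hankel_deriv \<alpha> g k \<in> borel_measurable borel"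
  by (intro borel_measurable_continuous_onI continuous_at_imp_continuous_on ballI
      DERIV_isCont[OF hankel_deriv_has_derivative])

lemma deriv_energy_measurable [measurable]: "deriv_energy \<in> borel_measurable (mu \<alpha>)"
  unfolding deriv_energy_def[abs_def] by (rule measurable_borel_mu) measurable

lemma deriv_bound_of_energy:
  assumes E: "deriv_energy x \<le> ennreal (m\<^sup>2)" and m: "m \<ge> 0" and x: "x > 0" and k: "k \<ge> 1"
  shows "\<bar>hankel_deriv \<alpha> g k (x^2)\<bar> \<le> m * (3 * pi * b / x) ^ k"
proof -
  let ?f = "\<lambda>k. ennreal (x ^ (2 * Suc k) * (hankel_deriv \<alpha> g (Suc k) (x^2))^2 / (9 * (pi * b)^2) ^ Suc k)"
  obtain j where j: "k = Suc j" using k by (cases k) auto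
  have "?f j \<le> suminf ?f" using sum_le_suminf[of ?f "{j}"] by simp
  also have "\<dots> \<le> ennreal (m\<^sup>2)" using E by (simp add: deriv_energy_def)
  finally have "x ^ (2 * k) * (hankel_deriv \<alpha> g k (x^2))^2 / (9 * (pi * b)^2) ^ k \<le> m\<^sup>2"
    unfolding j by (subst (asm) ennreal_le_iff) auto
  then have "x ^ (2 * k) * (hankel_deriv \<alpha> g k (x^2))^2 \<le> m\<^sup>2 * (9 * (pi * b)^2) ^ k"
    using b by (simp add: divide_le_eq)
  moreover have "(9 * (pi * b)^2) ^ k = ((3 * pi * b) ^ k)^2"
  proof -
    have "9 * (pi * b)^2 = (3 * pi * b)^2" by (simp add: power_mult_distrib)
    then show ?thesis by (simp only: power_mult[symmetric] mult.commute)
  qed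
  moreover have "x ^ (2 * k) = (x ^ k)^2" by (simp only: power_mult[symmetric] mult.commute)
  ultimately have "(x ^ k * hankel_deriv \<alpha> g k (x^2))^2 \<le> (m * (3 * pi * b) ^ k)^2"
    by (simp add: power_mult_distrib)
  then have "\<bar>x ^ k * hankel_deriv \<alpha> g k (x^2)\<bar> \<le> \<bar>m * (3 * pi * b) ^ k\<bar>"
    by (simp only: abs_le_square_iff)
  also have "\<dots> = m * (3 * pi * b) ^ k" using m b by (intro abs_of_nonneg) simp
  finally have "\<bar>x ^ k * hankel_deriv \<alpha> g k (x^2)\<bar> \<le> m * (3 * pi * b) ^ k" .
  then show ?thesis using x by (simp add: abs_mult power_divide field_simps)
qed

lemma square_integrable_piece:
  "A \<in> sets (mu \<alpha>) \<Longrightarrow> integrable (mu \<alpha>) (\<lambda>x. (hankel_deriv \<alpha> g 0 (x^2))^2 * indicator A x)"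
  using hankel_bernstein(1)[of 0] by (intro integrable_real_mult_indicator) auto

text \<open>Otherwise the derivative energy would exceed the mean on the part of \<open>I\<close> beyond
  \<open>a\<close>, which has at least \<open>3/4\<close> of the measure, and so integrate to more than
  \<open>3/8 S\<close>. The point must stay away from \<open>0\<close> because the energy controls
  derivatives only up to powers of \<open>x\<close>.\<close>

lemma good_point:
  assumes a: "a > 0" and l: "l = 0 \<or> l \<ge> 2 * a"
  defines "I \<equiv> {l..<l + 2 * a}"
  defines "S \<equiv> LINT x|mu \<alpha>. (hankel_deriv \<alpha> g 0 (x^2))^2 * indicator I x"
  assumes S: "S > 0" and small: "(\<integral>\<^sup>+x. deriv_energy x * indicator I x \<partial>mu \<alpha>) < ennreal (3 / 8 * S)"
  shows "\<exists>x\<in>I. x \<ge> a \<and> deriv_energy x \<le> ennreal (S / measure (mu \<alpha>) I)"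
proof (rule ccontr)
  assume neg: "\<not> ?thesis"
  let ?I' = "{max l a..<l + 2 * a}" and ?M = "S / measure (mu \<alpha>) I"
  have l0: "l \<ge> 0" using l a by auto
  have posI: "measure (mu \<alpha>) I > 0"
    unfolding I_def using l0 a mu_cdf_strict_mono[OF alpha l0, of "l + 2 * a"]
    by (simp add: measure_mu_half_open[OF alpha])
  have I': "?I' \<in> sets (mu \<alpha>)" "?I' \<subseteq> I" using l0 a by (auto intro!: sets_borel_mu simp: I_def)
  have fin: "emeasure (mu \<alpha>) ?I' = ennreal (measure (mu \<alpha>) ?I')"
  proof -
    have "?I' \<in> fmeasurable (mu \<alpha>)"
      by (rule fmeasurable_mu_bounded[OF alpha I'(1), of "max l a" "l + 2 * a"]) (use l0 in auto)
    then show ?thesis by (rule emeasure_eq_measure2)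
  qed
  have "ennreal (3 / 8 * S) \<le> ennreal (?M * measure (mu \<alpha>) ?I')"
  proof (rule ennreal_leI)
    have "3 / 8 * S \<le> ?M * (3 / 4 * measure (mu \<alpha>) I)" using posI S by simp
    also have "\<dots> \<le> ?M * measure (mu \<alpha>) ?I'"
      using mu_upper_part[OF alpha a l] S posI unfolding I_def by (intro mult_left_mono) auto
    finally show "3 / 8 * S \<le> ?M * measure (mu \<alpha>) ?I'" .
  qed
  also have "\<dots> = ennreal ?M * emeasure (mu \<alpha>) ?I'" unfolding fin by (rule ennreal_mult') (use S posI in simp)
  also have "\<dots> = (\<integral>\<^sup>+x. ennreal ?M * indicator ?I' x \<partial>mu \<alpha>)"
    using I' by (simp add: nn_integral_cmult_indicator)
  also have "\<dots> \<le> (\<integral>\<^sup>+x. deriv_energy x * indicator I x \<partial>mu \<alpha>)"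
  proof (intro nn_integral_mono)
    fix x
    show "ennreal ?M * indicator ?I' x \<le> deriv_energy x * indicator I x"
    proof (cases "x \<in> ?I'")
      case True
      then have "x \<in> I" "x \<ge> a" using I' by auto
      then have "ennreal ?M \<le> deriv_energy x" using neg by (meson not_le less_imp_le)
      then show ?thesis using True \<open>x \<in> I\<close> by simp
    qed simp
  qed
  also have "\<dots> < ennreal (3 / 8 * S)" by (rule small)
  finally show False by simp
qed

lemma deriv_bound_on_interval:
  assumes m: "m \<ge> 0" and x0: "x0 > 0" and E: "deriv_energy x0 \<le> ennreal (m\<^sup>2)" and n: "n \<ge> 1"
  shows "\<bar>hankel_deriv \<alpha> g n t\<bar> \<le> m * (3 * pi * b / x0) ^ n * exp (3 * pi * b / x0 * \<bar>t - x0\<^sup>2\<bar>)"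
proof (rule hankel_deriv_bound_from_point)
  show "\<bar>hankel_deriv \<alpha> g (n + k) (x0\<^sup>2)\<bar> \<le> m * (3 * pi * b / x0) ^ n * (3 * pi * b / x0) ^ k" for k
    using deriv_bound_of_energy[OF E m x0, of "n + k"] n by (simp add: power_add mult.assoc)
qed

text \<open>In the variable \<open>t\<close> the interval has length at most \<open>6 a x0\<close>,
  whereas \<open>k\<close>-th derivatives at \<open>x0\<^sup>2\<close> are at most
  \<open>m (3 pi b / x0)\<^sup>k\<close>; the product \<open>18 pi a b\<close> is the parameter of
  the exponential series, and \<open>n\<close> is at least nine times as large.\<close>

lemma error_bound_on_interval:
  assumes a: "a > 0" and l: "l = 0 \<or> l \<ge> 2 * a" and x0: "x0 \<in> {l..<l + 2 * a}" "x0 \<ge> a"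
    and m: "m \<ge> 0" and E: "deriv_energy x0 \<le> ennreal (m\<^sup>2)"
    and n: "n \<ge> 1" "real n \<ge> 162 * pi * (a * b)" and t: "t \<in> {l\<^sup>2..(l + 2 * a)^2}"
  shows "\<bar>hankel_deriv \<alpha> g n t\<bar> * ((l + 2 * a)^2 - l\<^sup>2) ^ n / fact n \<le> m / 2"
proof -
  define H where "H = (l + 2 * a)^2 - l\<^sup>2"
  define q where "q = 3 * pi * b / x0"
  define X where "X = 18 * pi * (a * b)"
  have x0p: "x0 > 0" using x0 a by simp
  have l0: "l \<ge> 0" using l a by auto
  have q: "q \<ge> 0" using b x0p by (simp add: q_def)
  have Heq: "H = 4 * a * (l + a)" by (simp add: H_def power2_eq_square algebra_simps)
  have H0: "H \<ge> 0" using Heq a l0 by simp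
  have "l + a \<le> 3 / 2 * x0" using l x0 a by auto
  then have "4 * a * (l + a) \<le> 4 * a * (3 / 2 * x0)" using a by (intro mult_left_mono) auto
  then have "H \<le> 6 * a * x0" by (simp add: Heq)
  then have "q * H \<le> q * (6 * a * x0)" using q by (rule mult_left_mono)
  also have "\<dots> = X" using x0p by (simp add: q_def X_def)
  finally have qH: "q * H \<le> X" .
  have "x0\<^sup>2 \<in> {l\<^sup>2..(l + 2 * a)^2}" using x0 l0 a by (auto intro!: power_mono)
  then have "\<bar>t - x0\<^sup>2\<bar> \<le> H" using t by (auto simp: H_def)
  then have "q * \<bar>t - x0\<^sup>2\<bar> \<le> q * H" using q by (rule mult_left_mono)
  then have "q * \<bar>t - x0\<^sup>2\<bar> \<le> X" using qH by simp
  then have "m * q ^ n * exp (q * \<bar>t - x0\<^sup>2\<bar>) \<le> m * q ^ n * exp X"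
    using m q by (intro mult_left_mono) auto
  with deriv_bound_on_interval[OF m x0p E n(1), of t, folded q_def]
  have F: "\<bar>hankel_deriv \<alpha> g n t\<bar> \<le> m * q ^ n * exp X" by (rule order_trans)
  then have "\<bar>hankel_deriv \<alpha> g n t\<bar> * H ^ n / fact n \<le> (m * q ^ n * exp X) * H ^ n / fact n"
    using H0 by (intro divide_right_mono mult_right_mono) auto
  also have "\<dots> = m * ((q * H) ^ n * exp X / fact n)" by (simp add: power_mult_distrib)
  also have "\<dots> \<le> m * (X ^ n * exp X / fact n)"
    using m q H0 qH by (intro mult_left_mono divide_right_mono mult_right_mono power_mono) auto
  also have "\<dots> \<le> m * (1 / 2)"
    using a b n by (intro mult_left_mono m taylor_remainder_small) (auto simp: X_def)
  finally show ?thesis by (simp add: H_def)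
qed

text \<open>Markov's inequality. If the integral over \<open>E\<close> vanishes then so does the
  function almost everywhere on \<open>E\<close>.\<close>

lemma large_sublevel_set:
  assumes E: "E \<in> fmeasurable (mu \<alpha>)" and pos: "measure (mu \<alpha>) E > 0"
  defines "T \<equiv> LINT x|mu \<alpha>. (hankel_deriv \<alpha> g 0 (x^2))^2 * indicator E x"
  defines "E' \<equiv> {x \<in> E. (hankel_deriv \<alpha> g 0 (x^2))^2 \<le> 2 * T / measure (mu \<alpha>) E}"
  shows "E' \<in> fmeasurable (mu \<alpha>)" and "measure (mu \<alpha>) E' \<ge> measure (mu \<alpha>) E / 2"
proof -
  let ?u = "\<lambda>x. (hankel_deriv \<alpha> g 0 (x^2))^2" and ?m = "measure (mu \<alpha>)"
  define v where "v = 2 * T / ?m E"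
  have Es: "E \<in> sets (mu \<alpha>)" using E by (rule fmeasurableD)
  have [measurable]: "?u \<in> borel_measurable (mu \<alpha>)" by (rule measurable_borel_mu) measurable
  have "{x \<in> space (mu \<alpha>). ?u x \<le> v} \<in> sets (mu \<alpha>)" by measurable
  with Es have "E \<inter> {x \<in> space (mu \<alpha>). ?u x \<le> v} \<in> sets (mu \<alpha>)" by (rule sets.Int)
  also have "E \<inter> {x \<in> space (mu \<alpha>). ?u x \<le> v} = E'"
    using sets.sets_into_space[OF Es] by (auto simp: E'_def v_def)
  finally have E's: "E' \<in> sets (mu \<alpha>)" .
  have sub: "E' \<subseteq> E" by (auto simp: E'_def)
  show E'f: "E' \<in> fmeasurable (mu \<alpha>)" by (rule fmeasurableI2[OF E sub E's])
  let ?D = "E - E'"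
  have Df: "?D \<in> fmeasurable (mu \<alpha>)" using E E'f by (rule fmeasurable.Diff)
  have Ds: "?D \<in> sets (mu \<alpha>)" using Df by (rule fmeasurableD)
  have split: "?m E = ?m ?D + ?m E'"
    using measure_Diff[of "mu \<alpha>" E E'] E E's sub by (auto simp: fmeasurable_def)
  have int: "integrable (mu \<alpha>) (\<lambda>x. ?u x * indicator E x)" by (rule square_integrable_piece[OF Es])
  have T0: "T \<ge> 0" unfolding T_def by (intro integral_nonneg_AE) auto
  have "?m ?D \<le> ?m E / 2"
  proof (cases "T = 0")
    case True
    then have "AE x in mu \<alpha>. ?u x * indicator E x = 0"
      unfolding T_def by (subst (asm) integral_nonneg_eq_0_iff_AE[OF int]) auto
    then have "AE x in mu \<alpha>. x \<notin> ?D"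
      by eventually_elim (auto simp: E'_def True indicator_def)
    then have "?m ?D = 0" using Ds by (simp add: AE_iff_null_sets measure_eq_0_null_sets)
    then show ?thesis using pos by simp
  next
    case False
    have "v * ?m ?D = (LINT x|mu \<alpha>. v * indicator ?D x)"
      using sets.Int_space_eq2[OF Ds] by simp
    also have "\<dots> \<le> T"
      unfolding T_def
    proof (rule integral_mono)
      show "integrable (mu \<alpha>) (\<lambda>x. v * indicator ?D x)"
        using Df by (intro integrable_mult_right integrable_real_indicator) (auto simp: fmeasurable_def)
      show "v * indicator ?D x \<le> ?u x * indicator E x" for x
        by (auto simp: E'_def v_def indicator_def)
    qed (rule int)
    finally have "2 * T * ?m ?D \<le> T * ?m E" using pos by (simp add: v_def field_simps)
    then show ?thesis using False T0 by simp
  qed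
  then show "?m E' \<ge> ?m E / 2" using split by simp
qed

text \<open>If the derivative energy on the interval is small, \<open>good_point\<close> and
  \<open>error_bound_on_interval\<close> make interpolation accurate to half the root mean square
  \<open>m\<close>. With nodes in a sublevel set on \<open>E\<close> this bounds the function pointwise by
  \<open>A V + m / 2\<close>; squared and integrated, the term with \<open>m\<close> accounts for
  half of \<open>S\<close> and is absorbed.\<close>

lemma local_estimate:
  assumes a: "a > 0" and l: "l = 0 \<or> l \<ge> 2 * a"
    and E: "E \<in> sets (mu \<alpha>)" "E \<subseteq> {l..<l + 2 * a}" and \<gamma>: "\<gamma> > 0"
    and dense: "measure (mu \<alpha>) E \<ge> \<gamma> * measure (mu \<alpha>) {l..<l + 2 * a}"
    and n: "n \<ge> 1" "real n \<ge> 162 * pi * (a * b)"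
  defines "S \<equiv> LINT x|mu \<alpha>. (hankel_deriv \<alpha> g 0 (x^2))^2 * indicator {l..<l + 2 * a} x"
    and "T \<equiv> LINT x|mu \<alpha>. (hankel_deriv \<alpha> g 0 (x^2))^2 * indicator E x"
  shows "S \<le> 72 / \<gamma> * (12 * (\<alpha> + 1) / \<gamma>) ^ (2 * (n - 1)) * T \<or>
    ennreal (3 / 8 * S) \<le> (\<integral>\<^sup>+x. deriv_energy x * indicator {l..<l + 2 * a} x \<partial>mu \<alpha>)"
proof -
  let ?u = "\<lambda>x. hankel_deriv \<alpha> g 0 (x^2)" and ?m = "measure (mu \<alpha>)"
  define I where "I = {l..<l + 2 * a}"
  define r where "r = l + 2 * a"
  have l0: "l \<ge> 0" using l a by auto
  have r: "r > l" "r > 0" using a l0 by (auto simp: r_def)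
  have Is: "I \<in> sets (mu \<alpha>)" using l0 by (intro sets_borel_mu) (auto simp: I_def)
  have If: "I \<in> fmeasurable (mu \<alpha>)"
    using l0 by (intro fmeasurable_mu_bounded[OF alpha Is, of l r]) (auto simp: I_def r_def)
  have mI: "?m I = mu_cdf \<alpha> r - mu_cdf \<alpha> l"
    unfolding I_def r_def[symmetric] using l0 r by (intro measure_mu_half_open alpha) auto
  have posI: "?m I > 0" using mu_cdf_strict_mono[OF alpha l0 r(1)] by (simp add: mI)
  have Ef: "E \<in> fmeasurable (mu \<alpha>)" using E by (intro fmeasurableI2[OF If]) (auto simp: I_def)
  have EI: "?m E \<le> ?m I" using E by (intro measure_mono_fmeasurable[OF _ E(1) If]) (auto simp: I_def)
  have dE: "?m E \<ge> \<gamma> * ?m I" using dense by (simp add: I_def)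
  have posE: "?m E > 0" using dE mult_pos_pos[OF \<gamma> posI] by linarith
  have "\<gamma> * ?m I \<le> 1 * ?m I" using dE EI by linarith
  then have \<gamma>1: "\<gamma> \<le> 1" using posI by (simp only: mult_le_cancel_right_pos)
  have T0: "T \<ge> 0" unfolding T_def by (intro integral_nonneg_AE) auto
  have S0: "S \<ge> 0" unfolding S_def by (intro integral_nonneg_AE) auto
  have main: "S \<le> 72 / \<gamma> * (12 * (\<alpha> + 1) / \<gamma>) ^ (2 * (n - 1)) * T"
    if S: "S > 0" and small: "(\<integral>\<^sup>+x. deriv_energy x * indicator I x \<partial>mu \<alpha>) < ennreal (3 / 8 * S)"
  proof -
    obtain x0 where x0: "x0 \<in> I" "x0 \<ge> a" "deriv_energy x0 \<le> ennreal (S / ?m I)"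
      using good_point[OF a l] S small unfolding I_def S_def by blast
    define m where "m = sqrt (S / ?m I)"
    have m2: "m\<^sup>2 = S / ?m I" using S0 posI by (simp add: m_def)
    have m0: "m \<ge> 0" using S0 posI by (simp add: m_def)
    define E' where "E' = {x \<in> E. (?u x)^2 \<le> 2 * T / ?m E}"
    have E': "E' \<in> fmeasurable (mu \<alpha>)" "?m E' \<ge> ?m E / 2"
      using large_sublevel_set[OF Ef posE] by (simp_all add: E'_def T_def)
    obtain x where x: "\<And>i. i < n \<Longrightarrow> x i \<in> E'"
      and sep: "\<And>i j. i < j \<Longrightarrow> j < n \<Longrightarrow> mu_cdf \<alpha> (x j) - mu_cdf \<alpha> (x i) \<ge> real (j - i) * (?m E' / real n)"
      using well_separated_points[OF alpha n(1) E'(1)] E'(2) posE by auto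
    have xI: "l \<le> x i \<and> x i \<le> r" if "i < n" for i
      using x[OF that] E by (auto simp: E'_def r_def)
    \<comment> \<open>half of \<open>\<gamma>\<close> is lost to the sublevel set, and \<open>\<alpha> + 1\<close> to comparing \<open>mu\<close> with Lebesgue measure in \<open>t\<close>\<close>
    define \<delta> where "\<delta> = \<gamma> / (2 * (\<alpha> + 1))"
    have \<delta>: "\<delta> > 0" "\<delta> \<le> 1" using \<gamma> \<gamma>1 alpha by (auto simp: \<delta>_def divide_simps)
    define c where "c = pi powr (\<alpha> + 1) / Gamma (\<alpha> + 1) * (r\<^sup>2) powr \<alpha>"
    have c: "c > 0" using alpha r by (simp add: c_def)
    have mI_ge: "c / (\<alpha> + 1) * (r\<^sup>2 - l\<^sup>2) \<le> ?m I"
      using mu_cdf_diff_bounds(2)[OF alpha l0, of r] r by (simp add: mI c_def)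
    have tsep: "(x j)^2 - (x i)^2 \<ge> real (j - i) * (\<delta> * (r\<^sup>2 - l\<^sup>2) / real n)" if ij: "i < j" "j < n" for i j
    proof -
      have xi: "0 \<le> x i" "x i \<le> r" "0 \<le> x j" "x j \<le> r" using xI[of i] xI[of j] ij l0 by auto
      have posE': "?m E' > 0" using E'(2) posE by simp
      have "0 < real (j - i) * (?m E' / real n)" using ij posE' by simp
      then have "mu_cdf \<alpha> (x i) < mu_cdf \<alpha> (x j)" using sep[OF ij] by linarith
      then have lt: "x i < x j" using mu_cdf_mono[OF alpha xi(3), of "x i"] by (meson not_le)
      have sq: "(x i)^2 \<le> (x j)^2" using lt xi by (intro power_mono) auto
      have "real (j - i) * ((\<gamma> * (c / (\<alpha> + 1) * (r\<^sup>2 - l\<^sup>2)) / 2) / real n) \<le> real (j - i) * (?m E' / real n)"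
      proof (intro mult_left_mono divide_right_mono)
        have half: "w / 2 \<le> ?m E'" if "w \<le> \<gamma> * ?m I" for w
          using that E'(2) dE by linarith
        have "\<gamma> * (c / (\<alpha> + 1) * (r\<^sup>2 - l\<^sup>2)) \<le> \<gamma> * ?m I" using \<gamma> by (intro mult_left_mono mI_ge) auto
        then show "\<gamma> * (c / (\<alpha> + 1) * (r\<^sup>2 - l\<^sup>2)) / 2 \<le> ?m E'" by (rule half)
      qed auto
      also have "\<dots> \<le> mu_cdf \<alpha> (x j) - mu_cdf \<alpha> (x i)" by (rule sep[OF ij])
      also have "\<dots> \<le> pi powr (\<alpha> + 1) / Gamma (\<alpha> + 1) * ((x j)^2) powr \<alpha> * ((x j)^2 - (x i)^2)"
        using lt xi by (intro mu_cdf_diff_bounds(1)[OF alpha]) auto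
      also have "\<dots> \<le> c * ((x j)^2 - (x i)^2)"
        unfolding c_def using alpha xi sq
        by (intro mult_right_mono mult_left_mono powr_mono2 power_mono) auto
      finally have "c * (real (j - i) * (\<delta> * (r\<^sup>2 - l\<^sup>2) / real n)) \<le> c * ((x j)^2 - (x i)^2)"
        by (simp add: \<delta>_def mult_ac)
      then show ?thesis using c by (simp only: mult_le_cancel_left_pos)
    qed
    define V where "V = sqrt (2 * T / ?m E)"
    have V2: "V\<^sup>2 = 2 * T / ?m E" using T0 posE by (simp add: V_def)
    define A where "A = 3 * (6 / \<delta>) ^ (n - 1)"
    have A0: "A \<ge> 0" using \<delta> by (simp add: A_def)
    have V0: "V \<ge> 0" using T0 posE by (simp add: V_def)
    \<comment> \<open>interpolation in the variable \<open>t = x\<^sup>2\<close>, with nodes \<open>(x i)\<^sup>2\<close>\<close>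
    have pt: "\<bar>?u y\<bar> \<le> A * V + m / 2" if y: "y \<in> I" for y
      unfolding A_def
    proof (rule interpolation_bound[where t = "\<lambda>i. (x i)^2" and l = "l\<^sup>2" and u = "r\<^sup>2" and f = "hankel_deriv \<alpha> g",
          OF hankel_deriv_has_derivative n(1) \<delta>])
      show "l\<^sup>2 < r\<^sup>2" using r l0 by (intro power_strict_mono) auto
      show "(x i)^2 \<in> {l\<^sup>2..r\<^sup>2}" if "i < n" for i using xI[OF that] l0 by (auto intro!: power_mono)
      show "\<bar>hankel_deriv \<alpha> g 0 ((x i)^2)\<bar> \<le> V" if "i < n" for i
        using x[OF that] unfolding V_def by (intro real_le_rsqrt) (simp add: E'_def)
      show "\<bar>hankel_deriv \<alpha> g n \<xi>\<bar> * (r\<^sup>2 - l\<^sup>2) ^ n / fact n \<le> m / 2" if "\<xi> \<in> {l\<^sup>2..r\<^sup>2}" for \<xi>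
        unfolding r_def using x0 that m0 m2
        by (intro error_bound_on_interval[OF a l, of x0] n) (auto simp: I_def r_def)
      show "y\<^sup>2 \<in> {l\<^sup>2..r\<^sup>2}" using y l0 by (auto intro!: power_mono simp: I_def r_def)
    qed (use tsep in auto)
    have pt2: "(?u y)^2 \<le> 2 * (A\<^sup>2 * V\<^sup>2) + m\<^sup>2 / 2" if y: "y \<in> I" for y
    proof -
      have "\<bar>?u y\<bar>\<^sup>2 \<le> (A * V + m / 2)^2" by (intro power_mono pt[OF y]) auto
      also have "\<dots> \<le> 2 * (A * V)^2 + 2 * (m / 2)^2"
        using sum_squares_bound[of "A * V" "m / 2"] by (simp add: power2_sum)
      finally show ?thesis by (simp add: power_mult_distrib power_divide)
    qed
    define B where "B = 2 * (A\<^sup>2 * V\<^sup>2) + m\<^sup>2 / 2"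
    have "S \<le> (LINT y|mu \<alpha>. B * indicator I y)"
      unfolding S_def I_def[symmetric]
    proof (rule integral_mono[OF square_integrable_piece[OF Is]])
      show "integrable (mu \<alpha>) (\<lambda>y. B * indicator I y)"
        using If by (intro integrable_mult_right integrable_real_indicator) (auto simp: fmeasurable_def)
      show "(?u y)^2 * indicator I y \<le> B * indicator I y" for y
        using pt2[of y] by (auto simp: indicator_def B_def)
    qed
    also have "\<dots> = B * ?m I" using sets.Int_space_eq2[OF Is] by simp
    also have "\<dots> = 2 * (A\<^sup>2 * V\<^sup>2) * ?m I + S / 2" using posI by (simp add: B_def m2 distrib_right)
    finally have "S \<le> 4 * A\<^sup>2 * V\<^sup>2 * ?m I" by simp
    also have "\<dots> = 8 * A\<^sup>2 * T * (?m I / ?m E)" by (simp add: V2)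
    also have "\<dots> \<le> 8 * A\<^sup>2 * T * (1 / \<gamma>)"
      using T0 posE dE \<gamma> by (intro mult_left_mono) (auto simp: field_simps)
    also have "A\<^sup>2 = 9 * (12 * (\<alpha> + 1) / \<gamma>) ^ (2 * (n - 1))"
    proof -
      have "6 / \<delta> = 12 * (\<alpha> + 1) / \<gamma>" using \<gamma> alpha by (simp add: \<delta>_def)
      then show ?thesis by (simp add: A_def power_mult_distrib power_even_eq)
    qed
    finally show ?thesis by (simp add: mult_ac)
  qed
  show ?thesis
  proof (cases "S > 0")
    case False
    then have "S = 0" using S0 by simp
    moreover have "72 / \<gamma> * (12 * (\<alpha> + 1) / \<gamma>) ^ (2 * (n - 1)) * T \<ge> 0" using \<gamma> alpha T0 by simp
    ultimately show ?thesis by simp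
  next
    case True
    then show ?thesis using main[OF True] unfolding I_def by (meson not_le)
  qed
qed

end

section \<open>Summation over the intervals\<close>

lemma sets_mu_half_open: "0 \<le> p \<Longrightarrow> {p..<q} \<in> sets (mu \<alpha>)"
  by (intro sets_borel_mu) auto

lemma nn_integral_mu_partition:
  assumes a: "a > 0" and f[measurable]: "f \<in> borel_measurable (mu \<alpha>)"
  shows "(\<integral>\<^sup>+x. f x \<partial>mu \<alpha>)
    = (\<Sum>j. \<integral>\<^sup>+x. f x * indicator {2 * a * real j..<2 * a * real j + 2 * a} x \<partial>mu \<alpha>)"
proof -
  let ?I = "\<lambda>j::nat. {2 * a * real j..<2 * a * real j + 2 * a}"
  have mI [measurable]: "?I j \<in> sets (mu \<alpha>)" for j
    using a by (intro sets_mu_half_open) simp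
  have disj: "disjoint_family ?I"
    unfolding disjoint_family_on_def
  proof (intro ballI impI)
    have less: "?I i \<inter> ?I j = {}" if "i < j" for i j
    proof -
      have "2 * a * (real i + 1) \<le> 2 * a * real j" using that a by (intro mult_left_mono) auto
      then show ?thesis by (auto simp: distrib_left)
    qed
    show "?I i \<inter> ?I j = {}" if "i \<noteq> j" for i j
      using that by (cases i j rule: linorder_cases) (use less[of i j] less[of j i] in blast)+
  qed
  have "f x = (\<Sum>j. f x * indicator (?I j) x)" if "x \<in> space (mu \<alpha>)" for x
  proof -
    have x: "x \<ge> 0" using that by simp
    define j where "j = nat \<lfloor>x / (2 * a)\<rfloor>"
    have "real j = of_int \<lfloor>x / (2 * a)\<rfloor>" using x a by (simp add: j_def)
    then have "real j \<le> x / (2 * a)" "x / (2 * a) < real j + 1" by linarith+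
    then have "x \<in> ?I j" using a by (simp add: field_simps)
    then have "x \<in> (\<Union>j. ?I j)" by blast
    then show ?thesis by (simp only: ennreal_suminf_cmult suminf_indicator[OF disj] indicator_simps mult_1_right)
  qed
  then have "(\<integral>\<^sup>+x. f x \<partial>mu \<alpha>) = (\<integral>\<^sup>+x. (\<Sum>j. f x * indicator (?I j) x) \<partial>mu \<alpha>)"
    by (intro nn_integral_cong)
  also have "\<dots> = (\<Sum>j. \<integral>\<^sup>+x. f x * indicator (?I j) x \<partial>mu \<alpha>)"
    by (rule nn_integral_suminf) measurable
  finally show ?thesis .
qed

context band_limited
begin

lemma deriv_energy_total: "(\<integral>\<^sup>+x. deriv_energy x \<partial>mu \<alpha>) \<le> ennreal ((LINT x|mu \<alpha>. (g x)^2) / 8)"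
proof -
  define N where "N = (LINT x|mu \<alpha>. (g x)^2)"
  have N0: "N \<ge> 0" by (simp add: N_def)
  let ?h = "\<lambda>k x. x ^ (2 * Suc k) * (hankel_deriv \<alpha> g (Suc k) (x^2))^2"
  let ?q = "9 * (pi * b)^2"
  have q: "?q > 0" using b by simp
  have h0: "?h k x \<ge> 0" for k x by (simp add: power_mult del: mult_Suc_right power_Suc)
  have "(\<integral>\<^sup>+x. deriv_energy x \<partial>mu \<alpha>) = (\<Sum>k. \<integral>\<^sup>+x. ennreal (?h k x / ?q ^ Suc k) \<partial>mu \<alpha>)"
    unfolding deriv_energy_def
    by (rule nn_integral_suminf) (rule measurable_borel_mu, measurable)
  also have "\<dots> \<le> (\<Sum>k. ennreal (N * (1 / 9) ^ Suc k))"
  proof (intro suminf_le summableI)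
    fix k
    have "(\<integral>\<^sup>+x. ennreal (?h k x / ?q ^ Suc k) \<partial>mu \<alpha>) = ennreal (LINT x|mu \<alpha>. ?h k x / ?q ^ Suc k)"
      using q h0 by (intro nn_integral_eq_integral integrable_divide hankel_bernstein(1) AE_I2 divide_nonneg_nonneg) auto
    also have "\<dots> = ennreal ((LINT x|mu \<alpha>. ?h k x) / ?q ^ Suc k)" by simp
    also have "\<dots> \<le> ennreal (((pi * b) ^ (2 * Suc k) * N) / ?q ^ Suc k)"
      using q hankel_bernstein(2)[of "Suc k"] unfolding N_def
      by (intro ennreal_leI divide_right_mono) auto
    also have "((pi * b) ^ (2 * Suc k) * N) / ?q ^ Suc k = N * (1 / 9) ^ Suc k"
      using b unfolding power_mult[of "pi * b"] power_mult_distrib[of 9] by (simp add: power_divide)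
    finally show "(\<integral>\<^sup>+x. ennreal (?h k x / ?q ^ Suc k) \<partial>mu \<alpha>) \<le> ennreal (N * (1 / 9) ^ Suc k)" .
  qed
  also have "\<dots> = ennreal (N / 8)"
  proof (rule suminf_ennreal_eq)
    have "(\<lambda>k. (1 / 9 :: real) ^ Suc k) sums (1 / 8)"
      using sums_mult[OF geometric_sums[of "1 / 9 :: real"], of "1 / 9"] by simp
    then show "(\<lambda>k. N * (1 / 9) ^ Suc k) sums (N / 8)" using sums_mult by fastforce
  qed (use N0 in auto)
  finally show ?thesis by (simp add: N_def)
qed

text \<open>The two cases of \<open>local_estimate\<close> are both covered by the sum of their bounds,
  which can be added up over all intervals without sorting them into good and bad ones.\<close>

lemma global_estimate:
  assumes a: "a > 0" and \<Omega>: "\<Omega> \<in> sets (mu \<alpha>)" and \<gamma>: "\<gamma> > 0"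
    and dense: "\<And>j::nat. measure (mu \<alpha>) (\<Omega> \<inter> {2 * a * real j..<2 * a * real j + 2 * a})
      \<ge> \<gamma> * measure (mu \<alpha>) {2 * a * real j..<2 * a * real j + 2 * a}"
    and n: "n \<ge> 1" "real n \<ge> 162 * pi * (a * b)"
    and inv: "(LINT x|mu \<alpha>. (g x)^2) \<le> (LINT x|mu \<alpha>. (hankel_deriv \<alpha> g 0 (x^2))^2)"
  shows "2 / 3 * (LINT x|mu \<alpha>. (hankel_deriv \<alpha> g 0 (x^2))^2)
    \<le> 72 / \<gamma> * (12 * (\<alpha> + 1) / \<gamma>) ^ (2 * (n - 1)) *
      (LINT x|mu \<alpha>. (hankel_deriv \<alpha> g 0 (x^2))^2 * indicator \<Omega> x)"
proof -
  let ?u = "\<lambda>x. (hankel_deriv \<alpha> g 0 (x^2))^2"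
  let ?I = "\<lambda>j::nat. {2 * a * real j..<2 * a * real j + 2 * a}"
  define K where "K = 72 / \<gamma> * (12 * (\<alpha> + 1) / \<gamma>) ^ (2 * (n - 1))"
  have K: "K \<ge> 0" using \<gamma> alpha by (simp add: K_def)
  define U where "U = (LINT x|mu \<alpha>. ?u x)"
  define W where "W = (LINT x|mu \<alpha>. ?u x * indicator \<Omega> x)"
  have W0: "W \<ge> 0" unfolding W_def by (intro integral_nonneg_AE) auto
  have U0: "U \<ge> 0" by (simp add: U_def)
  have um [measurable]: "?u \<in> borel_measurable (mu \<alpha>)" by (rule measurable_borel_mu) measurable
  have mI: "?I j \<in> sets (mu \<alpha>)" for j
    using a by (intro sets_mu_half_open) simp
  have nn: "(\<integral>\<^sup>+x. ennreal (?u x) * indicator A x \<partial>mu \<alpha>) = ennreal (LINT x|mu \<alpha>. ?u x * indicator A x)"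
    if "A \<in> sets (mu \<alpha>)" for A
    by (subst nn_integral_eq_integral[OF square_integrable_piece[OF that], symmetric])
      (auto intro!: nn_integral_cong simp: indicator_def)
  have piece: "ennreal (LINT x|mu \<alpha>. ?u x * indicator (?I j) x)
      \<le> ennreal K * ennreal (LINT x|mu \<alpha>. ?u x * indicator (\<Omega> \<inter> ?I j) x)
        + ennreal (8 / 3) * (\<integral>\<^sup>+x. deriv_energy x * indicator (?I j) x \<partial>mu \<alpha>)" for j
  proof -
    let ?S = "LINT x|mu \<alpha>. ?u x * indicator (?I j) x"
    let ?T = "LINT x|mu \<alpha>. ?u x * indicator (\<Omega> \<inter> ?I j) x"
    let ?P = "\<integral>\<^sup>+x. deriv_energy x * indicator (?I j) x \<partial>mu \<alpha>"
    have l: "2 * a * real j = 0 \<or> 2 * a * real j \<ge> 2 * a"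
      using a by (cases j) auto
    have S0: "?S \<ge> 0" by (intro integral_nonneg_AE) auto
    have "?S \<le> K * ?T \<or> ennreal (3 / 8 * ?S) \<le> ?P"
      unfolding K_def using dense[of j]
      by (intro local_estimate[OF a l _ _ \<gamma> _ n] sets.Int \<Omega> mI) auto
    then show ?thesis
    proof
      assume "?S \<le> K * ?T"
      then have "ennreal ?S \<le> ennreal K * ennreal ?T"
        using K by (simp add: ennreal_mult'[symmetric] ennreal_leI)
      then show ?thesis by (rule order_trans) simp
    next
      assume P: "ennreal (3 / 8 * ?S) \<le> ?P"
      have "ennreal ?S = ennreal (8 / 3 * (3 / 8 * ?S))" by simp
      also have "\<dots> = ennreal (8 / 3) * ennreal (3 / 8 * ?S)" by (rule ennreal_mult') simp
      also have "\<dots> \<le> ennreal (8 / 3) * ?P" by (intro mult_left_mono P) simp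
      finally show ?thesis by (rule order_trans) simp
    qed
  qed
  have "ennreal U = (\<integral>\<^sup>+x. ennreal (?u x) \<partial>mu \<alpha>)"
    unfolding U_def using hankel_bernstein(1)[of 0] by (intro nn_integral_eq_integral[symmetric]) auto
  also have "\<dots> = (\<Sum>j. ennreal (LINT x|mu \<alpha>. ?u x * indicator (?I j) x))"
    by (subst nn_integral_mu_partition[OF a]) (simp_all add: nn mI)
  also have "\<dots> \<le> (\<Sum>j. ennreal K * ennreal (LINT x|mu \<alpha>. ?u x * indicator (\<Omega> \<inter> ?I j) x)
        + ennreal (8 / 3) * (\<integral>\<^sup>+x. deriv_energy x * indicator (?I j) x \<partial>mu \<alpha>))"
    by (intro suminf_le summableI piece)
  also have "\<dots> = ennreal K * (\<Sum>j. ennreal (LINT x|mu \<alpha>. ?u x * indicator (\<Omega> \<inter> ?I j) x))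
        + ennreal (8 / 3) * (\<Sum>j. \<integral>\<^sup>+x. deriv_energy x * indicator (?I j) x \<partial>mu \<alpha>)"
    by (simp only: suminf_add[OF summableI summableI, symmetric] ennreal_suminf_cmult)
  also have "(\<Sum>j. ennreal (LINT x|mu \<alpha>. ?u x * indicator (\<Omega> \<inter> ?I j) x)) = ennreal W"
  proof -
    have "ennreal W = (\<integral>\<^sup>+x. ennreal (?u x) * indicator \<Omega> x \<partial>mu \<alpha>)"
      unfolding W_def by (rule nn[OF \<Omega>, symmetric])
    also have "\<dots> = (\<Sum>j. \<integral>\<^sup>+x. ennreal (?u x) * indicator \<Omega> x * indicator (?I j) x \<partial>mu \<alpha>)"
      by (intro nn_integral_mu_partition[OF a] borel_measurable_times_ennreal
          measurable_compose[OF um measurable_ennreal] borel_measurable_indicator \<Omega>)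
    also have "\<dots> = (\<Sum>j. \<integral>\<^sup>+x. ennreal (?u x) * indicator (\<Omega> \<inter> ?I j) x \<partial>mu \<alpha>)"
      by (simp add: indicator_inter_arith mult.assoc)
    finally show ?thesis unfolding nn[OF sets.Int[OF \<Omega> mI]] by (rule sym)
  qed
  also have "(\<Sum>j. \<integral>\<^sup>+x. deriv_energy x * indicator (?I j) x \<partial>mu \<alpha>) = (\<integral>\<^sup>+x. deriv_energy x \<partial>mu \<alpha>)"
    by (rule nn_integral_mu_partition[OF a deriv_energy_measurable, symmetric])
  also have "ennreal K * ennreal W + ennreal (8 / 3) * (\<integral>\<^sup>+x. deriv_energy x \<partial>mu \<alpha>)
      \<le> ennreal K * ennreal W + ennreal (8 / 3) * ennreal (U / 8)"
    using inv by (intro add_left_mono mult_left_mono order_trans[OF deriv_energy_total] ennreal_leI)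
      (auto simp: U_def)
  also have "\<dots> = ennreal (K * W + 8 / 3 * (U / 8))"
    using K W0 U0 by (simp add: ennreal_mult'[symmetric] ennreal_plus[symmetric] del: ennreal_plus)
  finally have "U \<le> K * W + 8 / 3 * (U / 8)"
    using K W0 U0 by (subst (asm) ennreal_le_iff) auto
  then have "2 / 3 * U \<le> K * W" by simp
  then show ?thesis by (simp only: U_def K_def W_def)
qed

end

section \<open>Complex-valued functions and the constants\<close>

text \<open>Setting \<open>g\<close> to zero beyond \<open>b\<close> changes it on a null set only; the
  result is integrable because \<open>{0..b}\<close> has finite measure.\<close>

lemma real_valued_estimate:
  assumes al: "\<alpha> \<ge> 0" and a: "a > 0" and b: "b > 0" and \<gamma>: "\<gamma> > 0"
    and fg: "hankel_L2_limit \<alpha> f g"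
    and supp: "AE y in mu \<alpha>. y \<notin> {0..b} \<longrightarrow> g y = 0"
    and \<Omega>: "\<Omega> \<in> sets (mu \<alpha>)"
    and dense: "\<And>j::nat. measure (mu \<alpha>) (\<Omega> \<inter> {2 * a * real j..<2 * a * real j + 2 * a})
      \<ge> \<gamma> * measure (mu \<alpha>) {2 * a * real j..<2 * a * real j + 2 * a}"
    and n: "n \<ge> 1" "real n \<ge> 162 * pi * (a * b)"
  shows "2 / 3 * (LINT x|mu \<alpha>. (f x)\<^sup>2)
    \<le> 72 / \<gamma> * (12 * (\<alpha> + 1) / \<gamma>) ^ (2 * (n - 1)) * (LINT x|mu \<alpha>. (f x)\<^sup>2 * indicator \<Omega> x)"
proof -
  have f: "f \<in> borel_measurable (mu \<alpha>)" "integrable (mu \<alpha>) (\<lambda>x. (f x)\<^sup>2)"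
    and g: "g \<in> borel_measurable (mu \<alpha>)" "integrable (mu \<alpha>) (\<lambda>x. (g x)\<^sup>2)"
    using fg by (auto simp: hankel_L2_limit_def)
  define g' where "g' x = (if x > b then 0 else g x)" for x
  have g'm [measurable]: "g' \<in> borel_measurable (mu \<alpha>)"
    unfolding g'_def[abs_def] using g(1) by measurable
  have eq: "AE x in mu \<alpha>. g x = g' x"
    using supp by eventually_elim (auto simp: g'_def)
  have g'2: "integrable (mu \<alpha>) (\<lambda>x. (g' x)\<^sup>2)"
    by (rule Bochner_Integration.integrable_bound[OF g(2)]) (measurable, auto simp: g'_def)
  have g'1: "integrable (mu \<alpha>) g'"
  proof (rule Bochner_Integration.integrable_bound)
    have "{0..b} \<in> fmeasurable (mu \<alpha>)"
      by (rule fmeasurable_mu_bounded[OF al, of _ 0 b]) (auto intro!: sets_borel_mu)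
    then show "integrable (mu \<alpha>) (\<lambda>x. (g' x)\<^sup>2 + indicator {0..b} x)"
      by (intro Bochner_Integration.integrable_add g'2 integrable_real_indicator) (auto simp: fmeasurable_def)
    show "AE x in mu \<alpha>. norm (g' x) \<le> norm ((g' x)\<^sup>2 + indicator {0..b} x)"
    proof (intro AE_I2)
      fix x assume "x \<in> space (mu \<alpha>)"
      then have x: "x \<ge> 0" by simp
      have "\<bar>y\<bar> \<le> y\<^sup>2 + 1" for y :: real
        using zero_le_power2[of "\<bar>y\<bar> - 1"] zero_le_power2[of y] by (simp add: power2_diff)
      then show "norm (g' x) \<le> norm ((g' x)\<^sup>2 + indicator {0..b} x)"
        using x by (auto simp: g'_def indicator_def)
    qed
  qed measurable
  have fg': "hankel_L2_limit \<alpha> f g'"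
  proof -
    obtain F where F: "\<And>n. integrable (mu \<alpha>) (F n)" "\<And>n. integrable (mu \<alpha>) (\<lambda>x. (F n x)\<^sup>2)"
      and lim: "(\<lambda>n. LINT x|mu \<alpha>. (F n x - f x)\<^sup>2) \<longlonglongrightarrow> 0"
        "(\<lambda>n. LINT x|mu \<alpha>. (hankel \<alpha> (F n) x - g x)\<^sup>2) \<longlonglongrightarrow> 0"
      using fg by (auto simp: hankel_L2_limit_def)
    have hm [measurable]: "hankel \<alpha> (F n) \<in> borel_measurable (mu \<alpha>)" for n
      using F(1)[of n] by (intro measurable_hankel al) simp
    have [measurable]: "g \<in> borel_measurable (mu \<alpha>)" by (rule g)
    have "(LINT x|mu \<alpha>. (hankel \<alpha> (F n) x - g x)\<^sup>2) = (LINT x|mu \<alpha>. (hankel \<alpha> (F n) x - g' x)\<^sup>2)" for n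
      using eq by (intro integral_cong_AE) auto
    then show ?thesis
      unfolding hankel_L2_limit_def using f g'2 g'm F lim by auto
  qed
  interpret band_limited \<alpha> b g'
    by unfold_locales (use al b g'1 g'2 in \<open>auto simp: g'_def\<close>)
  let ?u = "\<lambda>x. hankel_deriv \<alpha> g' 0 (x\<^sup>2)"
  have um [measurable]: "?u \<in> borel_measurable (mu \<alpha>)" by (rule measurable_borel_mu) measurable
  have fu: "AE x in mu \<alpha>. f x = ?u x"
    using hankel_L2_limit_inversion[OF al fg' g'1] hankel_deriv_eq[of 0] by simp
  have [measurable]: "f \<in> borel_measurable (mu \<alpha>)" by (rule f)
  have e1: "(LINT x|mu \<alpha>. (f x)\<^sup>2) = (LINT x|mu \<alpha>. (?u x)\<^sup>2)"
    using fu by (intro integral_cong_AE) auto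
  have e2: "(LINT x|mu \<alpha>. (f x)\<^sup>2 * indicator \<Omega> x) = (LINT x|mu \<alpha>. (?u x)\<^sup>2 * indicator \<Omega> x)"
    using fu \<Omega> by (intro integral_cong_AE) auto
  show ?thesis
    unfolding e1 e2 using hankel_L2_limit_norm_le[OF al fg'] e1
    by (intro global_estimate[OF a \<Omega> \<gamma> dense n]) auto
qed

lemma Lp1_integrable: "F \<in> Lp \<alpha> 1 \<Longrightarrow> integrable (mu \<alpha>) F"
  by (auto simp: Lp_def integrable_norm_iff)

lemma Lp2_integrable:
  assumes "F \<in> Lp \<alpha> 2"
  shows "F \<in> borel_measurable (mu \<alpha>)" "integrable (mu \<alpha>) (\<lambda>x. (norm (F x))\<^sup>2)"
  using assms by (auto simp: Lp_def powr_numeral)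

lemma Lp_norm_on_square: "(Lp_norm_on \<alpha> 2 S F)\<^sup>2 = (LINT x|mu \<alpha>. (norm (F x))\<^sup>2 * indicator S x)"
proof -
  have "(LINT x|mu \<alpha>. (norm (F x))\<^sup>2 * indicator S x) \<ge> 0" by (intro integral_nonneg_AE) auto
  then show ?thesis
    by (simp add: Lp_norm_on_def set_lebesgue_integral_def powr_numeral powr_half_sqrt mult.commute)
qed

lemma Lp_norm_square: "(Lp_norm \<alpha> 2 F)\<^sup>2 = (LINT x|mu \<alpha>. (norm (F x))\<^sup>2)"
  unfolding Lp_norm_on_square by (intro Bochner_Integration.integral_cong) auto

text \<open>Used for \<open>Re\<close> and \<open>Im\<close>: the kernel is real, so \<open>T\<close>
  commutes with the transform, and it does not increase norms.\<close>

lemma hankel_L2_limit_component: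
  fixes T :: "complex \<Rightarrow> real"
  assumes al: "\<alpha> \<ge> 0" and fg: "is_fourier_bessel_L2 \<alpha> f g" and T: "bounded_linear T"
    and T_le: "\<And>z. \<bar>T z\<bar> \<le> norm z"
  shows "hankel_L2_limit \<alpha> (\<lambda>x. T (f x)) (\<lambda>x. T (g x))"
proof -
  interpret T: bounded_linear T by (rule T)
  obtain F where F: "\<And>n. F n \<in> Lp \<alpha> 1" "\<And>n. F n \<in> Lp \<alpha> 2"
    and Ff: "tendsto_Lp \<alpha> 2 F f" and Fg: "tendsto_Lp \<alpha> 2 (\<lambda>n. fourier_bessel \<alpha> (F n)) g"
    using fg by (auto simp: is_fourier_bessel_L2_def)
  have Tm: "(\<lambda>x. T (h x)) \<in> borel_measurable (mu \<alpha>)" if "h \<in> borel_measurable (mu \<alpha>)" for h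
    using that by (rule measurable_compose) (intro borel_measurable_continuous_onI T.continuous_on continuous_on_id)
  have T2_le: "(T z)\<^sup>2 \<le> (norm z)\<^sup>2" for z
    using power_mono[OF T_le[of z], of 2] by simp
  have T2: "integrable (mu \<alpha>) (\<lambda>x. (T (h x))\<^sup>2)"
    if "h \<in> borel_measurable (mu \<alpha>)" "integrable (mu \<alpha>) (\<lambda>x. (norm (h x))\<^sup>2)" for h
    by (rule Bochner_Integration.integrable_bound[OF that(2)])
      (use Tm[OF that(1)] T2_le in auto)
  have lim: "(\<lambda>n. LINT x|mu \<alpha>. (T (H n x) - T (h x))\<^sup>2) \<longlonglongrightarrow> 0" if "tendsto_Lp \<alpha> 2 H h" for H h
  proof -
    have H: "H n \<in> Lp \<alpha> 2" "h \<in> Lp \<alpha> 2" for n using that by (auto simp: tendsto_Lp_def)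
    have "(\<lambda>n. (Lp_norm \<alpha> 2 (\<lambda>x. H n x - h x))\<^sup>2) \<longlonglongrightarrow> 0\<^sup>2"
      using that unfolding tendsto_Lp_def by (intro tendsto_power) auto
    then have l: "(\<lambda>n. LINT x|mu \<alpha>. (norm (H n x - h x))\<^sup>2) \<longlonglongrightarrow> 0"
      unfolding Lp_norm_square by simp
    have int: "integrable (mu \<alpha>) (\<lambda>x. (norm (H n x - h x))\<^sup>2)" for n
    proof (rule Bochner_Integration.integrable_bound)
      show "integrable (mu \<alpha>) (\<lambda>x. 2 * (norm (H n x))\<^sup>2 + 2 * (norm (h x))\<^sup>2)"
        by (intro Bochner_Integration.integrable_add integrable_mult_right Lp2_integrable H)
      show "(\<lambda>x. (norm (H n x - h x))\<^sup>2) \<in> borel_measurable (mu \<alpha>)"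
        using Lp2_integrable(1)[OF H(1)[of n]] Lp2_integrable(1)[OF H(2)] by measurable
      have "(norm (z - w))\<^sup>2 \<le> 2 * (norm z)\<^sup>2 + 2 * (norm w)\<^sup>2" for z w :: complex
      proof -
        have "(norm (z - w))\<^sup>2 \<le> (norm z + norm w)\<^sup>2" by (intro power_mono norm_triangle_ineq4) simp
        also have "\<dots> \<le> 2 * (norm z)\<^sup>2 + 2 * (norm w)\<^sup>2"
          using sum_squares_bound[of "norm z" "norm w"] by (simp add: power2_sum)
        finally show ?thesis .
      qed
      then show "AE x in mu \<alpha>. norm ((norm (H n x - h x))\<^sup>2) \<le> norm (2 * (norm (H n x))\<^sup>2 + 2 * (norm (h x))\<^sup>2)"
        by (intro AE_I2) simp
    qed
    have "(LINT x|mu \<alpha>. (T (H n x) - T (h x))\<^sup>2) \<le> (LINT x|mu \<alpha>. (norm (H n x - h x))\<^sup>2)" for n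
      unfolding T.diff[symmetric] using Lp2_integrable(1)[OF H(1)[of n]] Lp2_integrable(1)[OF H(2)]
      by (intro integral_mono T2[of "\<lambda>x. H n x - h x"] int T2_le borel_measurable_diff)
    moreover have "(LINT x|mu \<alpha>. (T (H n x) - T (h x))\<^sup>2) \<ge> 0" for n by simp
    ultimately show ?thesis by (intro tendsto_sandwich[OF _ _ tendsto_const l] always_eventually allI)
  qed
  have hank: "T (fourier_bessel \<alpha> (F n) y) = hankel \<alpha> (\<lambda>x. T (F n x)) y" for n y
  proof -
    let ?k = "\<lambda>x. bessel_j \<alpha> (2 * pi * x * y)"
    have km: "?k \<in> borel_measurable (mu \<alpha>)"
      by (intro measurable_borel_mu measurable_compose[OF _ measurable_bessel_j[OF al]]) measurable
    have F1: "integrable (mu \<alpha>) (F n)" by (rule Lp1_integrable[OF F(1)])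
    have "integrable (mu \<alpha>) (\<lambda>x. F n x * complex_of_real (?k x))"
    proof (rule Bochner_Integration.integrable_bound[OF F1])
      show "(\<lambda>x. F n x * complex_of_real (?k x)) \<in> borel_measurable (mu \<alpha>)"
        using borel_measurable_integrable[OF F1] km by measurable
      show "AE x in mu \<alpha>. norm (F n x * complex_of_real (?k x)) \<le> norm (F n x)"
        using bessel_j_le_1[OF al] by (intro AE_I2) (auto simp: norm_mult intro!: mult_left_le)
    qed
    then have "T (fourier_bessel \<alpha> (F n) y) = (LINT x|mu \<alpha>. T (F n x * complex_of_real (?k x)))"
      unfolding fourier_bessel_def by (rule integral_bounded_linear[OF T, symmetric])
    also have "(\<lambda>x. T (F n x * complex_of_real (?k x))) = (\<lambda>x. T (F n x) * ?k x)"
      using T.scaleR by (simp add: scaleR_conv_of_real mult.commute fun_eq_iff)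
    finally show ?thesis by (simp add: hankel_def)
  qed
  have f2: "f \<in> Lp \<alpha> 2" and g2: "g \<in> Lp \<alpha> 2" using Ff Fg by (auto simp: tendsto_Lp_def)
  show ?thesis
    unfolding hankel_L2_limit_def
  proof (intro conjI exI[of _ "\<lambda>n x. T (F n x)"] allI)
    show "(\<lambda>n. LINT x|mu \<alpha>. (hankel \<alpha> (\<lambda>x. T (F n x)) x - T (g x))\<^sup>2) \<longlonglongrightarrow> 0"
      using lim[OF Fg] by (simp add: hank)
    show "integrable (mu \<alpha>) (\<lambda>x. T (F n x))" for n
      by (rule integrable_bounded_linear[OF T Lp1_integrable[OF F(1)]])
  qed (intro Tm T2 lim[OF Ff] Lp2_integrable f2 g2 F)+
qed

text \<open>The order \<open>n - 1\<close> is the integer part of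
  \<open>80 sqrt 3 pi s / ln 2\<close>, half of the part of the exponent that depends on
  \<open>s\<close>. It is large enough because \<open>162 ln 2 \<le> 80 sqrt 3\<close>, and the base
  is below both \<open>\<gamma> / 72\<close> and
  \<open>\<gamma> / (12 (\<alpha> + 1))\<close>.\<close>

lemma exponent_constants:
  fixes \<alpha> \<gamma> s :: real
  assumes al: "\<alpha> \<ge> 0" and \<gamma>: "0 < \<gamma>" "\<gamma> \<le> 1" and s: "s \<ge> 0"
  obtains n :: nat where "n \<ge> 1" "real n \<ge> 162 * pi * s"
    and "(\<gamma> / (300 * 9 powr \<alpha>)) powr (160 * sqrt 3 * pi / ln 2 * s + \<alpha> * (ln 3 / ln 2) + 1)
      * (72 / \<gamma> * (12 * (\<alpha> + 1) / \<gamma>) ^ (2 * (n - 1))) \<le> 1"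
proof
  define P where "P = 160 * sqrt 3 * pi / ln 2 * s + \<alpha> * (ln 3 / ln 2) + 1"
  define B where "B = \<gamma> / (300 * 9 powr \<alpha>)"
  \<comment> \<open>\<open>n\<close> is \<open>N + 1\<close>, and \<open>2 N + 1\<close> is at most the exponent \<open>P\<close>\<close>
  define N where "N = nat \<lfloor>80 * sqrt 3 * pi / ln 2 * s\<rfloor>"
  have ln2: "0 < ln (2::real)" "ln (2::real) \<le> 25 / 36" using ln2_le_25_over_36 by auto
  have sqrt3: "sqrt 3 \<ge> 17 / 10" by (rule real_le_rsqrt) (simp add: power2_eq_square)
  have e0: "80 * sqrt 3 * pi / ln 2 * s \<ge> 0" using s ln2 by simp
  have N: "real N \<le> 80 * sqrt 3 * pi / ln 2 * s" "80 * sqrt 3 * pi / ln 2 * s < real N + 1"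
    using e0 by (auto simp: N_def)
  show "Suc N \<ge> 1" by simp
  have "162 * ln 2 \<le> 80 * sqrt (3::real)" using ln2 sqrt3 by linarith
  then have "162 \<le> 80 * sqrt 3 / ln (2::real)" using ln2 by (simp add: le_divide_eq)
  then have "162 * (pi * s) \<le> 80 * sqrt 3 / ln 2 * (pi * s)" using s by (intro mult_right_mono) auto
  also have "\<dots> = 80 * sqrt 3 * pi / ln 2 * s" by simp
  finally show "real (Suc N) \<ge> 162 * pi * s" using N(2) by simp
  have nine: "9 powr \<alpha> \<ge> \<alpha> + 1"
  proof -
    have "1 \<le> ln (9::real)" using exp_le by (subst ln_ge_iff) auto
    then have "\<alpha> * 1 \<le> \<alpha> * ln 9" using al by (intro mult_left_mono) auto
    then have "\<alpha> + 1 \<le> 1 + \<alpha> * ln 9" by simp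
    also have "\<dots> \<le> exp (\<alpha> * ln 9)" by (rule exp_ge_add_one_self)
    finally show ?thesis by (simp add: powr_def)
  qed
  then have nine1: "9 powr \<alpha> \<ge> 1" using al by simp
  define y where "y = 9 powr \<alpha>"
  have y: "\<alpha> + 1 \<le> y" "1 \<le> y" using nine nine1 by (simp_all add: y_def)
  have "B > 0" using \<gamma> by (simp add: B_def)
  moreover have "B \<le> \<gamma> / 72"
    unfolding B_def y_def[symmetric] using \<gamma> y by (intro divide_left_mono mult_pos_pos) linarith+
  moreover have "B \<le> \<gamma> / (12 * (\<alpha> + 1))"
  proof -
    have "12 * (\<alpha> + 1) \<le> 12 * y" using y by simp
    also have "\<dots> \<le> 300 * y" using y by simp
    finally show ?thesis
      unfolding B_def y_def[symmetric] using \<gamma> al y by (intro divide_left_mono) simp_all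
  qed
  ultimately have B: "B > 0" "B \<le> \<gamma> / 72" "B \<le> \<gamma> / (12 * (\<alpha> + 1))" .
  have "B \<le> 1" using B(2) \<gamma> by simp
  moreover have "real (2 * N + 1) \<le> P"
  proof -
    have "ln 3 / ln 2 \<ge> (0::real)" by simp
    then have "\<alpha> * (ln 3 / ln 2) \<ge> 0" using al by (rule mult_nonneg_nonneg[rotated])
    moreover have "160 * sqrt 3 * pi / ln 2 * s = 2 * (80 * sqrt 3 * pi / ln 2 * s)" by simp
    ultimately show ?thesis using N(1) unfolding P_def by simp
  qed
  ultimately have "B powr P \<le> B powr real (2 * N + 1)" using B(1) by (intro powr_mono') auto
  also have "\<dots> = B ^ (2 * N + 1)" using B(1) by (rule powr_realpow)
  also have "\<dots> = B * B ^ (2 * N)" by simp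
  also have "\<dots> \<le> \<gamma> / 72 * (\<gamma> / (12 * (\<alpha> + 1))) ^ (2 * N)"
    using B \<gamma> al by (intro mult_mono power_mono) auto
  finally have "B powr P * (72 / \<gamma> * (12 * (\<alpha> + 1) / \<gamma>) ^ (2 * N))
      \<le> (\<gamma> / 72 * (\<gamma> / (12 * (\<alpha> + 1))) ^ (2 * N)) * (72 / \<gamma> * (12 * (\<alpha> + 1) / \<gamma>) ^ (2 * N))"
    using \<gamma> al by (intro mult_right_mono) auto
  also have "\<dots> = (\<gamma> / (12 * (\<alpha> + 1)) * (12 * (\<alpha> + 1) / \<gamma>)) ^ (2 * N)"
  proof -
    have "(\<gamma> / 72 * p) * (72 / \<gamma> * q) = p * q" for p q using \<gamma> by simp
    then show ?thesis by (simp only: power_mult_distrib)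
  qed
  also have "\<gamma> / (12 * (\<alpha> + 1)) * (12 * (\<alpha> + 1) / \<gamma>) = 1" using \<gamma> al by simp
  finally show "(\<gamma> / (300 * 9 powr \<alpha>)) powr (160 * sqrt 3 * pi / ln 2 * s + \<alpha> * (ln 3 / ln 2) + 1)
      * (72 / \<gamma> * (12 * (\<alpha> + 1) / \<gamma>) ^ (2 * (Suc N - 1))) \<le> 1"
    by (simp add: B_def P_def)
qed

theorem theorem4p2:
  fixes \<alpha> a b \<gamma> :: real and f g :: "real \<Rightarrow> complex" and \<Omega> :: "real set"
  assumes "\<alpha> \<ge> 0" and "a > 0" and "b > 0" and "\<gamma> > 0"
    and "f \<in> Lp \<alpha> 2"
    and "is_fourier_bessel_L2 \<alpha> f g"
    and "AE y in mu \<alpha>. y \<notin> {0..b} \<longrightarrow> g y = 0"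
    and "relatively_dense \<alpha> \<gamma> a \<Omega>"
  shows "(Lp_norm_on \<alpha> 2 \<Omega> f)\<^sup>2 \<ge>
    2 / 3 * (\<gamma> / (300 * 9 powr \<alpha>))
      powr (160 * sqrt 3 * pi / ln 2 * (a * b) + \<alpha> * (ln 3 / ln 2) + 1)
    * (Lp_norm \<alpha> 2 f)\<^sup>2"
proof -
  note al = assms(1) and a = assms(2) and b = assms(3) and \<gamma> = assms(4)
  have \<Omega>: "\<Omega> \<in> sets (mu \<alpha>)"
    and dense: "\<And>x. x \<ge> a \<Longrightarrow> measure (mu \<alpha>) (\<Omega> \<inter> {x - a..x + a}) \<ge> \<gamma> * measure (mu \<alpha>) {x - a..x + a}"
    using assms(8) by (auto simp: relatively_dense_def)
  have half_open: "measure (mu \<alpha>) (A \<inter> {p..q}) = measure (mu \<alpha>) (A \<inter> {p..<q})"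
    if "A \<in> sets (mu \<alpha>)" "p \<ge> 0" for A p q
  proof (rule measure_eq_AE)
    have "{p..q} \<in> sets (mu \<alpha>)" "{p..<q} \<in> sets (mu \<alpha>)"
      using that(2) by (auto intro!: sets_borel_mu)
    then show "A \<inter> {p..q} \<in> sets (mu \<alpha>)" "A \<inter> {p..<q} \<in> sets (mu \<alpha>)"
      using that(1) by blast+
    show "AE x in mu \<alpha>. x \<in> A \<inter> {p..q} \<longleftrightarrow> x \<in> A \<inter> {p..<q}"
      using AE_mu_neq[OF al, of q] by eventually_elim auto
  qed
  have S0: "{0..} \<in> sets (mu \<alpha>)" using sets.top[of "mu \<alpha>"] by simp
  have dense': "measure (mu \<alpha>) (\<Omega> \<inter> {2 * a * real j..<2 * a * real j + 2 * a})
      \<ge> \<gamma> * measure (mu \<alpha>) {2 * a * real j..<2 * a * real j + 2 * a}" for j :: nat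
  proof -
    let ?p = "2 * a * real j"
    have p: "?p \<ge> 0" using a by simp
    have eq: "{0..} \<inter> {r..<q} = {r..<q}" "{0..} \<inter> {r..q} = {r..q}" if "r \<ge> 0" for r q :: real
      using that by auto
    have "measure (mu \<alpha>) (\<Omega> \<inter> {?p..?p + 2 * a}) \<ge> \<gamma> * measure (mu \<alpha>) {?p..?p + 2 * a}"
      using dense[of "?p + a"] p by (simp add: algebra_simps)
    then show ?thesis
      using half_open[OF \<Omega> p, of "?p + 2 * a"] half_open[OF S0 p, of "?p + 2 * a"] unfolding eq[OF p] by simp
  qed
  have \<gamma>1: "\<gamma> \<le> 1"
  proof -
    have If: "{0..2 * a} \<in> fmeasurable (mu \<alpha>)"
      by (rule fmeasurable_mu_bounded[OF al, of _ 0 "2 * a"]) (auto intro!: sets_borel_mu)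
    have "\<gamma> * measure (mu \<alpha>) {0..2 * a} \<le> measure (mu \<alpha>) (\<Omega> \<inter> {0..2 * a})" using dense[of a] by simp
    also have "\<dots> \<le> measure (mu \<alpha>) {0..2 * a}"
      using If \<Omega> by (intro measure_mono_fmeasurable sets.Int) (auto simp: fmeasurable_def)
    finally have "\<gamma> * measure (mu \<alpha>) {0..2 * a} \<le> 1 * measure (mu \<alpha>) {0..2 * a}" by simp
    moreover have "measure (mu \<alpha>) {0..2 * a} > 0"
      using a mu_cdf_strict_mono[OF al order.refl, of "2 * a"]
      by (simp add: measure_def emeasure_mu_interval[OF al])
    ultimately show ?thesis by (simp only: mult_le_cancel_right_pos)
  qed
  obtain n where n: "n \<ge> 1" "real n \<ge> 162 * pi * (a * b)"
    and const: "(\<gamma> / (300 * 9 powr \<alpha>)) powr (160 * sqrt 3 * pi / ln 2 * (a * b) + \<alpha> * (ln 3 / ln 2) + 1)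
      * (72 / \<gamma> * (12 * (\<alpha> + 1) / \<gamma>) ^ (2 * (n - 1))) \<le> 1"
    using exponent_constants[OF al \<gamma> \<gamma>1, of "a * b"] a b by auto
  define Q where "Q = (\<gamma> / (300 * 9 powr \<alpha>)) powr (160 * sqrt 3 * pi / ln 2 * (a * b) + \<alpha> * (ln 3 / ln 2) + 1)"
  define K where "K = 72 / \<gamma> * (12 * (\<alpha> + 1) / \<gamma>) ^ (2 * (n - 1))"
  define W where "W h = (LINT x|mu \<alpha>. (h x)\<^sup>2 * indicator \<Omega> x)" for h :: "real \<Rightarrow> real"
  define U where "U h = (LINT x|mu \<alpha>. (h x)\<^sup>2)" for h :: "real \<Rightarrow> real"
  let ?re = "\<lambda>x. Re (f x)" and ?im = "\<lambda>x. Im (f x)"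
  have re: "hankel_L2_limit \<alpha> ?re (\<lambda>x. Re (g x))"
    by (rule hankel_L2_limit_component[OF al assms(6) bounded_linear_Re abs_Re_le_cmod])
  have im: "hankel_L2_limit \<alpha> ?im (\<lambda>x. Im (g x))"
    by (rule hankel_L2_limit_component[OF al assms(6) bounded_linear_Im abs_Im_le_cmod])
  have "2 / 3 * U ?re \<le> K * W ?re"
    unfolding U_def W_def K_def
    by (rule real_valued_estimate[OF al a b \<gamma> re _ \<Omega> dense' n]) (use assms(7) in eventually_elim, simp)
  moreover have "2 / 3 * U ?im \<le> K * W ?im"
    unfolding U_def W_def K_def
    by (rule real_valued_estimate[OF al a b \<gamma> im _ \<Omega> dense' n]) (use assms(7) in eventually_elim, simp)
  ultimately have "2 / 3 * (U ?re + U ?im) \<le> K * (W ?re + W ?im)" by (simp add: distrib_left)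
  then have "Q * (2 / 3 * (U ?re + U ?im)) \<le> Q * (K * (W ?re + W ?im))"
    by (intro mult_left_mono) (auto simp: Q_def)
  also have "\<dots> = (Q * K) * (W ?re + W ?im)" by simp
  also have "\<dots> \<le> 1 * (W ?re + W ?im)"
  proof (rule mult_right_mono)
    show "Q * K \<le> 1" using const by (simp add: Q_def K_def)
    show "W ?re + W ?im \<ge> 0" unfolding W_def by (intro add_nonneg_nonneg integral_nonneg_AE) auto
  qed
  finally have main: "2 / 3 * Q * (U ?re + U ?im) \<le> W ?re + W ?im" by (simp add: mult_ac)
  have i: "integrable (mu \<alpha>) (\<lambda>x. (?re x)\<^sup>2)" "integrable (mu \<alpha>) (\<lambda>x. (?im x)\<^sup>2)"
    using re im by (auto simp: hankel_L2_limit_def)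
  have "(Lp_norm \<alpha> 2 f)\<^sup>2 = U ?re + U ?im"
    unfolding Lp_norm_square cmod_power2 U_def by (rule Bochner_Integration.integral_add[OF i])
  moreover have "(Lp_norm_on \<alpha> 2 \<Omega> f)\<^sup>2 = W ?re + W ?im"
    unfolding Lp_norm_on_square cmod_power2 W_def distrib_right
    by (intro Bochner_Integration.integral_add integrable_real_mult_indicator \<Omega> i)
  ultimately show ?thesis using main by (simp add: Q_def)
qed

end
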